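(* Let $\mathfrak g$ be a reductive Lie algebra over $\mathbb C$ with a symmetric non-degenerate invariant bilinear form $\langle\cdot\mid\cdot\rangle$, let $f\in\mathfrak g$ be nilpotent, embedded in an $\mathfrak{sl}_2$-triple $(f,2x,e)$, and let $\phi:\mathfrak g\to\operatorname{End}(V)$ be a faithful finite-dimensional representation. Let $\tfrac{\xi}{2}$ be the largest eigenvalue of $x$ on $V$. Suppose that $V$ has highest weight vectors for the $\mathfrak{sl}_2$-triple $(f,2x,e)$ of different weights (weights always meaning $x$-eigenvalues). Let $l\in\frac12\mathbb Z$ be the largest number such that $l<\xi/2$ and $l$ is the weight of a highest weight vector in $V$. Let $b\in\frac12\mathbb Z$ be such that $b>\xi/2-l$. Let $W$ be the subspace of $V$ spanned by the lowest weight vectors of weight $-l$. Then the coefficients of $z^{-b}$ in $\Pi_W L_R(z)\Psi_{-\xi/2}\,\bar 1$ are in the finite $W$-algebra $U(\mathfrak g,f)$ (that is, all matrix entries of the $z^{-b}$ coefficient lie in $U(\mathfrak g,f)$). Here $L_R(z)$ is the right handed Lax type operator defined in the context.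
   Context: Finite $W$-algebra: for $k\in\frac12\mathbb Z$ let $\mathfrak g_k$ be the $k$-eigenspace of $\operatorname{ad}x$ on $\mathfrak g$, with $\mathfrak g_{\ge k}$, $\mathfrak g_{\le k}$ the obvious sums. Let $J$ be the left ideal of $U(\mathfrak g)$ generated by $\{m-\langle f\mid m\rangle : m\in\mathfrak g_{\ge1}\}$. Then $U(\mathfrak g,f)=(U(\mathfrak g)/J)^{\mathfrak g_{\ge1/2}}$, the invariants for the action of $\mathfrak g_{\ge 1/2}$ on $U(\mathfrak g)/J$ induced by the adjoint action. $\bar 1$ is the image of $1$ in $U(\mathfrak g)/J$; for an operator $A$ with coefficients in $U(\mathfrak g)$, $A\bar 1$ is obtained by replacing each coefficient by its image in $U(\mathfrak g)/J$. Weight spaces: $V[k]$ is the $k$-eigenspace of $\phi(x)$ on $V$; $V[<k]$, $V[>k]$, etc. are the obvious sums. $\Pi_{<k}$ denotes the projection of $V$ onto $V[<k]$ along the other weight spaces, and $\Psi_{k}$, $\Psi_{>k}$ denote the inclusions of $V[k]$, $V[>k]$ into $V$. $\Pi_W$ is the projection of $V$ onto $W$ along the span of the other weight vectors, i.e. along all weight spaces $V[j]$, $j\ne -l$, and the intersection of $V[-l]$ with the sum of the $\mathfrak{sl}_2$-isotypic components of $V$ whose highest $x$-weight differs from $l$. Operators: let $\{u_i\}$ be a basis of $\mathfrak g$ of $\operatorname{ad}x$-eigenvectors, $\{u^i\}$ the dual basis with respect to the form, $U_i=\phi(u_i)$, $U^i=\phi(u^i)$, $F=\phi(f)$, and $\delta(u_i)$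 the $\operatorname{ad}x$-eigenvalue of $u_i$. Put $D=\sum_{u_i\in\mathfrak g_{\ge1}}U^iU_i\in\operatorname{End}(V)$ and $$Y=\mathbb 1_V+F+\sum_{u_i\in\mathfrak g_{\le1/2}}z^{\delta(u_i)-1}u_i\otimes U^i+z^{-1}D\in U(\mathfrak g)[[z^{-1/2}]]\otimes\operatorname{End}(V),$$ sums running over basis elements in the indicated subspace. Products are matrix products with entries in the noncommutative ring $U(\mathfrak g)[[z^{-1/2}]]$. The operator $\Pi_{<\xi/2}Y\Psi_{>-\xi/2}$ (from $V[>-\xi/2]$ to $V[<\xi/2]$) is invertible, and $$L_R(z)=\left(\Pi_{<\xi/2}Y\Psi_{>-\xi/2}\right)^{-1}\Pi_{<\xi/2}Y\Psi_{-\xi/2}\in U(\mathfrak g)[[z^{-1/2}]]\otimes\operatorname{Hom}(V[-\tfrac{\xi}{2}],V[>-\tfrac{\xi}{2}]).$$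
   Formalization: The operator D is taken with a minus sign, D = -\sum_{u_i\in\mathfrak g_{\ge1}} U^iU_i; with the plus sign printed in the context the claim fails, e.g. for gl_3 acting on C^3 with f = e_{21} and b = 3/2. *)

theory Defs
  imports
    "HOL-Analysis.Analysis"
    "HOL-Library.Poly_Mapping"
    "HOL-Computational_Algebra.Formal_Power_Series"
begin

section \<open>Complex Lie algebras\<close>

class complex_lie_algebra = ab_group_add +
  fixes cscale :: "complex \<Rightarrow> 'a \<Rightarrow> 'a"  (infixr "*\<^sub>C" 75)
    and lie :: "'a \<Rightarrow> 'a \<Rightarrow> 'a"
  assumes cscale_right_distrib: "c *\<^sub>C (a + b) = c *\<^sub>C a + c *\<^sub>C b"
    and cscale_left_distrib: "(c + d) *\<^sub>C a = c *\<^sub>C a + d *\<^sub>C a"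
    and cscale_cscale: "c *\<^sub>C d *\<^sub>C a = (c * d) *\<^sub>C a"
    and cscale_one: "1 *\<^sub>C a = a"
    and lie_add_left: "lie (a + b) y = lie a y + lie b y"
    and lie_add_right: "lie y (a + b) = lie y a + lie y b"
    and lie_cscale_left: "lie (c *\<^sub>C a) y = c *\<^sub>C lie a y"
    and lie_cscale_right: "lie y (c *\<^sub>C a) = c *\<^sub>C lie y a"
    and lie_self: "lie a a = 0"
    and jacobi: "lie a (lie b y) + lie b (lie y a) + lie y (lie a b) = 0"

interpretation lie_vs: vector_space
  "cscale :: complex \<Rightarrow> 'a \<Rightarrow> 'a::complex_lie_algebra"
  by unfold_locales
    (simp_all add: cscale_right_distrib cscale_left_distrib cscale_cscale cscale_one)

definition lie_ideal :: "'a::complex_lie_algebra set \<Rightarrow> bool" where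
  "lie_ideal I \<longleftrightarrow> lie_vs.subspace I \<and> (\<forall>a. \<forall>b\<in>I. lie a b \<in> I)"

text \<open>Finite-dimensional with completely reducible adjoint representation.\<close>

definition reductive :: "'a::complex_lie_algebra itself \<Rightarrow> bool" where
  "reductive _ \<longleftrightarrow>
     (\<exists>B::'a set. finite B \<and> lie_vs.span B = UNIV) \<and>
     (\<forall>I::'a set. lie_ideal I \<longrightarrow>
        (\<exists>I'. lie_ideal I' \<and> I \<inter> I' = {0} \<and> (\<forall>a. \<exists>b\<in>I. \<exists>c\<in>I'. a = b + c)))"

definition sym_nondeg_invariant_form ::
  "('a::complex_lie_algebra \<Rightarrow> 'a \<Rightarrow> complex) \<Rightarrow> bool" where
  "sym_nondeg_invariant_form B \<longleftrightarrow>
     (\<forall>a b c. B (a + b) c = B a c + B b c) \<and>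
     (\<forall>k a b. B (k *\<^sub>C a) b = k * B a b) \<and>
     (\<forall>a b. B a b = B b a) \<and>
     (\<forall>a. (\<forall>b. B a b = 0) \<longrightarrow> a = 0) \<and>
     (\<forall>a b c. B (lie a b) c = B a (lie b c))"

definition ad_nilpotent :: "'a::complex_lie_algebra \<Rightarrow> bool" where
  "ad_nilpotent f \<longleftrightarrow> (\<exists>n. \<forall>a. (lie f ^^ n) a = 0)"

text \<open>\<open>(f, 2x, e)\<close> is an \<open>sl\<^sub>2\<close>-triple; the relations are written for \<open>x\<close>, half the neutral
  element.\<close>

definition sl2_triple :: "'a::complex_lie_algebra \<Rightarrow> 'a \<Rightarrow> 'a \<Rightarrow> bool" where
  "sl2_triple f x e \<longleftrightarrow> lie x e = e \<and> lie x f = - f \<and> lie e f = 2 *\<^sub>C x"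

definition half_ints :: "real set" where
  "half_ints = {k. \<exists>n::int. k = of_int n / 2}"

definition ad_space :: "'a::complex_lie_algebra \<Rightarrow> real \<Rightarrow> 'a set" where
  "ad_space x k = {a. lie x a = complex_of_real k *\<^sub>C a}"

text \<open>\<open>ad_sum x {k..}\<close> is \<open>g\<^bsub>\<ge>k\<^esub>\<close> and \<open>ad_sum x {..k}\<close> is \<open>g\<^bsub>\<le>k\<^esub>\<close>.  Indexing by all reals
  rather than by half-integers adds only zero eigenspaces; the same remark applies to the
  weight spaces below.\<close>

definition ad_sum :: "'a::complex_lie_algebra \<Rightarrow> real set \<Rightarrow> 'a set" where
  "ad_sum x K = lie_vs.span (\<Union>k\<in>K. ad_space x k)"

definition ad_eigenbasis :: "'a::complex_lie_algebra \<Rightarrow> 'a set \<Rightarrow> bool" where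
  "ad_eigenbasis x B \<longleftrightarrow> lie_vs.independent B \<and> lie_vs.span B = UNIV \<and>
     (\<forall>u\<in>B. \<exists>c. lie x u = c *\<^sub>C u)"

definition ad_weight :: "'a::complex_lie_algebra \<Rightarrow> 'a \<Rightarrow> real" where
  "ad_weight x u = (THE k. u \<in> ad_space x k)"

definition dual_elt ::
  "('a::complex_lie_algebra \<Rightarrow> 'a \<Rightarrow> complex) \<Rightarrow> 'a set \<Rightarrow> 'a \<Rightarrow> 'a" where
  "dual_elt form B u = (THE v. \<forall>w\<in>B. form w v = (if w = u then 1 else 0))"


section \<open>The universal enveloping algebra\<close>

text \<open>The free algebra on the set underlying \<open>g\<close> is the monoid algebra of the free monoid;
  \<open>U(g)\<close> is its quotient by the relations making \<open>a \<mapsto> gen a\<close> linear and compatible with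
  brackets.\<close>

datatype 'a free_mon = Free_Mon (letters: "'a list")

instantiation free_mon :: (type) monoid_add
begin
definition zero_free_mon :: "'a free_mon" where "0 = Free_Mon []"
definition plus_free_mon :: "'a free_mon \<Rightarrow> 'a free_mon \<Rightarrow> 'a free_mon" where
  "v + w = Free_Mon (letters v @ letters w)"
instance by standard (simp_all add: zero_free_mon_def plus_free_mon_def)
end

lemma free_mon_add_eq_0: "v + w = 0 \<longleftrightarrow> v = 0 \<and> w = (0 :: 'a free_mon)"
  by (cases v; cases w) (simp add: zero_free_mon_def plus_free_mon_def)

type_synonym 'a free_alg = "'a free_mon \<Rightarrow>\<^sub>0 complex"

abbreviation free_gen :: "'a \<Rightarrow> 'a free_alg" where
  "free_gen a \<equiv> Poly_Mapping.single (Free_Mon [a]) 1"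

abbreviation free_const :: "complex \<Rightarrow> 'a free_alg" where
  "free_const c \<equiv> Poly_Mapping.single 0 c"

inductive_set uea_rel :: "'a::complex_lie_algebra free_alg set" where
  rel_add: "free_gen (a + b) - free_gen a - free_gen b \<in> uea_rel"
| rel_scale: "free_gen (c *\<^sub>C a) - free_const c * free_gen a \<in> uea_rel"
| rel_lie: "free_gen a * free_gen b - free_gen b * free_gen a - free_gen (lie a b) \<in> uea_rel"

inductive_set uea_ideal :: "'a::complex_lie_algebra free_alg set" where
  ideal_zero: "0 \<in> uea_ideal"
| ideal_rel: "r \<in> uea_rel \<Longrightarrow> p * r * q \<in> uea_ideal"
| ideal_add: "r \<in> uea_ideal \<Longrightarrow> s \<in> uea_ideal \<Longrightarrow> r + s \<in> uea_ideal"

lemma uea_ideal_mult: "r \<in> uea_ideal \<Longrightarrow> p * r * q \<in> uea_ideal"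
proof (induction rule: uea_ideal.induct)
  case (ideal_rel r p' q')
  have "p * (p' * r * q') * q = (p * p') * r * (q' * q)" by (simp add: mult.assoc)
  then show ?case using uea_ideal.ideal_rel[OF ideal_rel] by metis
qed (auto simp: distrib_left distrib_right intro: uea_ideal.intros)

lemma uea_ideal_lmult: "r \<in> uea_ideal \<Longrightarrow> p * r \<in> uea_ideal"
  using uea_ideal_mult[of r p 1] by simp

lemma uea_ideal_rmult: "r \<in> uea_ideal \<Longrightarrow> r * q \<in> uea_ideal"
  using uea_ideal_mult[of r 1 q] by simp

lemma uea_ideal_uminus: "r \<in> uea_ideal \<Longrightarrow> - r \<in> uea_ideal"
  using uea_ideal_lmult[of r "- 1"] by simp

lemma lookup_mult_zero_word:
  fixes p q :: "'a free_alg"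
  shows "Poly_Mapping.lookup (p * q) 0 = Poly_Mapping.lookup p 0 * Poly_Mapping.lookup q 0"
proof -
  have eq: "(\<Sum>w'. Poly_Mapping.lookup q w' when (0::'a free_mon) = w + w') = (Poly_Mapping.lookup q 0 when w = 0)" for w
  proof -
    have "(\<Sum>w'. Poly_Mapping.lookup q w' when (0::'a free_mon) = w + w')
        = (\<Sum>w'. (Poly_Mapping.lookup q w' when w = 0) when w' = 0)"
      by (rule arg_cong[where f = Sum_any])
        (auto simp: fun_eq_iff when_def free_mon_add_eq_0 eq_commute[of 0])
    then show ?thesis by simp
  qed
  have "Poly_Mapping.lookup (p * q) 0 = (\<Sum>w. Poly_Mapping.lookup p w * (\<Sum>w'. Poly_Mapping.lookup q w' when 0 = w + w'))"
    by (simp add: times_poly_mapping.rep_eq prod_fun_def)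
  also have "\<dots> = (\<Sum>w. (Poly_Mapping.lookup p w * Poly_Mapping.lookup q 0) when w = 0)"
    unfolding eq by (simp add: mult_when)
  finally show ?thesis by simp
qed

lemma lookup_zero_word_gen: "Poly_Mapping.lookup (free_gen a) 0 = 0"
  by (simp add: lookup_single when_def zero_free_mon_def)

lemma lookup_zero_word_uea_rel: "r \<in> uea_rel \<Longrightarrow> Poly_Mapping.lookup r 0 = 0"
  by (induction rule: uea_rel.induct)
    (simp_all add: lookup_minus lookup_mult_zero_word lookup_zero_word_gen)

lemma lookup_zero_word_uea_ideal: "r \<in> uea_ideal \<Longrightarrow> Poly_Mapping.lookup r 0 = 0"
  by (induction rule: uea_ideal.induct)
    (simp_all add: lookup_add lookup_mult_zero_word lookup_zero_word_uea_rel)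

lemma one_notin_uea_ideal: "1 \<notin> uea_ideal"
  using lookup_zero_word_uea_ideal[of 1] by (auto simp: lookup_one)

quotient_type (overloaded) 'a uea =
  "'a::complex_lie_algebra free_alg" / "\<lambda>p q. p - q \<in> uea_ideal"
proof (rule equivpI)
  show "reflp (\<lambda>p q :: 'a free_alg. p - q \<in> uea_ideal)"
    by (auto intro!: reflpI ideal_zero)
  show "symp (\<lambda>p q :: 'a free_alg. p - q \<in> uea_ideal)"
    by (auto intro!: sympI dest: uea_ideal_uminus)
  show "transp (\<lambda>p q :: 'a free_alg. p - q \<in> uea_ideal)"
    by (auto intro!: transpI dest: ideal_add)
qed

instantiation uea :: (complex_lie_algebra) ring_1
begin

lift_definition zero_uea :: "'a uea" is 0 .
lift_definition one_uea :: "'a uea" is 1 .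
lift_definition plus_uea :: "'a uea \<Rightarrow> 'a uea \<Rightarrow> 'a uea" is "(+)"
  by (auto simp: add_diff_add intro: ideal_add)
lift_definition uminus_uea :: "'a uea \<Rightarrow> 'a uea" is uminus
  by (metis uea_ideal_uminus minus_diff_minus)
lift_definition minus_uea :: "'a uea \<Rightarrow> 'a uea \<Rightarrow> 'a uea" is "(-)"
proof -
  fix p p' q q' :: "'a free_alg"
  assume "p - p' \<in> uea_ideal" "q - q' \<in> uea_ideal"
  then have "(p - p') + - (q - q') \<in> uea_ideal"
    by (intro ideal_add uea_ideal_uminus)
  then show "p - q - (p' - q') \<in> uea_ideal" by (simp add: algebra_simps)
qed
lift_definition times_uea :: "'a uea \<Rightarrow> 'a uea \<Rightarrow> 'a uea" is "(*)"
proof -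
  fix p p' q q' :: "'a free_alg"
  assume "p - p' \<in> uea_ideal" "q - q' \<in> uea_ideal"
  then have "(p - p') * q + p' * (q - q') \<in> uea_ideal"
    by (intro ideal_add uea_ideal_lmult uea_ideal_rmult)
  then show "p * q - p' * q' \<in> uea_ideal" by (simp add: algebra_simps)
qed

instance
proof
  show "(0 :: 'a uea) \<noteq> 1"
    by transfer (use one_notin_uea_ideal uea_ideal_uminus in fastforce)
qed (transfer; simp add: algebra_simps ideal_zero)+

end

lift_definition uea_gen :: "'a::complex_lie_algebra \<Rightarrow> 'a uea" is free_gen .
lift_definition uea_const :: "complex \<Rightarrow> 'a::complex_lie_algebra uea" is free_const .


section \<open>The finite W-algebra\<close>

definition left_ideal :: "'r::ring_1 set \<Rightarrow> bool" where
  "left_ideal I \<longleftrightarrow> 0 \<in> I \<and> (\<forall>a\<in>I. \<forall>b\<in>I. a + b \<in> I) \<and> (\<forall>r. \<forall>a\<in>I. r * a \<in> I)"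

definition W_ideal ::
  "('a::complex_lie_algebra \<Rightarrow> 'a \<Rightarrow> complex) \<Rightarrow> 'a \<Rightarrow> 'a \<Rightarrow> 'a uea set" where
  "W_ideal form f x =
     \<Inter>{I. left_ideal I \<and> {uea_gen m - uea_const (form f m) |m. m \<in> ad_sum x {1..}} \<subseteq> I}"

text \<open>The image of \<open>a \<in> U(g)\<close> in \<open>U(g)/J\<close>; for a coefficient \<open>a\<close> of an operator \<open>A\<close> this is the
  corresponding coefficient of \<open>A\<close> applied to the image of \<open>1\<close>.\<close>

definition quot_class :: "'r::ring_1 set \<Rightarrow> 'r \<Rightarrow> 'r set" where
  "quot_class J a = {b. b - a \<in> J}"

text \<open>\<open>U(g,f)\<close> as a set of classes in \<open>U(g)/J\<close>; the action induced by \<open>ad m\<close> on the class of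
  \<open>a\<close> is the class of the commutator of \<open>m\<close> and \<open>a\<close>.\<close>

definition finite_W_algebra ::
  "('a::complex_lie_algebra \<Rightarrow> 'a \<Rightarrow> complex) \<Rightarrow> 'a \<Rightarrow> 'a \<Rightarrow> 'a uea set set" where
  "finite_W_algebra form f x =
     {quot_class (W_ideal form f x) a |a.
        \<forall>m\<in>ad_sum x {1/2..}.
          quot_class (W_ideal form f x) (uea_gen m * a - a * uea_gen m)
            = quot_class (W_ideal form f x) 0}"


section \<open>Representations and weight spaces\<close>

text \<open>A finite-dimensional space \<open>V\<close> is taken as \<open>complex ^ 'n\<close>, so \<open>End(V)\<close> is
  \<open>complex ^ 'n ^ 'n\<close>.\<close>

definition representation ::
  "('a::complex_lie_algebra \<Rightarrow> complex ^ 'n ^ 'n) \<Rightarrow> bool" where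
  "representation \<phi> \<longleftrightarrow>
     (\<forall>a b. \<phi> (a + b) = \<phi> a + \<phi> b) \<and>
     (\<forall>c a. \<phi> (c *\<^sub>C a) = mat c ** \<phi> a) \<and>
     (\<forall>a b. \<phi> (lie a b) = \<phi> a ** \<phi> b - \<phi> b ** \<phi> a)"

definition faithful_representation ::
  "('a::complex_lie_algebra \<Rightarrow> complex ^ 'n ^ 'n) \<Rightarrow> bool" where
  "faithful_representation \<phi> \<longleftrightarrow> representation \<phi> \<and> inj \<phi>"

text \<open>In the following \<open>X\<close>, \<open>E\<close>, \<open>F\<close> stand for the images of \<open>x\<close>, \<open>e\<close>, \<open>f\<close> in \<open>End(V)\<close>.\<close>

definition weight_space :: "complex ^ 'n ^ 'n \<Rightarrow> real \<Rightarrow> (complex ^ 'n) set" where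
  "weight_space X k = {v. X *v v = complex_of_real k *s v}"

definition weight_sum :: "complex ^ 'n ^ 'n \<Rightarrow> real set \<Rightarrow> (complex ^ 'n) set" where
  "weight_sum X K = vec.span (\<Union>k\<in>K. weight_space X k)"

definition is_weight :: "complex ^ 'n ^ 'n \<Rightarrow> real \<Rightarrow> bool" where
  "is_weight X k \<longleftrightarrow> (\<exists>v\<in>weight_space X k. v \<noteq> 0)"

definition highest_weight_vector ::
  "complex ^ 'n ^ 'n \<Rightarrow> complex ^ 'n ^ 'n \<Rightarrow> real \<Rightarrow> complex ^ 'n \<Rightarrow> bool" where
  "highest_weight_vector X E k v \<longleftrightarrow> v \<noteq> 0 \<and> v \<in> weight_space X k \<and> E *v v = 0"

definition lowest_weight_vector ::
  "complex ^ 'n ^ 'n \<Rightarrow> complex ^ 'n ^ 'n \<Rightarrow> real \<Rightarrow> complex ^ 'n \<Rightarrow> bool" where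
  "lowest_weight_vector X F k v \<longleftrightarrow> v \<noteq> 0 \<and> v \<in> weight_space X k \<and> F *v v = 0"

definition sl2_submodule ::
  "complex ^ 'n ^ 'n \<Rightarrow> complex ^ 'n ^ 'n \<Rightarrow> complex ^ 'n ^ 'n \<Rightarrow> (complex ^ 'n) set \<Rightarrow> bool" where
  "sl2_submodule X E F S \<longleftrightarrow> vec.subspace S \<and>
     (\<forall>v\<in>S. X *v v \<in> S \<and> E *v v \<in> S \<and> F *v v \<in> S)"

definition sl2_irreducible ::
  "complex ^ 'n ^ 'n \<Rightarrow> complex ^ 'n ^ 'n \<Rightarrow> complex ^ 'n ^ 'n \<Rightarrow> (complex ^ 'n) set \<Rightarrow> bool" where
  "sl2_irreducible X E F S \<longleftrightarrow> sl2_submodule X E F S \<and> S \<noteq> {0} \<and>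
     (\<forall>T. sl2_submodule X E F T \<and> T \<subseteq> S \<longrightarrow> T = {0} \<or> T = S)"

definition isotypic_component ::
  "complex ^ 'n ^ 'n \<Rightarrow> complex ^ 'n ^ 'n \<Rightarrow> complex ^ 'n ^ 'n \<Rightarrow> real \<Rightarrow> (complex ^ 'n) set" where
  "isotypic_component X E F k =
     vec.span (\<Union>{S. sl2_irreducible X E F S \<and> (\<exists>v\<in>S. highest_weight_vector X E k v)})"

text \<open>The projection of \<open>V = A \<oplus> B\<close> onto \<open>A\<close> along \<open>B\<close>, as an endomorphism of \<open>V\<close>.\<close>

definition proj_along ::
  "(complex ^ 'n) set \<Rightarrow> (complex ^ 'n) set \<Rightarrow> complex ^ 'n ^ 'n" where
  "proj_along A B = (THE P. (\<forall>v\<in>A. P *v v = v) \<and> (\<forall>v\<in>B. P *v v = 0))"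

text \<open>For sums of weight spaces \<open>S\<close>, \<open>T\<close> we identify \<open>Hom(S,T)\<close> with the endomorphisms of \<open>V\<close>
  that vanish on the weight spaces outside \<open>S\<close> and have values in \<open>T\<close>.  Under this
  identification both the projection of \<open>V\<close> onto \<open>S\<close> and the inclusion of \<open>S\<close> into \<open>V\<close> are the
  idempotent \<open>weight_proj\<close>: \<open>\<Pi>\<^bsub><k\<^esub>\<close>, \<open>\<Psi>\<^bsub>>k\<^esub>\<close>, \<open>\<Psi>\<^bsub>k\<^esub>\<close> are \<open>weight_proj X {..<k}\<close>,
  \<open>weight_proj X {k<..}\<close>, \<open>weight_proj X {k}\<close>.\<close>

definition weight_proj :: "complex ^ 'n ^ 'n \<Rightarrow> real set \<Rightarrow> complex ^ 'n ^ 'n" where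
  "weight_proj X K = proj_along (weight_sum X K) (weight_sum X (- K))"

definition W_space ::
  "complex ^ 'n ^ 'n \<Rightarrow> complex ^ 'n ^ 'n \<Rightarrow> real \<Rightarrow> (complex ^ 'n) set" where
  "W_space X F l = vec.span {v. lowest_weight_vector X F (- l) v}"

definition W_proj ::
  "complex ^ 'n ^ 'n \<Rightarrow> complex ^ 'n ^ 'n \<Rightarrow> complex ^ 'n ^ 'n \<Rightarrow> real \<Rightarrow> complex ^ 'n ^ 'n" where
  "W_proj X E F l = proj_along (W_space X F l)
     (vec.span (weight_sum X (- {- l}) \<union>
        (weight_space X (- l) \<inter> vec.span (\<Union>k\<in>- {l}. isotypic_component X E F k))))"


section \<open>The right handed Lax type operator\<close>

text \<open>\<open>U(g)[[z\<^sup>-\<^sup>1\<^sup>/\<^sup>2]] \<otimes> End(V)\<close> is the type \<open>'a uea fps ^ 'n ^ 'n\<close> with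
  \<open>fps_X = z\<^sup>-\<^sup>1\<^sup>/\<^sup>2\<close>.  \<open>z_tensor p a M\<close> is \<open>z\<^sup>-\<^sup>p a \<otimes> M\<close> for a half-integer \<open>p \<ge> 0\<close>, and
  \<open>z_coeff b A\<close> is the coefficient of \<open>z\<^sup>-\<^sup>b\<close>.\<close>

definition z_tensor ::
  "real \<Rightarrow> 'a::complex_lie_algebra uea \<Rightarrow> complex ^ 'n ^ 'm \<Rightarrow> 'a uea fps ^ 'n ^ 'm" where
  "z_tensor p a M = (\<chi> i j. fps_const (a * uea_const (M $ i $ j)) * fps_X ^ nat \<lfloor>2 * p\<rfloor>)"

definition z_coeff ::
  "real \<Rightarrow> 'a::complex_lie_algebra uea fps ^ 'n ^ 'm \<Rightarrow> 'a uea ^ 'n ^ 'm" where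
  "z_coeff b A = (\<chi> i j. fps_nth (A $ i $ j) (nat \<lfloor>2 * b\<rfloor>))"

abbreviation const_op :: "complex ^ 'n ^ 'm \<Rightarrow> 'a::complex_lie_algebra uea fps ^ 'n ^ 'm" where
  "const_op M \<equiv> z_tensor 0 1 M"

text \<open>The minus sign is essential: with the opposite sign the coefficients are not invariant.
  Take \<open>g = gl\<^sub>3\<close> with the trace form, acting on \<open>V = \<complex>\<^sup>3\<close>, with \<open>f = e\<^sub>2\<^sub>1\<close>,
  \<open>x = (e\<^sub>1\<^sub>1 - e\<^sub>2\<^sub>2)/2\<close> and \<open>e = e\<^sub>1\<^sub>2\<close>, so that \<open>e\<^sub>1\<^sub>2 = 1\<close> in \<open>U(g)/J\<close>.  The operator obtained from
  \<open>s\<close> times the sum below has as its \<open>z\<^sup>-\<^sup>3\<^sup>/\<^sup>2\<close> coefficient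
  \<open>w = e\<^sub>2\<^sub>3 - e\<^sub>1\<^sub>3 (e\<^sub>2\<^sub>2 + s) + (e\<^sub>3\<^sub>3 - e\<^sub>1\<^sub>3 e\<^sub>3\<^sub>2) e\<^sub>1\<^sub>3\<close>, and the commutator of \<open>e\<^sub>3\<^sub>2\<close> with \<open>w\<close> is
  \<open>1 + s\<close> in \<open>U(g)/J\<close>.\<close>

definition D_op ::
  "('a::complex_lie_algebra \<Rightarrow> 'a \<Rightarrow> complex) \<Rightarrow> ('a \<Rightarrow> complex ^ 'n ^ 'n) \<Rightarrow> 'a \<Rightarrow> 'a set
    \<Rightarrow> complex ^ 'n ^ 'n" where
  "D_op form \<phi> x B = - (\<Sum>u\<in>B \<inter> ad_sum x {1..}. \<phi> (dual_elt form B u) ** \<phi> u)"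

definition Y_op ::
  "('a::complex_lie_algebra \<Rightarrow> 'a \<Rightarrow> complex) \<Rightarrow> ('a \<Rightarrow> complex ^ 'n ^ 'n) \<Rightarrow> 'a \<Rightarrow> 'a \<Rightarrow> 'a set
    \<Rightarrow> 'a uea fps ^ 'n ^ 'n" where
  "Y_op form \<phi> f x B =
     const_op (mat 1) + const_op (\<phi> f)
     + (\<Sum>u\<in>B \<inter> ad_sum x {..1/2}.
          z_tensor (1 - ad_weight x u) (uea_gen u) (\<phi> (dual_elt form B u)))
     + z_tensor 1 1 (D_op form \<phi> x B)"

text \<open>\<open>rel_inverse P Q A\<close> is the inverse of \<open>A\<close> regarded as an operator from the image of the
  idempotent \<open>Q\<close> to the image of the idempotent \<open>P\<close>.\<close>

definition rel_inverse :: "'r::ring_1 ^ 'n ^ 'n \<Rightarrow> 'r ^ 'n ^ 'n \<Rightarrow> 'r ^ 'n ^ 'n \<Rightarrow> 'r ^ 'n ^ 'n" where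
  "rel_inverse P Q A = (THE C. Q ** C ** P = C \<and> A ** C = P \<and> C ** A = Q)"

definition L_R ::
  "('a::complex_lie_algebra \<Rightarrow> 'a \<Rightarrow> complex) \<Rightarrow> ('a \<Rightarrow> complex ^ 'n ^ 'n) \<Rightarrow> 'a \<Rightarrow> 'a \<Rightarrow> 'a set
    \<Rightarrow> real \<Rightarrow> 'a uea fps ^ 'n ^ 'n" where
  "L_R form \<phi> f x B \<xi> =
     (let Y = Y_op form \<phi> f x B;
          Plt = const_op (weight_proj (\<phi> x) {..<\<xi>/2});
          Pgt = const_op (weight_proj (\<phi> x) {- (\<xi>/2)<..});
          Peq = const_op (weight_proj (\<phi> x) {- (\<xi>/2)})
      in rel_inverse Plt Pgt (Plt ** Y ** Pgt) ** (Plt ** Y ** Peq))"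

end

theory Submission
  imports Defs
begin

text \<open>
  Write \<open>s = z\<^sup>-\<^sup>1\<^sup>/\<^sup>2\<close>, let \<open>\<Pi>\<close> be the projection onto \<open>V[<\<xi>/2]\<close>, and put \<open>t = 1 - L\<^sub>R\<close> on \<open>V[-\<xi>/2]\<close>, so
  that \<open>t\<close> is the solution of \<open>\<Pi> Y t = 0\<close> whose component on \<open>V[-\<xi>/2]\<close> is the identity.  Since \<open>W\<close>
  has weight \<open>-l > -\<xi>/2\<close>, the coefficients in question are those of \<open>- \<Pi>\<^sub>W t\<close>.  Two facts about \<open>t\<close>
  give the theorem.

  \<^item> Transformation law: \<open>[m, t] = - s\<^sup>2\<^sup>j \<phi>(m) t\<close> modulo \<open>J\<close> for \<open>m\<close> of \<open>ad x\<close>-weight \<open>j \<ge> 1/2\<close>.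
    The full Casimir tensor \<open>\<Sum> u\<^sub>i \<otimes> U\<^sup>i\<close> satisfies \<open>[m, _] = - [\<phi>(m), _]\<close>.  The operator \<open>Y\<close>
    differs from a rescaling of it by replacing \<open>u\<^sub>i\<close> by \<open>\<langle>f|u\<^sub>i\<rangle>\<close> for weights at least \<open>1\<close> and by the
    shift \<open>D\<close>; acting on \<open>t\<close>, the difference \<open>u\<^sub>i - \<langle>f|u\<^sub>i\<rangle>\<close> is \<open>[u\<^sub>i, t]\<close> modulo \<open>J\<close>, and \<open>D\<close> is what
    this contributes if the law holds for \<open>u\<^sub>i\<close>.  In general, with \<open>\<rho>\<^sub>m = [m, t] + s\<^sup>2\<^sup>j \<phi>(m) t\<close>, one
    finds that \<open>\<Pi> Y \<rho>\<^sub>m\<close> is, modulo \<open>J\<close>, a combination of the \<open>\<rho>\<^sub>u\<close> with positive powers of \<open>s\<close>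
    (\<open>Y_\<rho>\<close>).  The component of \<open>\<rho>\<^sub>m\<close> on \<open>V[-\<xi>/2]\<close> vanishes and \<open>\<Pi> Y\<close> is invertible on \<open>V[>-\<xi>/2]\<close>, so
    all \<open>\<rho>\<^sub>m\<close> vanish modulo \<open>J\<close> to every order in \<open>s\<close> (\<open>\<rho>_coeffs_in\<close>).

  \<^item> Polynomiality (\<open>t_polynomial\<close>): for \<open>p < -l\<close> the component of \<open>t\<close> of weight \<open>p\<close> is
    \<open>z\<^sup>-\<^sup>p\<^sup>-\<^sup>\<xi>\<^sup>/\<^sup>2\<close> times a polynomial in \<open>z\<close>.  Indeed \<open>F = \<phi>(f)\<close> is injective on \<open>V[p]\<close> for
    \<open>-\<xi>/2 < p < -l\<close> by the choice of \<open>l\<close>, and the equation \<open>\<Pi> Y t = 0\<close> in weight \<open>p - 1\<close> expresses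
    \<open>F\<close> applied to this component by components of lower weight.

  Hence \<open>[m, \<Pi>\<^sub>W t] = - s\<^sup>2\<^sup>j \<Pi>\<^sub>W \<phi>(m) t\<close> modulo \<open>J\<close>, where only the component of \<open>t\<close> of weight \<open>-l - j\<close>
  enters; by polynomiality the right hand side has no coefficient at \<open>z\<^sup>-\<^sup>b\<close> with \<open>b > \<xi>/2 - l\<close>.

  The representation theory of \<open>sl\<^sub>2\<close> on \<open>V\<close> supplies the rest: \<open>x\<close> acts diagonalizably with
  half-integral eigenvalues, the projection \<open>\<Pi>\<^sub>W\<close> is well defined, and \<open>1 + F\<close>, the leading term of
  \<open>Y\<close>, is invertible from \<open>V[>-\<xi>/2]\<close> to \<open>V[<\<xi>/2]\<close>.  It is developed from the generalized eigenspaces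
  of the Casimir operator.
\<close>

section \<open>Eigenvectors of a linear map\<close>

locale vector_space_endo = vector_space scale + T: Vector_Spaces.linear scale scale T
  for scale :: "'a::field \<Rightarrow> 'b::ab_group_add \<Rightarrow> 'b" and T :: "'b \<Rightarrow> 'b"
begin

definition eigenspace :: "'a \<Rightarrow> 'b set" where
  "eigenspace c = {v. T v = scale c v}"

text \<open>Apply \<open>T - c\<^sub>a\<close> to the relation: the summand for \<open>a\<close> disappears and the others are scaled by
  nonzero factors, so induction on the number of summands applies.\<close>

lemma eigenvectors_independent:
  assumes "finite K" "inj_on c K"
    and "\<And>k. k \<in> K \<Longrightarrow> v k \<in> eigenspace (c k)" and "(\<Sum>k\<in>K. v k) = 0" and "k \<in> K"
  shows "v k = 0"
  using assms
proof (induction K arbitrary: v k rule: finite_induct)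
  case empty
  then show ?case by simp
next
  case (insert a K)
  let ?w = "\<lambda>k. scale (c k - c a) (v k)"
  have ne: "c k \<noteq> c a" if "k \<in> K" for k
    using insert.prems(1) insert.hyps(2) that by (auto simp: inj_on_def)
  have T: "T (v k) = scale (c k) (v k)" if "k \<in> insert a K" for k
    using insert.prems(2)[OF that] by (simp add: eigenspace_def)
  have sum0: "v a + (\<Sum>k\<in>K. v k) = 0" using insert.prems(3) insert.hyps by simp
  have "0 = T (v a + (\<Sum>k\<in>K. v k)) - scale (c a) (v a + (\<Sum>k\<in>K. v k))"
    by (simp add: sum0)
  also have "\<dots> = (\<Sum>k\<in>K. ?w k)"
    by (simp add: T.add T.sum T scale_right_distrib scale_sum_right scale_left_diff_distrib
        sum_subtractf)
  finally have w0: "(\<Sum>k\<in>K. ?w k) = 0" by simp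
  have "?w k = 0" if "k \<in> K" for k
  proof (rule insert.IH[OF _ _ w0 that])
    show "inj_on c K" using insert.prems(1) by simp
    show "?w k \<in> eigenspace (c k)" if "k \<in> K" for k
      using T[of k] that by (simp add: eigenspace_def T.scale scale_left_commute)
  qed
  then have vK: "v k = 0" if "k \<in> K" for k using ne that by simp
  then have "v a = 0" using sum0 by simp
  then show ?case using insert.prems(4) vK by auto
qed

lemma eigenvectors_inj_on_and_independent:
  assumes "\<And>c. c \<in> C \<Longrightarrow> w c \<in> eigenspace c \<and> w c \<noteq> 0"
  shows "inj_on w C" "independent (w ` C)"
proof -
  have inj: "c = d" if "v \<in> eigenspace c" "v \<in> eigenspace d" "v \<noteq> 0" for v c d
    using that by (simp add: eigenspace_def)
  then show w: "inj_on w C" by (metis assms inj_onI)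
  show "independent (w ` C)"
    unfolding independent_explicit_module
  proof (intro allI impI)
    fix t u v
    assume t: "finite t" "t \<subseteq> w ` C" and 0: "(\<Sum>v\<in>t. scale (u v) v) = 0" and v: "v \<in> t"
    define c where "c v = the_inv_into C w v" for v
    have c: "c v \<in> C" "w (c v) = v" if "v \<in> t" for v
      using t(2) that the_inv_into_f_f[OF w] by (auto simp: c_def)
    have "v \<in> eigenspace (c v)" if "v \<in> t" for v
      using assms[of "c v"] c[OF that] by simp
    then have "scale (u v) v = 0"
      by (intro eigenvectors_independent[OF t(1) _ _ 0 v, of c])
        (auto simp: eigenspace_def T.scale scale_left_commute intro: inj_onI dest: c(2)
          | metis c(2) inj_onI)+
    moreover have "v \<noteq> 0" using assms t(2) v by auto
    ultimately show "u v = 0" by simp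
  qed
qed

lemma subspace_eigenspace: "subspace (eigenspace c)"
proof -
  show ?thesis
    by (auto simp: subspace_def eigenspace_def T.zero T.add T.scale scale_right_distrib
        scale_left_commute)
qed

lemma span_eigenspaces_sum:
  assumes "x \<in> span (\<Union>c\<in>C. eigenspace c)"
  obtains K w where "finite K" "K \<subseteq> C" "\<And>c. w c \<in> eigenspace c" "x = (\<Sum>c\<in>K. w c)"
proof -
  note sub = subspace_eigenspace
  have "\<exists>K w. finite K \<and> K \<subseteq> C \<and> (\<forall>c. w c \<in> eigenspace c) \<and> x = (\<Sum>c\<in>K. w c)"
    using assms
  proof (induction rule: span_induct_alt)
    case base
    show ?case
      by (intro exI[of _ "{}"] exI[of _ "\<lambda>_. 0"]) (simp add: subspace_0[OF sub])
  next
    case (step a y z)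
    from step obtain d where d: "d \<in> C" "y \<in> eigenspace d" by blast
    from step obtain K w where K: "finite K" "K \<subseteq> C" "\<And>c. w c \<in> eigenspace c"
      "z = (\<Sum>c\<in>K. w c)" by blast
    define w' where "w' c = (if c \<in> K then w c else 0) + (if c = d then scale a y else 0)" for c
    have "(\<Sum>c\<in>insert d K. w' c) = scale a y + z"
      unfolding w'_def sum.distrib using K(1)
      by (simp add: K(4) sum.If_cases sum.delta insert_absorb Int_absorb1 Int_insert_left)
    moreover have "w' c \<in> eigenspace c" for c
      using K(3)[of c] d(2) subspace_scale[OF sub] subspace_add[OF sub] subspace_0[OF sub]
      by (auto simp: w'_def)
    ultimately show ?case using K d
      by (intro exI[of _ "insert d K"] exI[of _ w']) auto
  qed
  then show ?thesis using that by blast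
qed

lemma span_eigenspaces_Int:
  assumes "C \<inter> D = {}"
    and "x \<in> span (\<Union>c\<in>C. eigenspace c)" "x \<in> span (\<Union>c\<in>D. eigenspace c)"
  shows "x = 0"
proof -
  note sub = subspace_eigenspace
  obtain K v where K: "finite K" "K \<subseteq> C" "\<And>c. v c \<in> eigenspace c" "x = (\<Sum>c\<in>K. v c)"
    using span_eigenspaces_sum[OF assms(2)] by blast
  obtain L w where L: "finite L" "L \<subseteq> D" "\<And>c. w c \<in> eigenspace c" "x = (\<Sum>c\<in>L. w c)"
    using span_eigenspaces_sum[OF assms(3)] by blast
  define u where "u c = (if c \<in> K then v c else - w c)" for c
  have disj: "K \<inter> L = {}" using K L assms(1) by blast
  have "(\<Sum>c\<in>K \<union> L. u c) = (\<Sum>c\<in>K. u c) + (\<Sum>c\<in>L. u c)"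
    by (rule sum.union_disjoint) (use K L disj in auto)
  also have "(\<Sum>c\<in>K. u c) = x" using K(4) by (simp add: u_def)
  also have "(\<Sum>c\<in>L. u c) = (\<Sum>c\<in>L. - w c)"
    by (rule sum.cong) (use disj in \<open>auto simp: u_def\<close>)
  also have "\<dots> = - x" by (simp add: L(4) sum_negf)
  finally have 0: "(\<Sum>c\<in>K \<union> L. u c) = 0" by simp
  have "u c = 0" if "c \<in> K \<union> L" for c
    by (rule eigenvectors_independent[OF _ _ _ 0 that, of "\<lambda>c. c"])
      (use K L subspace_neg[OF sub] in \<open>auto simp: u_def\<close>)
  then have "\<And>c. c \<in> K \<Longrightarrow> v c = 0" by (metis UnI1 u_def)
  then show ?thesis by (simp add: K(4))
qed

lemma eigenvector_in_span_eigenvectors: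
  assumes "A \<subseteq> (\<Union>c. eigenspace c)"
    and "x \<in> span A" and "x \<in> eigenspace d"
  shows "x \<in> span (A \<inter> eigenspace d)"
proof -
  note sub = subspace_eigenspace
  have "A = (A \<inter> eigenspace d) \<union> (A - eigenspace d)" by blast
  then obtain y z where y: "y \<in> span (A \<inter> eigenspace d)"
    and z: "z \<in> span (A - eigenspace d)" and x: "x = y + z"
    using assms(2) span_Un[of "A \<inter> eigenspace d" "A - eigenspace d"] by auto
  have "y \<in> eigenspace d" using y span_minimal[OF _ sub] by blast
  then have "z \<in> eigenspace d" using x assms(3) subspace_diff[OF sub, of x d y] by simp
  then have "z \<in> span (\<Union>c\<in>{d}. eigenspace c)" by (simp add: span_base)
  moreover have "z \<in> span (\<Union>c\<in>- {d}. eigenspace c)"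
    by (rule subsetD[OF span_mono z]) (use assms(1) in blast)
  ultimately have "z = 0" using span_eigenspaces_Int[of "{d}" "- {d}" z] by auto
  then show ?thesis using x y by simp
qed

text \<open>\<open>shifts [c\<^sub>1, \<dots>, c\<^sub>n]\<close> is \<open>(T - c\<^sub>n) \<cdots> (T - c\<^sub>1)\<close>.\<close>

fun shifts :: "'a list \<Rightarrow> 'b \<Rightarrow> 'b" where
  "shifts [] v = v"
| "shifts (c # cs) v = shifts cs (T v - scale c v)"

lemma shifts_append: "shifts (cs @ ds) v = shifts ds (shifts cs v)"
  by (induction cs arbitrary: v) auto

lemma shifts_zero: "shifts cs 0 = 0"
  by (induction cs) (auto simp: T.zero)

lemma shifts_add: "shifts cs (v + w) = shifts cs v + shifts cs w"
proof (induction cs arbitrary: v w)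
  case (Cons c cs)
  have "T (v + w) - scale c (v + w) = (T v - scale c v) + (T w - scale c w)"
    by (simp add: T.add scale_right_distrib)
  then show ?case using Cons by simp
qed simp

lemma shifts_eigenvector:
  assumes "v \<in> eigenspace c"
  shows "shifts cs v = scale (\<Prod>d\<leftarrow>cs. c - d) v"
  using assms
proof (induction cs arbitrary: v)
  case (Cons d cs)
  have "T v - scale d v = scale (c - d) v"
    using Cons.prems by (simp add: eigenspace_def scale_left_diff_distrib)
  moreover have "scale (c - d) v \<in> eigenspace c"
    using Cons.prems subspace_scale[OF subspace_eigenspace] by blast
  ultimately show ?case using Cons.IH by (simp add: mult.commute)
qed simp

lemma shifts_in_invariant:
  assumes "subspace S" "\<And>v. v \<in> S \<Longrightarrow> T v \<in> S" "v \<in> S"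
  shows "shifts cs v \<in> S"
  using assms(3)
  by (induction cs arbitrary: v) (auto simp: assms(1,2) subspace_diff subspace_scale)

text \<open>If a polynomial with distinct roots in \<open>T\<close> kills \<open>v\<close>, then \<open>v\<close> is a sum of
  eigenvectors: remove one root \<open>a\<close> at a time, dividing the eigencomponent of \<open>(T - a) v\<close> for
  the eigenvalue \<open>c\<close> by \<open>c - a\<close>.\<close>

lemma shifts_distinct_imp_eigenvectors:
  assumes S: "subspace S" "\<And>v. v \<in> S \<Longrightarrow> T v \<in> S"
    and "distinct cs" "v \<in> S" "shifts cs v = 0"
  shows "v \<in> span (\<Union>c\<in>set cs. eigenspace c \<inter> S)"
  using assms(3-)
proof (induction cs arbitrary: v)
  case Nil
  then show ?case by (simp add: span_zero)
next
  case (Cons a cs)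
  let ?U = "\<lambda>cs. span (\<Union>c\<in>set cs. eigenspace c \<inter> S)"
  note sub = subspace_eigenspace
  have "T v - scale a v \<in> ?U cs"
    by (rule Cons.IH) (use Cons.prems S in \<open>auto intro: subspace_diff subspace_scale\<close>)
  moreover have "\<exists>y\<in>?U cs. T y - scale a y = u" if "u \<in> ?U cs" for u
    using that
  proof (induction rule: span_induct_alt)
    case base
    then show ?case by (intro bexI[of _ 0]) (auto simp: T.zero span_zero)
  next
    case (step b x y)
    then obtain c where c: "c \<in> set cs" "x \<in> eigenspace c" "x \<in> S" by blast
    from step obtain y' where y': "y' \<in> ?U cs" "T y' - scale a y' = y" by blast
    have "c \<noteq> a" using c Cons.prems by auto
    let ?x = "scale (b / (c - a)) x"
    have "T ?x - scale a ?x = scale (b / (c - a)) (T x - scale a x)"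
      by (simp add: T.scale scale_right_diff_distrib scale_left_commute)
    also have "\<dots> = scale b x"
      using c \<open>c \<noteq> a\<close> by (simp add: eigenspace_def flip: scale_left_diff_distrib)
    finally have x: "T ?x - scale a ?x = scale b x" .
    have "x \<in> ?U cs" using c by (intro span_base) auto
    then have "?x + y' \<in> ?U cs" using y' by (intro span_add span_scale)
    moreover have "T (?x + y') - scale a (?x + y') = scale b x + y"
      using x y'(2) by (simp add: T.add scale_right_distrib) (metis add_diff_add)
    ultimately show ?case by blast
  qed
  ultimately obtain y where y: "y \<in> ?U cs" "T y - scale a y = T v - scale a v" by blast
  have "y \<in> S" using y(1) span_minimal[OF _ S(1), of "\<Union>c\<in>set cs. eigenspace c \<inter> S"] by blast
  moreover have "v - y \<in> eigenspace a"
    using y(2) by (simp add: eigenspace_def T.diff scale_right_diff_distrib algebra_simps)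
  ultimately have "v - y \<in> span (\<Union>c\<in>set (a # cs). eigenspace c \<inter> S)"
    using Cons.prems S by (intro span_base) (auto intro: subspace_diff)
  moreover have "y \<in> span (\<Union>c\<in>set (a # cs). eigenspace c \<inter> S)"
    using y(1) by (rule subsetD[OF span_mono, rotated]) auto
  ultimately have "(v - y) + y \<in> span (\<Union>c\<in>set (a # cs). eigenspace c \<inter> S)"
    by (rule span_add)
  then show ?case by simp
qed

definition gen_eigenspace :: "'a \<Rightarrow> 'b set" where
  "gen_eigenspace c = {v. \<exists>n. shifts (replicate n c) v = 0}"

lemma shifts_replicate_mono:
  "shifts (replicate n c) v = 0 \<Longrightarrow> n \<le> m
    \<Longrightarrow> shifts (replicate m c) v = 0"
  by (metis le_add_diff_inverse replicate_add shifts_append shifts_zero)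

lemma shifts_scale: "shifts cs (scale b v) = scale b (shifts cs v)"
proof -
  have "T (scale b v) - scale c (scale b v) = scale b (T v - scale c v)" for c v
    by (simp add: T.scale scale_right_diff_distrib scale_left_commute)
  then show ?thesis by (induction cs arbitrary: v) auto
qed

lemma shifts_commute:
  assumes "Vector_Spaces.linear scale scale S" "\<And>v. S (T v) = T (S v)"
  shows "S (shifts cs v) = shifts cs (S v)"
proof -
  interpret S: Vector_Spaces.linear scale scale S by fact
  show ?thesis by (induction cs arbitrary: v) (auto simp: S.diff S.scale assms(2))
qed

lemma gen_eigenspace_commute:
  assumes "Vector_Spaces.linear scale scale S" "\<And>v. S (T v) = T (S v)" and "v \<in> gen_eigenspace c"
  shows "S v \<in> gen_eigenspace c"
proof -
  interpret S: Vector_Spaces.linear scale scale S by fact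
  obtain n where "shifts (replicate n c) v = 0" using assms(3) by (auto simp: gen_eigenspace_def)
  then have "shifts (replicate n c) (S v) = 0"
    using shifts_commute[OF assms(1,2)] S.zero by metis
  then show ?thesis by (auto simp: gen_eigenspace_def)
qed

lemma subspace_gen_eigenspace: "subspace (gen_eigenspace c)"
proof -
  show ?thesis
  proof (rule subspaceI)
    show "0 \<in> gen_eigenspace c" by (auto simp: gen_eigenspace_def shifts_zero)
    fix v w
    assume "v \<in> gen_eigenspace c" "w \<in> gen_eigenspace c"
    then obtain n m where "shifts (replicate n c) v = 0" "shifts (replicate m c) w = 0"
      by (auto simp: gen_eigenspace_def)
    then have "shifts (replicate (max n m) c) (v + w) = 0"
      using shifts_replicate_mono by (simp add: shifts_add)
    then show "v + w \<in> gen_eigenspace c" by (auto simp: gen_eigenspace_def)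
  next
    fix b v
    assume "v \<in> gen_eigenspace c"
    then show "scale b v \<in> gen_eigenspace c"
      by (auto simp: gen_eigenspace_def shifts_scale)
  qed
qed

text \<open>On a generalized eigenspace for \<open>c \<noteq> a\<close> the map \<open>T - a\<close> is \<open>c - a\<close> plus a nilpotent map,
  hence invertible.\<close>

lemma gen_eigenspace_shift_surj:
  assumes "c \<noteq> a" "u \<in> gen_eigenspace c"
  shows "\<exists>y\<in>gen_eigenspace c. T y - scale a y = u"
proof -
  note sub = subspace_gen_eigenspace
  from assms(2) obtain n where "shifts (replicate n c) u = 0" by (auto simp: gen_eigenspace_def)
  then show ?thesis
  proof (induction n arbitrary: u)
    case 0
    then show ?case by (intro bexI[of _ 0]) (auto simp: T.zero subspace_0[OF sub])
  next
    case (Suc n)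
    define u' where "u' = T u - scale c u"
    have "shifts (replicate n c) u' = 0" using Suc.prems by (simp add: u'_def)
    from Suc.IH[OF this] obtain y' where
      y': "y' \<in> gen_eigenspace c" "T y' - scale a y' = u'" by blast
    have "u \<in> gen_eigenspace c"
      unfolding gen_eigenspace_def using Suc.prems by (intro CollectI exI[of _ "Suc n"])
    then have y: "scale (1 / (c - a)) (u - y') \<in> gen_eigenspace c"
      using y' by (intro subspace_scale[OF sub] subspace_diff[OF sub])
    have "T (u - y') - scale a (u - y') = T u - scale a u - u'"
      unfolding y'(2)[symmetric] by (simp add: T.diff scale_right_diff_distrib)
    also have "\<dots> = scale (c - a) u" by (simp add: u'_def scale_left_diff_distrib)
    finally have "scale (1 / (c - a)) (T (u - y') - scale a (u - y')) = u"
      using assms(1) by simp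
    moreover have "T (scale b w) - scale a (scale b w) = scale b (T w - scale a w)" for b w
      by (simp add: T.scale scale_right_diff_distrib scale_left_commute)
    ultimately show ?case using y by metis
  qed
qed

text \<open>With repeated roots only generalized eigenvectors remain; again one root is removed at a time.\<close>

lemma shifts_imp_gen_eigenvectors:
  assumes "shifts cs v = 0"
  shows "v \<in> span (\<Union>c\<in>set cs. gen_eigenspace c)"
  using assms
proof (induction cs arbitrary: v)
  case Nil
  then show ?case by (simp add: span_zero)
next
  case (Cons a cs)
  let ?U = "\<lambda>cs. span (\<Union>c\<in>set cs. gen_eigenspace c)"
  note sub = subspace_gen_eigenspace
  have "T v - scale a v \<in> ?U cs" using Cons by simp
  moreover have "\<exists>y\<in>?U cs. T y - scale a y - u \<in> gen_eigenspace a" if "u \<in> ?U cs" for u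
    using that
  proof (induction rule: span_induct_alt)
    case base
    then show ?case by (intro bexI[of _ 0]) (auto simp: T.zero span_zero subspace_0[OF sub])
  next
    case (step b x y)
    then obtain c where c: "c \<in> set cs" "x \<in> gen_eigenspace c" by blast
    have bx: "scale b x \<in> gen_eigenspace c" using c subspace_scale[OF sub] by blast
    from step obtain y' where y': "y' \<in> ?U cs" "T y' - scale a y' - y \<in> gen_eigenspace a"
      by blast
    show ?case
    proof (cases "c = a")
      case True
      have "T y' - scale a y' - y - scale b x \<in> gen_eigenspace a"
        using bx y'(2) True subspace_diff[OF sub] by blast
      then show ?thesis using y'(1) by (intro bexI[of _ y']) (simp_all add: algebra_simps)
    next
      case False
      obtain x' where x': "x' \<in> gen_eigenspace c" "T x' - scale a x' = scale b x"
        using gen_eigenspace_shift_surj[OF False bx] by blast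
      have "x' \<in> ?U cs" using c x' by (intro span_base) auto
      moreover have "T (x' + y') - scale a (x' + y') - (scale b x + y) = T y' - scale a y' - y"
        unfolding x'(2)[symmetric] by (simp add: T.add scale_right_distrib)
      ultimately show ?thesis using y' by (metis span_add)
    qed
  qed
  ultimately obtain y where y: "y \<in> ?U cs"
    "T y - scale a y - (T v - scale a v) \<in> gen_eigenspace a" by blast
  have "T (y - v) - scale a (y - v) \<in> gen_eigenspace a"
    using y(2) by (simp add: T.diff scale_right_diff_distrib algebra_simps)
  then obtain n where "shifts (replicate n a) (T (y - v) - scale a (y - v)) = 0"
    by (auto simp: gen_eigenspace_def)
  then have "shifts (replicate (Suc n) a) (y - v) = 0" by simp
  then have "y - v \<in> gen_eigenspace a" unfolding gen_eigenspace_def by blast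
  then have "y - v \<in> ?U (a # cs)" by (intro span_base) auto
  moreover have "y \<in> ?U (a # cs)" using y(1) by (rule subsetD[OF span_mono, rotated]) auto
  ultimately have "y - (y - v) \<in> ?U (a # cs)" by (metis span_diff)
  then show ?case by simp
qed

end

section \<open>Representations of \<open>sl\<^sub>2\<close> on a finite-dimensional space\<close>

lemma mat_mult_nth [simp]: "(mat c ** M) $ i $ j = c * M $ i $ j"
  by (simp add: matrix_matrix_mult_def mat_def if_distrib if_distribR sum.delta cong: if_cong)

lemma mult_mat_nth [simp]: "(M ** mat c) $ i $ j = M $ i $ j * c"
  by (simp add: matrix_matrix_mult_def mat_def if_distrib if_distribR sum.delta cong: if_cong)

lemma matrix_mult_minus_left: "(A - B) ** C = A ** C - B ** (C :: 'r::ring_1 ^ 'n ^ 'm)"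
  by (simp add: vec_eq_iff matrix_matrix_mult_def left_diff_distrib sum_subtractf)

lemma matrix_mult_minus_right: "A ** (B - C) = A ** B - A ** (C :: 'r::ring_1 ^ 'n ^ 'm)"
  by (simp add: vec_eq_iff matrix_matrix_mult_def right_diff_distrib sum_subtractf)

lemma matrix_mult_uminus_left: "(- A) ** C = - (A ** (C :: 'r::ring_1 ^ 'n ^ 'm))"
  by (simp add: vec_eq_iff matrix_matrix_mult_def sum_negf)

lemma matrix_mult_uminus_right: "A ** (- C) = - (A ** (C :: 'r::ring_1 ^ 'n ^ 'm))"
  by (simp add: vec_eq_iff matrix_matrix_mult_def sum_negf)

lemma matrix_vector_uminus_left: "(- A) *v v = - (A *v (v :: 'r::ring_1 ^ 'm))"
  by (simp add: vec_eq_iff matrix_vector_mult_def sum_negf)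

text \<open>The powers of \<open>E\<close> are eigenvectors of \<open>ad X\<close> with eigenvalues \<open>0, 1, 2, \<dots>\<close>, so only
  finitely many of them are nonzero.\<close>

lemma nilpotent_if_weight_one:
  fixes X E :: "complex ^ 'n ^ 'n"
  assumes XE: "X ** E - E ** X = E"
  shows "\<exists>n. \<forall>v. ((*v) E ^^ n) v = 0"
proof -
  define fl :: "complex ^ 'n ^ 'n \<Rightarrow> complex ^ ('n \<times> 'n)" where "fl M = (\<chi> p. M $ fst p $ snd p)" for M
  define T :: "complex ^ ('n \<times> 'n) \<Rightarrow> complex ^ ('n \<times> 'n)" where
    "T w = (\<chi> p. (\<Sum>k\<in>UNIV. X $ fst p $ k * w $ (k, snd p)) - (\<Sum>k\<in>UNIV. w $ (fst p, k) * X $ k $ snd p))" for w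
  define P where "P j = ((**) E ^^ j) (mat 1)" for j
  interpret T: vector_space_endo "(*s)" T
    by unfold_locales
      (auto simp: T_def vec_eq_iff sum.distrib sum_distrib_left algebra_simps)
  have T: "T (fl M) = fl (X ** M - M ** X)" for M
    by (simp add: T_def fl_def matrix_matrix_mult_def vec_eq_iff)
  have comm: "X ** P j - P j ** X = mat (of_nat j) ** P j" for j
  proof (induction j)
    case 0
    show ?case by (simp add: P_def vec_eq_iff)
  next
    case (Suc j)
    have PS: "P (Suc j) = E ** P j" by (simp add: P_def)
    have "X ** P (Suc j) - P (Suc j) ** X = (X ** E - E ** X) ** P j + E ** (X ** P j - P j ** X)"
      by (simp add: PS matrix_mult_minus_left matrix_mult_minus_right matrix_mul_assoc)
    also have "\<dots> = E ** P j + E ** (mat (of_nat j) ** P j)" by (simp add: XE Suc)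
    also have "E ** (mat (of_nat j) ** P j) = mat (of_nat j) ** (E ** P j)"
    proof -
      have "E ** mat (of_nat j) = mat (of_nat j) ** E" by (simp add: vec_eq_iff mult.commute)
      then show ?thesis by (simp add: matrix_mul_assoc)
    qed
    finally show ?case by (simp add: PS vec_eq_iff algebra_simps)
  qed
  have eig: "fl (P j) \<in> T.eigenspace (of_nat j)" for j
    unfolding T.eigenspace_def mem_Collect_eq T comm by (simp add: fl_def vec_eq_iff)
  have "\<exists>j. fl (P j) = 0"
  proof (rule ccontr)
    assume "\<not> ?thesis"
    then have *: "fl (P (the_inv of_nat c)) \<in> T.eigenspace c \<and> fl (P (the_inv of_nat c)) \<noteq> 0"
      if "c \<in> range (of_nat :: nat \<Rightarrow> complex)" for c
      using that eig by (auto simp: the_inv_f_f[OF inj_of_nat])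
    have "infinite (range (of_nat :: nat \<Rightarrow> complex))" using range_inj_infinite[OF inj_of_nat] .
    then show False
      using T.eigenvectors_inj_on_and_independent[OF *] vec.finiteI_independent finite_imageD
      by blast
  qed
  then obtain j where "fl (P j) = 0" by blast
  then have "P j = 0" by (simp add: fl_def vec_eq_iff)
  moreover have "P j *v v = ((*v) E ^^ j) v" for j v
    by (induction j) (auto simp: P_def simp flip: matrix_vector_mul_assoc)
  ultimately show ?thesis by (metis matrix_vector_mult_0)
qed

text \<open>The relations are those of \<open>(f, 2x, e)\<close>, written for \<open>X\<close>, half the neutral element.\<close>

locale sl2_rep =
  fixes E F X :: "complex ^ 'n ^ 'n"
  assumes XE: "X ** E - E ** X = E"
    and XF: "X ** F - F ** X = - F"
    and EF: "E ** F - F ** E = X + X"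
begin

abbreviation Epow :: "nat \<Rightarrow> complex ^ 'n \<Rightarrow> complex ^ 'n" where "Epow j \<equiv> (*v) E ^^ j"
abbreviation Fpow :: "nat \<Rightarrow> complex ^ 'n \<Rightarrow> complex ^ 'n" where "Fpow j \<equiv> (*v) F ^^ j"

text \<open>Exchanging \<open>E\<close> and \<open>F\<close> turns statements about highest weight vectors into statements about
  lowest weight vectors.\<close>

lemma dual: "sl2_rep F E (- X)"
  using XE XF EF
  by unfold_locales
    (simp_all add: matrix_mult_uminus_left matrix_mult_uminus_right algebra_simps)

sublocale X: vector_space_endo "(*s)" "(*v) X" by unfold_locales

lemma XE_v: "X *v (E *v v) = E *v (X *v v) + E *v v"
  using arg_cong[OF XE, of "\<lambda>M. M *v v"]
  by (simp add: matrix_vector_mult_diff_rdistrib matrix_vector_mul_assoc algebra_simps)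

lemma XF_v: "X *v (F *v v) = F *v (X *v v) - F *v v"
  using arg_cong[OF XF, of "\<lambda>M. M *v v"]
  by (simp add: matrix_vector_mult_diff_rdistrib matrix_vector_mul_assoc algebra_simps
      matrix_vector_uminus_left)

lemma EF_v: "E *v (F *v v) = F *v (E *v v) + 2 *s (X *v v)"
proof -
  have "2 *s w = w + w" for w :: "complex ^ 'n" by (simp add: vec_eq_iff)
  then have "2 *s (X *v v) = (X + X) *v v" by (simp only: matrix_vector_mult_add_rdistrib)
  then show ?thesis using arg_cong[OF EF, of "\<lambda>M. M *v v"]
    by (simp add: matrix_vector_mult_diff_rdistrib matrix_vector_mul_assoc algebra_simps)
qed

lemma nilpotent_E: "\<exists>n. \<forall>v. Epow n v = 0"
  using nilpotent_if_weight_one[OF XE] .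

lemma nilpotent_F: "\<exists>n. \<forall>v. Fpow n v = 0"
  using sl2_rep.nilpotent_E[OF dual] .

lemma Fpow_linear:
  "Fpow j (v + w) = Fpow j v + Fpow j w" "Fpow j (c *s v) = c *s Fpow j v" "Fpow j 0 = 0"
  "Fpow j (v - w) = Fpow j v - Fpow j w"
  by (induction j) (auto simp: matrix_vector_right_distrib vec.scale matrix_vector_mult_diff_distrib)

lemma Epow_linear:
  "Epow j (v + w) = Epow j v + Epow j w" "Epow j (c *s v) = c *s Epow j v" "Epow j 0 = 0"
  "Epow j (v - w) = Epow j v - Epow j w"
  by (induction j) (auto simp: matrix_vector_right_distrib vec.scale matrix_vector_mult_diff_distrib)

lemma X_Fpow: "X *v Fpow j v = Fpow j (X *v v) - of_nat j *s Fpow j v"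
proof (induction j)
  case (Suc j)
  show ?case
    by (simp add: XF_v Suc matrix_vector_mult_diff_distrib vec.scale vec.scale_left_distrib)
qed (simp add: vec_eq_iff)

lemma X_Epow: "X *v Epow j v = Epow j (X *v v) + of_nat j *s Epow j v"
proof (induction j)
  case (Suc j)
  show ?case
    by (simp add: XE_v Suc matrix_vector_right_distrib vec.scale vec.scale_left_distrib)
qed (simp add: vec_eq_iff)

lemma E_Fpow:
  "E *v Fpow (Suc j) v = Fpow (Suc j) (E *v v) + of_nat (Suc j) *s Fpow j (2 *s (X *v v) - of_nat j *s v)"
proof (induction j)
  case 0
  show ?case by (simp add: EF_v vec_eq_iff)
next
  case (Suc j)
  have "E *v Fpow (Suc (Suc j)) v = F *v (E *v Fpow (Suc j) v) + 2 *s (X *v Fpow (Suc j) v)"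
    by (simp add: EF_v)
  also have "\<dots> = Fpow (Suc (Suc j)) (E *v v)
      + of_nat (Suc j) *s Fpow (Suc j) (2 *s (X *v v) - of_nat j *s v)
      + 2 *s (Fpow (Suc j) (X *v v) - of_nat (Suc j) *s Fpow (Suc j) v)"
    unfolding Suc X_Fpow by (simp add: matrix_vector_right_distrib vec.scale)
  also have "\<dots> = Fpow (Suc (Suc j)) (E *v v)
      + of_nat (Suc (Suc j)) *s Fpow (Suc j) (2 *s (X *v v) - of_nat (Suc j) *s v)"
    unfolding Fpow_linear by (simp add: vec_eq_iff algebra_simps)
  finally show ?case .
qed

lemma Epow_Fpow:
  assumes "E *v v = 0"
  shows "Epow j (Fpow j v) = (fact j * 2 ^ j) *s X.shifts (map (\<lambda>i. of_nat i / 2) (rev [0..<j])) v"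
  using assms
proof (induction j arbitrary: v)
  case 0
  then show ?case by simp
next
  case (Suc j)
  let ?w = "2 *s (X *v v) - of_nat j *s v"
  have w: "?w = 2 *s (X *v v - (of_nat j / 2) *s v)" by (simp add: vec_eq_iff)
  have Ew: "E *v (X *v v - (of_nat j / 2) *s v) = 0"
    using XE_v[of v] Suc.prems by (simp add: matrix_vector_mult_diff_distrib vec.scale)
  have "Epow (Suc j) (Fpow (Suc j) v) = Epow j (E *v Fpow (Suc j) v)"
    by (simp only: funpow_Suc_right o_apply)
  also have "\<dots> = Epow j (of_nat (Suc j) *s Fpow j ?w)"
    unfolding E_Fpow Suc.prems by (simp only: Fpow_linear add_0)
  also have "\<dots> = (of_nat (Suc j) * 2) *s Epow j (Fpow j (X *v v - (of_nat j / 2) *s v))"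
    unfolding w by (simp add: Epow_linear Fpow_linear)
  also have "\<dots> = (fact (Suc j) * 2 ^ Suc j) *s
      X.shifts (map (\<lambda>i. of_nat i / 2) (rev [0..<Suc j])) v"
    unfolding Suc.IH[OF Ew] by (simp add: algebra_simps)
  finally show ?case .
qed

text \<open>The scalar by which \<open>E\<^sup>j F\<^sup>j\<close> acts on a highest weight vector of weight \<open>c\<close>.\<close>

definition hw_coeff :: "nat \<Rightarrow> complex \<Rightarrow> complex" where
  "hw_coeff j c = fact j * (\<Prod>i<j. 2 * c - of_nat i)"

lemma Epow_Fpow_hw:
  assumes "E *v v = 0" "v \<in> X.eigenspace c"
  shows "Epow j (Fpow j v) = hw_coeff j c *s v"
proof -
  have "2 ^ j * (\<Prod>d\<leftarrow>map (\<lambda>i. of_nat i / 2) (rev [0..<j]). c - d) = (\<Prod>i<j. 2 * c - of_nat i)"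
  proof (induction j)
    case (Suc j)
    have "2 ^ Suc j * (\<Prod>d\<leftarrow>map (\<lambda>i. of_nat i / 2) (rev [0..<Suc j]). c - d) =
      2 * (c - of_nat j / 2) * (2 ^ j * (\<Prod>d\<leftarrow>map (\<lambda>i. of_nat i / 2) (rev [0..<j]). c - d))"
      by simp
    also have "\<dots> = (\<Prod>i<Suc j. 2 * c - of_nat i)" unfolding Suc by (simp add: algebra_simps)
    finally show ?case .
  qed simp
  then show ?thesis
    unfolding Epow_Fpow[OF assms(1)] X.shifts_eigenvector[OF assms(2)] hw_coeff_def
    by (simp add: mult.assoc)
qed

lemma hw_coeff_nonzero: "real j \<le> 2 * k \<Longrightarrow> hw_coeff j (of_real k) \<noteq> 0"
proof -
  assume j: "real j \<le> 2 * k"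
  have "2 * complex_of_real k - of_nat i \<noteq> 0" if "i < j" for i
  proof -
    have "2 * k - real i \<noteq> 0" using j that by linarith
    then have "complex_of_real (2 * k - real i) \<noteq> 0" by (simp only: of_real_eq_0_iff not_False_eq_True)
    then show ?thesis by simp
  qed
  then show ?thesis by (simp add: hw_coeff_def)
qed


text \<open>The Casimir element of \<open>sl\<^sub>2\<close> is \<open>E F + F E + 2 X\<^sup>2\<close>; this is half of it.\<close>

definition casimir :: "complex ^ 'n ^ 'n" where
  "casimir = F ** E + X ** X + X"

sublocale Om: vector_space_endo "(*s)" "(*v) casimir" by unfold_locales

lemma casimir_v: "casimir *v v = F *v (E *v v) + X *v (X *v v) + X *v v"
  by (simp add: casimir_def matrix_vector_mult_add_rdistrib matrix_vector_mul_assoc)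

lemma casimir_X: "X *v (casimir *v v) = casimir *v (X *v v)"
  by (simp add: casimir_v XF_v XE_v matrix_vector_right_distrib matrix_vector_mult_diff_distrib)

lemma two_scale: "2 *s w = w + (w :: complex ^ 'n)"
  by (simp add: vec_eq_iff)

lemma casimir_E: "E *v (casimir *v v) = casimir *v (E *v v)"
  by (simp add: casimir_v EF_v XE_v matrix_vector_right_distrib matrix_vector_mult_diff_distrib
      two_scale algebra_simps)

lemma casimir_F: "F *v (casimir *v v) = casimir *v (F *v v)"
  by (simp add: casimir_v EF_v XF_v matrix_vector_right_distrib matrix_vector_mult_diff_distrib
      vec.scale) (simp add: vec_eq_iff)

lemma eigen_Epow: "v \<in> X.eigenspace c \<Longrightarrow> Epow j v \<in> X.eigenspace (c + of_nat j)"
  by (simp add: X.eigenspace_def X_Epow Epow_linear vec.scale_left_distrib)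

lemma eigen_Fpow: "v \<in> X.eigenspace c \<Longrightarrow> Fpow j v \<in> X.eigenspace (c - of_nat j)"
  by (simp add: X.eigenspace_def X_Fpow Fpow_linear vec.scale_left_diff_distrib)

lemma eigen_eq: "v \<in> X.eigenspace c \<Longrightarrow> v \<in> X.eigenspace d \<Longrightarrow> v \<noteq> 0 \<Longrightarrow> c = d"
  by (simp add: X.eigenspace_def)

lemma ker_E: "vec.subspace {v. E *v v = 0}"
  by (simp add: vec.subspace_def matrix_vector_right_distrib vec.scale)

text \<open>On \<open>ker E\<close> the map \<open>E\<^sup>m F\<^sup>m\<close> is a multiple of \<open>2X (2X - 1) \<cdots> (2X - m + 1)\<close>, and it
  vanishes once \<open>F\<^sup>m = 0\<close>.\<close>

lemma ker_E_eigenvectors: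
  assumes "\<And>v. Fpow m v = 0"
    and S: "vec.subspace S" "\<And>v. v \<in> S \<Longrightarrow> X *v v \<in> S" "v \<in> S" and "E *v v = 0"
  shows "v \<in> vec.span (\<Union>c\<in>(\<lambda>i. of_nat i / 2) ` {..<m}. X.eigenspace c \<inter> {v. E *v v = 0} \<inter> S)"
proof -
  let ?cs = "map (\<lambda>i. of_nat i / 2 :: complex) (rev [0..<m])"
  have "X.shifts ?cs v = 0"
    using Epow_Fpow[OF assms(5), of m] by (simp add: assms(1) Epow_linear)
  moreover have "distinct ?cs" by (auto simp: distinct_map intro: inj_onI)
  moreover have X: "E *v (X *v v) = 0" if "E *v v = 0" for v
    using XE_v[of v] that by simp
  ultimately have "v \<in> vec.span (\<Union>c\<in>set ?cs. X.eigenspace c \<inter> ({v. E *v v = 0} \<inter> S))"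
    by (intro X.shifts_distinct_imp_eigenvectors vec.subspace_inter ker_E)
      (use S assms(5) X in auto)
  then show ?thesis by (simp add: Int_assoc atLeast0LessThan)
qed

lemma hw_weight_half_nat:
  assumes "E *v v = 0" "v \<in> X.eigenspace c" "v \<noteq> 0"
  shows "\<exists>i::nat. c = of_nat i / 2"
proof (rule ccontr)
  assume "\<not> ?thesis"
  then have no: "\<And>i::nat. c \<noteq> of_nat i / 2" by blast
  obtain m where "\<forall>v. Fpow m v = 0" using nilpotent_F by blast
  then have "v \<in> vec.span (\<Union>c\<in>(\<lambda>i. of_nat i / 2) ` {..<m}. X.eigenspace c \<inter> {v. E *v v = 0} \<inter> UNIV)"
    by (intro ker_E_eigenvectors) (use assms in auto)
  then have 1: "v \<in> vec.span (\<Union>c\<in>(\<lambda>i. of_nat i / 2) ` {..<m}. X.eigenspace c)"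
    by (rule subsetD[OF vec.span_mono, rotated]) auto
  have 2: "v \<in> vec.span (\<Union>c\<in>{c}. X.eigenspace c)" using assms(2) by (simp add: vec.span_base)
  have "(\<lambda>i. of_nat i / 2) ` {..<m} \<inter> {c} = {}" using no by blast
  then have "v = 0" using X.span_eigenspaces_Int 1 2 by blast
  then show False using assms(3) by simp
qed

text \<open>The eigenvalue of the Casimir operator on an irreducible module of highest weight \<open>c\<close>.\<close>

definition casimir_val :: "complex \<Rightarrow> complex" where "casimir_val c = c * c + c"

lemma casimir_val_half_nat: "casimir_val (of_nat i / 2) = casimir_val (of_nat j / 2) \<longleftrightarrow> i = j"
proof
  have c4: "4 * casimir_val (of_nat i / 2) = of_nat (i * (i + 2))" for i
    by (simp add: casimir_val_def algebra_simps)
  assume "casimir_val (of_nat i / 2) = casimir_val (of_nat j / 2)"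
  then have "(of_nat (i * (i + 2)) :: complex) = of_nat (j * (j + 2))"
    using arg_cong[of _ _ "\<lambda>z. 4 * z"] unfolding c4[symmetric] by blast
  then have *: "i * (i + 2) = j * (j + 2)" by (simp only: of_nat_eq_iff)
  show "i = j"
  proof (rule ccontr)
    assume "i \<noteq> j"
    then consider "i < j" | "j < i" by linarith
    then show False using * mult_strict_mono[of i j "i + 2" "j + 2"]
        mult_strict_mono[of j i "j + 2" "i + 2"] by cases auto
  qed
qed simp

lemma casimir_hw:
  "E *v v = 0 \<Longrightarrow> v \<in> X.eigenspace c \<Longrightarrow> v \<in> Om.eigenspace (casimir_val c)"
  by (simp add: Om.eigenspace_def X.eigenspace_def casimir_v vec.scale casimir_val_def
      vec.scale_left_distrib)

text \<open>The submodule on which the Casimir operator has the generalized eigenvalue of highest weight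
  \<open>k/2\<close>.\<close>

definition GE :: "nat \<Rightarrow> (complex ^ 'n) set" where
  "GE k = Om.gen_eigenspace (casimir_val (of_nat k / 2))"

lemma subspace_GE: "vec.subspace (GE k)"
  unfolding GE_def by (rule Om.subspace_gen_eigenspace)

lemma GE_invariant: "v \<in> GE k \<Longrightarrow> X *v v \<in> GE k" "v \<in> GE k \<Longrightarrow> E *v v \<in> GE k"
  "v \<in> GE k \<Longrightarrow> F *v v \<in> GE k"
  unfolding GE_def
  using Om.gen_eigenspace_commute[OF matrix_vector_mul_linear_gen] casimir_X casimir_E casimir_F
  by blast+

lemma GE_pow: "v \<in> GE k \<Longrightarrow> Epow j v \<in> GE k" "v \<in> GE k \<Longrightarrow> Fpow j v \<in> GE k"
  by (induction j) (auto intro: GE_invariant)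

text \<open>By \<open>ker_E_eigenvectors\<close> such a vector is a sum of highest weight vectors of weights \<open>i/2\<close> in
  \<open>GE k\<close>, and distinct nonnegative weights have distinct Casimir eigenvalues.\<close>

lemma GE_hw:
  assumes "v \<in> GE k" "E *v v = 0"
  shows "v \<in> X.eigenspace (of_nat k / 2)"
proof -
  obtain m where "\<forall>v. Fpow m v = 0" using nilpotent_F by blast
  then have v: "v \<in> vec.span (\<Union>c\<in>(\<lambda>i. of_nat i / 2) ` {..<m}. X.eigenspace c \<inter> {v. E *v v = 0} \<inter> GE k)"
    by (intro ker_E_eigenvectors) (use assms subspace_GE GE_invariant in auto)
  have "w \<in> X.eigenspace (of_nat k / 2)"
    if w: "w \<in> X.eigenspace (of_nat i / 2)" "E *v w = 0" "w \<in> GE k" for w i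
  proof (cases "i = k")
    case False
    obtain n where n: "Om.shifts (replicate n (casimir_val (of_nat k / 2))) w = 0"
      using w(3) by (auto simp: GE_def Om.gen_eigenspace_def)
    have "w \<in> Om.eigenspace (casimir_val (of_nat i / 2))" using casimir_hw w by blast
    from Om.shifts_eigenvector[OF this] n
    have "((casimir_val (of_nat i / 2) - casimir_val (of_nat k / 2)) ^ n) *s w = 0"
      by (metis map_replicate prod_list_replicate)
    then have "w = 0" using False casimir_val_half_nat by simp
    then show ?thesis using vec.subspace_0[OF X.subspace_eigenspace] by simp
  qed (use w in simp)
  then have "vec.span (\<Union>c\<in>(\<lambda>i. of_nat i / 2) ` {..<m}. X.eigenspace c \<inter> {v. E *v v = 0} \<inter> GE k)
    \<subseteq> X.eigenspace (of_nat k / 2)"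
    by (intro vec.span_minimal X.subspace_eigenspace) blast
  then show ?thesis using v by blast
qed

lemma E_shifts: "E *v X.shifts cs v = X.shifts (map (\<lambda>c. c + 1) cs) (E *v v)"
proof (induction cs arbitrary: v)
  case (Cons c cs)
  have "E *v (X *v v - c *s v) = X *v (E *v v) - (c + 1) *s (E *v v)"
    by (simp add: XE_v matrix_vector_mult_diff_distrib vec.scale vec.scale_left_distrib)
  then show ?case using Cons by simp
qed simp

text \<open>A vector of \<open>GE k\<close> killed by \<open>E\<^sup>j\<^sup>+\<^sup>1\<close> is killed by \<open>X - k/2\<close> after the shifts by
  \<open>k/2 - j, \<dots>, k/2 - 1\<close>; these roots are distinct, so \<open>X\<close> is diagonalizable on \<open>GE k\<close>.\<close>

lemma GE_shifts:
  assumes "v \<in> GE k" "Epow j v = 0"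
  shows "X.shifts (map (\<lambda>i. of_nat k / 2 - of_nat i) (rev [0..<j])) v = 0"
  using assms
proof (induction j arbitrary: v)
  case (Suc j)
  let ?L = "\<lambda>j. map (\<lambda>i. of_nat k / 2 - of_nat i :: complex) (rev [0..<j])"
  have "rev [0..<Suc j] = map Suc (rev [0..<j]) @ [0]"
    by (simp add: upt_conv_Cons rev_map flip: map_Suc_upt del: upt_Suc)
  then have L: "?L (Suc j) = map (\<lambda>i. of_nat k / 2 - of_nat (Suc i)) (rev [0..<j]) @ [of_nat k / 2]"
    by simp
  define w where "w = X.shifts (map (\<lambda>i. of_nat k / 2 - of_nat (Suc i)) (rev [0..<j])) v"
  have "E *v w = X.shifts (?L j) (E *v v)"
    by (simp add: w_def E_shifts o_def)
  also have "\<dots> = 0"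
  proof (rule Suc.IH)
    show "E *v v \<in> GE k" using Suc.prems GE_invariant by blast
    show "Epow j (E *v v) = 0" using Suc.prems by (metis funpow_Suc_right o_apply)
  qed
  finally have "E *v w = 0" .
  moreover have "w \<in> GE k"
    unfolding w_def using Suc.prems GE_invariant(1)
    by (intro X.shifts_in_invariant subspace_GE) auto
  ultimately have "X *v w - (of_nat k / 2) *s w = 0"
    using GE_hw by (simp add: X.eigenspace_def)
  then show ?case unfolding L X.shifts_append w_def[symmetric] by simp
qed simp

lemma GE_eigenvectors: "v \<in> GE k \<Longrightarrow> v \<in> vec.span (\<Union>c. X.eigenspace c \<inter> GE k)"
proof -
  assume v: "v \<in> GE k"
  obtain j where "\<forall>v. Epow j v = 0" using nilpotent_E by blast
  then have "X.shifts (map (\<lambda>i. of_nat k / 2 - of_nat i) (rev [0..<j])) v = 0"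
    using GE_shifts v by blast
  moreover have "distinct (map (\<lambda>i. of_nat k / 2 - of_nat i :: complex) (rev [0..<j]))"
    by (auto simp: distinct_map intro: inj_onI)
  ultimately have "v \<in> vec.span (\<Union>c\<in>set (map (\<lambda>i. of_nat k / 2 - of_nat i) (rev [0..<j])).
      X.eigenspace c \<inter> GE k)"
    using v by (intro X.shifts_distinct_imp_eigenvectors subspace_GE GE_invariant(1))
  then show ?thesis by (rule subsetD[OF vec.span_mono, rotated]) auto
qed

text \<open>A product of shifts of the Casimir operator kills \<open>ker E\<close>; since it commutes with \<open>E\<close>, its
  \<open>j\<close>-th power kills \<open>ker E\<^sup>j\<close>, which is everything for large \<open>j\<close>.\<close>

lemma span_GE: "vec.span (\<Union>k. GE k) = UNIV"
proof -
  obtain m where m: "\<forall>v. Fpow m v = 0" using nilpotent_F by blast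
  let ?L = "map (\<lambda>i. casimir_val (of_nat i / 2)) [0..<m]"
  have ker: "Om.shifts ?L v = 0" if v: "E *v v = 0" for v
  proof -
    have "v \<in> vec.span (\<Union>c\<in>(\<lambda>i. of_nat i / 2) ` {..<m}. X.eigenspace c \<inter> {v. E *v v = 0} \<inter> UNIV)"
      by (intro ker_E_eigenvectors) (use m v in auto)
    moreover have "vec.span (\<Union>c\<in>(\<lambda>i. of_nat i / 2) ` {..<m}. X.eigenspace c \<inter> {v. E *v v = 0} \<inter> UNIV)
      \<subseteq> {v. Om.shifts ?L v = 0}"
    proof (rule vec.span_minimal)
      show "vec.subspace {v. Om.shifts ?L v = 0}"
        by (simp add: vec.subspace_def Om.shifts_zero Om.shifts_add Om.shifts_scale)
      have "Om.shifts ?L w = 0" if "i < m" "w \<in> X.eigenspace (of_nat i / 2)" "E *v w = 0" for i w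
        unfolding Om.shifts_eigenvector[OF casimir_hw[OF that(3,2)]]
        using that(1) by (auto simp: prod_list_zero_iff)
      then show "(\<Union>c\<in>(\<lambda>i. of_nat i / 2) ` {..<m}. X.eigenspace c \<inter> {v. E *v v = 0} \<inter> UNIV)
        \<subseteq> {v. Om.shifts ?L v = 0}" by auto
    qed
    ultimately show ?thesis by blast
  qed
  have "Om.shifts (concat (replicate j ?L)) v = 0" if "Epow j v = 0" for j v
    using that
  proof (induction j arbitrary: v)
    case (Suc j)
    have "Epow j (Om.shifts ?L v) = Om.shifts ?L (Epow j v)"
    proof (rule Om.shifts_commute)
      show "Vector_Spaces.linear (*s) (*s) (Epow j)"
        by unfold_locales (simp_all add: Epow_linear)
      show "Epow j (casimir *v v) = casimir *v Epow j v" for v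
        by (induction j) (auto simp: casimir_E)
    qed
    also have "\<dots> = 0" using Suc.prems by (intro ker) simp
    finally show ?case using Suc.IH by (simp add: Om.shifts_append)
  qed simp
  moreover obtain j where "\<forall>v. Epow j v = 0" using nilpotent_E by blast
  ultimately have "v \<in> vec.span (\<Union>c\<in>set (concat (replicate j ?L)). Om.gen_eigenspace c)" for v
    using Om.shifts_imp_gen_eigenvectors by blast
  moreover have "(\<Union>c\<in>set (concat (replicate j ?L)). Om.gen_eigenspace c) \<subseteq> (\<Union>k. GE k)"
    by (auto simp: GE_def set_replicate_conv_if)
  ultimately show ?thesis using vec.span_mono by blast
qed

lemma last_Epow:
  assumes "v \<noteq> 0" obtains j where "Epow j v \<noteq> 0" "E *v Epow j v = 0"
proof -
  obtain n where n: "Epow n v = 0" using nilpotent_E by blast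
  define m where "m = (LEAST n. Epow n v = 0)"
  have m: "Epow m v = 0" unfolding m_def using n by (rule LeastI)
  then obtain j where j: "m = Suc j" using assms by (cases m) auto
  have "Epow j v \<noteq> 0" using not_less_Least[of j "\<lambda>n. Epow n v = 0"] by (auto simp flip: m_def simp: j)
  then show ?thesis using that m by (auto simp: j)
qed

lemma dual_eigenspace: "vector_space_endo.eigenspace (*s) ((*v) (- X)) c = X.eigenspace (- c)"
proof -
  interpret d: sl2_rep F E "- X" by (rule dual)
  show ?thesis
    by (auto simp: d.X.eigenspace_def X.eigenspace_def matrix_vector_uminus_left) (metis minus_minus)
qed

lemma dual_casimir: "sl2_rep.casimir F E (- X) = casimir"
proof -
  interpret d: sl2_rep F E "- X" by (rule dual)
  have "E ** F = F ** E + (X + X)" using EF by (simp add: algebra_simps)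
  then show ?thesis
    by (simp add: d.casimir_def casimir_def matrix_mult_uminus_left matrix_mult_uminus_right)
qed

lemma last_Fpow:
  assumes "v \<noteq> 0" obtains j where "Fpow j v \<noteq> 0" "F *v Fpow j v = 0"
  using sl2_rep.last_Epow[OF dual assms] .

lemma GE_lw:
  assumes "v \<in> GE k" "F *v v = 0"
  shows "v \<in> X.eigenspace (- (of_nat k / 2))"
proof -
  interpret d: sl2_rep F E "- X" by (rule dual)
  have "d.GE k = GE k" unfolding d.GE_def GE_def dual_casimir d.casimir_val_def casimir_val_def ..
  then show ?thesis using d.GE_hw[of v k] assms dual_eigenspace by simp
qed

text \<open>The index is twice the weight.\<close>

definition hw_space :: "nat \<Rightarrow> (complex ^ 'n) set" where
  "hw_space k = {w. E *v w = 0 \<and> w \<in> X.eigenspace (of_nat k / 2)}"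

text \<open>Otherwise \<open>F\<^sup>k\<^sup>+\<^sup>1 w\<close> would be a highest weight vector of negative weight.\<close>

lemma string_end:
  assumes "w \<in> hw_space k" shows "Fpow (Suc k) w = 0"
proof (rule ccontr)
  assume ne: "Fpow (Suc k) w \<noteq> 0"
  have w: "E *v w = 0" "X *v w = (of_nat k / 2) *s w" "w \<in> X.eigenspace (of_nat k / 2)"
    using assms by (auto simp: hw_space_def X.eigenspace_def)
  have "2 *s (X *v w) - of_nat k *s w = 0" by (simp add: w(2))
  then have "E *v Fpow (Suc k) w = 0" by (simp only: E_Fpow w(1) Fpow_linear) simp
  moreover have "Fpow (Suc k) w \<in> X.eigenspace (of_nat k / 2 - of_nat (Suc k))"
    using eigen_Fpow[OF w(3)] .
  ultimately obtain i :: nat where "of_nat k / 2 - of_nat (Suc k) = (of_nat i / 2 :: complex)"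
    using hw_weight_half_nat ne by blast
  then have "real k / 2 - (1 + real k) = real i / 2" by (auto dest: arg_cong[of _ _ Re])
  then show False by (simp add: field_simps)
qed

text \<open>In \<open>GE k\<close> all highest weight vectors have weight \<open>k/2\<close> and all lowest weight vectors weight
  \<open>-k/2\<close>, which places every weight vector on a string.\<close>

lemma GE_string:
  assumes v: "v \<in> GE k" "v \<in> X.eigenspace c"
  shows "\<exists>w\<in>hw_space k. \<exists>i\<le>k. v = Fpow i w"
proof (cases "v = 0")
  case True
  have "0 \<in> hw_space k" by (simp add: hw_space_def X.eigenspace_def)
  then show ?thesis using True Fpow_linear(3) by (metis le0)
next
  case False
  obtain j where j: "Epow j v \<noteq> 0" "E *v Epow j v = 0" using last_Epow[OF False] .
  have top: "c = of_nat k / 2 - of_nat j"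
    if "Epow j u \<noteq> 0" "E *v Epow j u = 0" "u \<in> GE k" "u \<in> X.eigenspace c" for u j
    using eigen_eq[OF eigen_Epow[OF that(4)] GE_hw[OF GE_pow(1)[OF that(3)] that(2)] that(1)]
    by (simp add: algebra_simps)
  obtain j' where j': "Fpow j' v \<noteq> 0" "F *v Fpow j' v = 0" using last_Fpow[OF False] .
  have "c - of_nat j' = - (of_nat k / 2)"
    using eigen_eq[OF eigen_Fpow[OF v(2)] GE_lw[OF GE_pow(2)[OF v(1)] j'(2)] j'(1)] .
  with top[OF j v] have "real k / 2 - real j - real j' = - (real k / 2)"
    by (auto dest: arg_cong[of _ _ Re])
  then have "j \<le> k" by linarith
  then have nz: "hw_coeff j (of_nat k / 2) \<noteq> 0" using hw_coeff_nonzero[of j "real k / 2"] by simp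
  define w where "w = (1 / hw_coeff j (of_nat k / 2)) *s Epow j v"
  have w: "E *v w = 0" "w \<in> X.eigenspace (of_nat k / 2)"
    using j(2) GE_hw[OF GE_pow(1)[OF v(1)] j(2)] vec.subspace_scale[OF X.subspace_eigenspace]
    by (auto simp: w_def vec.scale)
  have wGE: "w \<in> GE k" using v GE_pow vec.subspace_scale[OF subspace_GE] by (simp add: w_def)
  have "v - Fpow j w = 0"
  proof (rule ccontr)
    assume ne: "v - Fpow j w \<noteq> 0"
    have "v - Fpow j w \<in> X.eigenspace c"
      using eigen_Fpow[OF w(2), of j] v(2) top[OF j v]
        vec.subspace_diff[OF X.subspace_eigenspace] by simp
    moreover have "v - Fpow j w \<in> GE k"
      using wGE v GE_pow vec.subspace_diff[OF subspace_GE] by blast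
    moreover obtain i where i: "Epow i (v - Fpow j w) \<noteq> 0" "E *v Epow i (v - Fpow j w) = 0"
      using last_Epow[OF ne] .
    ultimately have "c = of_nat k / 2 - of_nat i" using top by blast
    then have "i = j" using top[OF j v] by simp
    moreover have "Epow j (v - Fpow j w) = 0"
      using Epow_Fpow_hw[OF w, of j] nz by (simp add: Epow_linear w_def)
    ultimately show False using i by simp
  qed
  then show ?thesis using w \<open>j \<le> k\<close> by (auto simp: hw_space_def)
qed

lemma span_strings: "vec.span {Fpow i w | i k w. i \<le> k \<and> w \<in> hw_space k} = UNIV"
proof -
  let ?S = "{Fpow i w | i k w. i \<le> k \<and> w \<in> hw_space k}"
  have "GE k \<subseteq> vec.span ?S" for k
  proof
    fix v assume "v \<in> GE k"
    then have "v \<in> vec.span (\<Union>c. X.eigenspace c \<inter> GE k)" by (rule GE_eigenvectors)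
    moreover have "(\<Union>c. X.eigenspace c \<inter> GE k) \<subseteq> ?S" using GE_string by blast
    ultimately show "v \<in> vec.span ?S" using vec.span_mono by blast
  qed
  then show ?thesis using span_GE vec.span_minimal[OF _ vec.subspace_span, of "\<Union>k. GE k" ?S] by blast
qed

end

section \<open>Projections onto sums of weight spaces\<close>

lemma matrix_eq_on_span:
  fixes M N :: "complex ^ 'n ^ 'm"
  assumes "vec.span A = UNIV" "\<And>v. v \<in> A \<Longrightarrow> M *v v = N *v v"
  shows "M = N"
proof -
  have "vec.span A \<subseteq> {v. M *v v = N *v v}"
    by (rule vec.span_minimal)
      (use assms(2) in \<open>auto simp: vec.subspace_def matrix_vector_right_distrib vec.scale\<close>)
  then show ?thesis using assms(1) by (auto simp: matrix_eq)
qed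

text \<open>The description by \<open>THE\<close> is meaningful as soon as the two spans are complementary.\<close>

lemma proj_along:
  assumes "vec.span (A \<union> B) = UNIV" "vec.span A \<inter> vec.span B \<subseteq> {0}"
  shows "v \<in> A \<Longrightarrow> proj_along A B *v v = v" "v \<in> B \<Longrightarrow> proj_along A B *v v = 0"
proof -
  have dec: "\<exists>a. a \<in> vec.span A \<and> v - a \<in> vec.span B" for v
  proof -
    have "v \<in> vec.span (A \<union> B)" using assms(1) by simp
    then obtain a b where "a \<in> vec.span A" "b \<in> vec.span B" "v = a + b"
      unfolding vec.span_Un by blast
    then show ?thesis by (intro exI[of _ a]) simp
  qed
  define g where "g v = (SOME a. a \<in> vec.span A \<and> v - a \<in> vec.span B)" for v
  have g: "g v \<in> vec.span A" "v - g v \<in> vec.span B" for v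
    unfolding g_def using someI_ex[OF dec[of v]] by auto
  have unique: "g v = a" if "a \<in> vec.span A" "v - a \<in> vec.span B" for v a
  proof -
    have "g v - a \<in> vec.span A" using g(1) that(1) by (rule vec.span_diff)
    moreover have "(v - a) - (v - g v) \<in> vec.span B" using that(2) g(2) by (rule vec.span_diff)
    then have "g v - a \<in> vec.span B" by simp
    ultimately have "g v - a = 0" using assms(2) by blast
    then show ?thesis by simp
  qed
  have "Vector_Spaces.linear (*s) (*s) g"
  proof unfold_locales
    fix v w :: "complex ^ 'a" and c
    show "g (v + w) = g v + g w"
    proof (rule unique)
      show "g v + g w \<in> vec.span A" by (intro vec.span_add g)
      have "(v - g v) + (w - g w) \<in> vec.span B" by (intro vec.span_add g)
      then show "v + w - (g v + g w) \<in> vec.span B" by (simp add: algebra_simps)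
    qed
    show "g (c *s v) = c *s g v"
    proof (rule unique)
      show "c *s g v \<in> vec.span A" by (intro vec.span_scale g)
      have "c *s (v - g v) \<in> vec.span B" by (intro vec.span_scale g)
      then show "c *s v - c *s g v \<in> vec.span B" by (simp add: vec.scale_right_diff_distrib)
    qed
  qed
  then have m: "matrix g *v v = g v" for v by (rule matrix_works)
  have "(\<forall>v\<in>A. matrix g *v v = v) \<and> (\<forall>v\<in>B. matrix g *v v = 0)"
    unfolding m using unique[OF vec.span_base] unique[OF vec.span_zero]
    by (simp add: vec.span_base vec.span_zero)
  moreover have "P = matrix g" if P: "(\<forall>v\<in>A. P *v v = v) \<and> (\<forall>v\<in>B. P *v v = 0)" for P
    using calculation P by (intro matrix_eq_on_span[OF assms(1)]) auto
  ultimately have "(\<forall>v\<in>A. proj_along A B *v v = v) \<and> (\<forall>v\<in>B. proj_along A B *v v = 0)"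
    unfolding proj_along_def by (rule theI)
  then show "v \<in> A \<Longrightarrow> proj_along A B *v v = v" "v \<in> B \<Longrightarrow> proj_along A B *v v = 0" by auto
qed

context sl2_rep
begin

lemma weight_space_eq: "weight_space X k = X.eigenspace (of_real k)"
  by (simp add: weight_space_def X.eigenspace_def)

lemma half_nat_minus_half_int: "real k / 2 - real i \<in> half_ints"
  unfolding half_ints_def by (rule CollectI, rule exI[of _ "int k - 2 * int i"]) simp

lemma span_half_int_weight_spaces: "vec.span (\<Union>k\<in>half_ints. weight_space X k) = UNIV"
proof -
  have "Fpow i w \<in> (\<Union>k\<in>half_ints. weight_space X k)" if "w \<in> hw_space k" for i k w
  proof -
    have "Fpow i w \<in> X.eigenspace (of_nat k / 2 - of_nat i)"
      using that eigen_Fpow by (auto simp: hw_space_def)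
    then have "Fpow i w \<in> weight_space X (real k / 2 - real i)" by (simp add: weight_space_eq)
    then show ?thesis using half_nat_minus_half_int by blast
  qed
  then have "{Fpow i w | i k w. i \<le> k \<and> w \<in> hw_space k} \<subseteq> (\<Union>k\<in>half_ints. weight_space X k)"
    by blast
  then show ?thesis using vec.span_mono span_strings by blast
qed

lemma span_weight_spaces: "vec.span (\<Union>k. weight_space X k) = UNIV"
  using vec.span_mono[of "\<Union>k\<in>half_ints. weight_space X k" "\<Union>k. weight_space X k"]
    span_half_int_weight_spaces by blast

lemma eigenvalue_half_int:
  assumes "v \<in> X.eigenspace c" "v \<noteq> 0" shows "\<exists>k\<in>half_ints. c = of_real k"
proof (rule ccontr)
  assume "\<not> ?thesis"
  then have disj: "of_real ` half_ints \<inter> {c} = {}" by blast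
  have "v \<in> vec.span (\<Union>c\<in>of_real ` half_ints. X.eigenspace c)"
    using span_half_int_weight_spaces by (simp add: weight_space_eq)
  moreover have "v \<in> vec.span (\<Union>c\<in>{c}. X.eigenspace c)"
    using assms by (simp add: vec.span_base)
  ultimately show False using X.span_eigenspaces_Int[OF disj] assms(2) by blast
qed

lemma is_weight_half_int: "is_weight X k \<Longrightarrow> k \<in> half_ints"
proof -
  assume "is_weight X k"
  then obtain v where "v \<in> X.eigenspace (of_real k)" "v \<noteq> 0"
    by (auto simp: is_weight_def weight_space_eq)
  then show "k \<in> half_ints" using eigenvalue_half_int by (metis of_real_eq_iff)
qed

lemma eq_on_weights:
  assumes "\<And>k v. v \<in> weight_space X k \<Longrightarrow> M *v v = N *v v" shows "M = N"
  by (rule matrix_eq_on_span[OF span_weight_spaces]) (use assms in auto)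

lemma weight_sum_Int:
  assumes "K \<inter> L = {}" "v \<in> weight_sum X K" "v \<in> weight_sum X L" shows "v = 0"
proof -
  have "complex_of_real ` K \<inter> of_real ` L = {}" using assms(1) by auto
  then show ?thesis
    using X.span_eigenspaces_Int[of "of_real ` K" "of_real ` L" v] assms(2,3)
    by (simp add: weight_sum_def weight_space_eq)
qed

lemma weight_sum_Un: "vec.span (weight_sum X K \<union> weight_sum X (- K)) = UNIV"
proof -
  have "(\<Union>k. weight_space X k) \<subseteq> weight_sum X K \<union> weight_sum X (- K)"
    by (auto simp: weight_sum_def) (metis ComplI UN_I vec.span_base)
  then show ?thesis using vec.span_mono span_weight_spaces by blast
qed

lemma weight_proj:
  assumes "v \<in> weight_space X k"
  shows "k \<in> K \<Longrightarrow> weight_proj X K *v v = v" "k \<notin> K \<Longrightarrow> weight_proj X K *v v = 0"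
proof -
  have "vec.span (weight_sum X K) \<inter> vec.span (weight_sum X (- K)) \<subseteq> {0}"
    using weight_sum_Int[of K "- K"]
    by (auto simp: weight_sum_def vec.span_span)
  note * = proj_along[OF weight_sum_Un this]
  have "v \<in> weight_sum X L" if "k \<in> L" for L
    using assms that by (auto simp: weight_sum_def intro: vec.span_base)
  then show "k \<in> K \<Longrightarrow> weight_proj X K *v v = v" "k \<notin> K \<Longrightarrow> weight_proj X K *v v = 0"
    using * by (auto simp: weight_proj_def)
qed

lemma weight_proj_weight_vector:
  "v \<in> weight_space X k \<Longrightarrow> weight_proj X K *v v = (if k \<in> K then v else 0)"
  using weight_proj by simp

lemma weight_proj_mult: "weight_proj X K ** weight_proj X L = weight_proj X (K \<inter> L)"
  by (rule eq_on_weights) (simp add: weight_proj_weight_vector flip: matrix_vector_mul_assoc)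

lemma weight_proj_cong:
  "(\<And>k. is_weight X k \<Longrightarrow> k \<in> K \<longleftrightarrow> k \<in> L) \<Longrightarrow> weight_proj X K = weight_proj X L"
  by (rule eq_on_weights) (auto simp: weight_proj_weight_vector is_weight_def)

lemma weight_proj_UNIV: "weight_proj X UNIV = mat 1"
  by (rule eq_on_weights) (auto simp: weight_proj_weight_vector)

lemma weight_proj_empty: "weight_proj X {} = 0"
  by (rule eq_on_weights) (auto simp: weight_proj_weight_vector)

lemma weight_proj_Un:
  "K \<inter> L = {} \<Longrightarrow> weight_proj X (K \<union> L) = weight_proj X K + weight_proj X L"
  by (rule eq_on_weights)
    (auto simp: weight_proj_weight_vector matrix_vector_mult_add_rdistrib)

definition has_weight :: "complex ^ 'n ^ 'n \<Rightarrow> real \<Rightarrow> bool" where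
  "has_weight M d \<longleftrightarrow> X ** M - M ** X = mat (of_real d) ** M"

lemma mat_mult_v: "(mat c ** M) *v v = c *s (M *v v)" for v :: "complex ^ 'n"
  by (simp add: vec_eq_iff matrix_vector_mult_def sum_distrib_left mult.assoc)

lemma X_mult_v:
  assumes "X ** M - M ** X = mat c ** M" "v \<in> X.eigenspace k"
  shows "M *v v \<in> X.eigenspace (k + c)"
proof -
  have "X *v (M *v v) - M *v (X *v v) = c *s (M *v v)"
    using arg_cong[OF assms(1), of "\<lambda>A. A *v v"]
    by (simp add: matrix_vector_mult_diff_rdistrib mat_mult_v matrix_vector_mul_assoc)
  then show ?thesis using assms(2)
    by (simp add: X.eigenspace_def vec.scale vec.scale_left_distrib algebra_simps)
qed

lemma has_weight_v: "has_weight M d \<Longrightarrow> v \<in> weight_space X k \<Longrightarrow> M *v v \<in> weight_space X (k + d)"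
  using X_mult_v[of M "of_real d" v "of_real k"] by (simp add: has_weight_def weight_space_eq)

lemma weight_proj_shift:
  assumes "has_weight M d"
  shows "weight_proj X K ** M = M ** weight_proj X {k. k + d \<in> K}"
  by (rule eq_on_weights)
    (auto simp: weight_proj_weight_vector weight_proj_weight_vector[OF has_weight_v[OF assms]]
      simp flip: matrix_vector_mul_assoc)

text \<open>\<open>M\<close> maps some weight vector to a nonzero weight vector, and \<open>c\<close> is the difference of their
  weights.\<close>

lemma ad_eigenvalue_half_int:
  assumes "X ** M - M ** X = mat c ** M" "M \<noteq> 0"
  shows "\<exists>d\<in>half_ints. c = of_real d"
proof -
  obtain k v where v: "v \<in> weight_space X k" "M *v v \<noteq> 0"
    using eq_on_weights[of M 0] assms(2) by auto
  then have "is_weight X k" by (auto simp: is_weight_def) (metis matrix_vector_mult_0_right)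
  then obtain n where n: "k = of_int n / 2" using is_weight_half_int by (auto simp: half_ints_def)
  have "M *v v \<in> X.eigenspace (of_real k + c)"
    using X_mult_v[OF assms(1)] v by (simp add: weight_space_eq)
  then obtain d where d: "d \<in> half_ints" "of_real k + c = of_real d"
    using eigenvalue_half_int v by blast
  then obtain n' where n': "d = of_int n' / 2" by (auto simp: half_ints_def)
  have "c = of_real (d - k)" using d(2) by (simp add: algebra_simps)
  moreover have "d - k \<in> half_ints"
    unfolding half_ints_def by (rule CollectI, rule exI[of _ "n' - n"]) (simp add: n n' diff_divide_distrib)
  ultimately show ?thesis by blast
qed

lemma has_weight_E: "has_weight E 1" and has_weight_F: "has_weight F (- 1)"
  unfolding has_weight_def XE XF by (simp_all add: vec_eq_iff)

lemma highest_weight_nonneg: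
  assumes "highest_weight_vector X E k v" obtains i :: nat where "k = real i / 2"
proof -
  obtain i :: nat where "complex_of_real k = of_nat i / 2"
    using assms hw_weight_half_nat by (auto simp: highest_weight_vector_def weight_space_eq)
  then have "complex_of_real k = of_real (real i / 2)" by simp
  then have "k = real i / 2" by (simp only: of_real_eq_iff)
  then show ?thesis using that by blast
qed

text \<open>The last nonzero vector \<open>E\<^sup>i v\<close> of the string through \<open>v\<close>.\<close>

lemma lowest_imp_highest:
  assumes "v \<noteq> 0" "v \<in> weight_space X p" "F *v v = 0"
  shows "\<exists>u. highest_weight_vector X E (- p) u"
proof -
  interpret d: sl2_rep F E "- X" by (rule dual)
  have v: "v \<in> d.X.eigenspace (of_real (- p))"
    using assms(2) dual_eigenspace by (simp add: weight_space_eq)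
  then have "highest_weight_vector (- X) F (- p) v"
    using assms by (simp add: highest_weight_vector_def d.weight_space_eq)
  then obtain i :: nat where i: "- p = real i / 2" using d.highest_weight_nonneg by blast
  have vi: "v \<in> d.hw_space i" using v assms(3) by (simp add: d.hw_space_def i)
  have top: "E *v Epow i v = 0" using d.string_end[OF vi] by simp
  have nz: "Epow i v \<noteq> 0"
  proof
    assume "Epow i v = 0"
    then have "d.hw_coeff i (of_real (- p)) *s v = 0"
      using d.Epow_Fpow_hw[OF assms(3) v, of i] Fpow_linear(3) by simp
    moreover have "d.hw_coeff i (of_real (- p)) \<noteq> 0"
      by (rule d.hw_coeff_nonzero) (simp add: i)
    ultimately show False using assms(1) by simp
  qed
  have "Epow i v \<in> X.eigenspace (of_real p + of_nat i)"
    using eigen_Epow assms(2) by (simp add: weight_space_eq)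
  then have "Epow i v \<in> weight_space X (p + real i)" by (simp add: weight_space_eq)
  moreover have "p + real i = - p" using i by linarith
  ultimately have "Epow i v \<in> weight_space X (- p)" by simp
  then show ?thesis using top nz by (auto simp: highest_weight_vector_def)
qed

text \<open>Applying \<open>F\<close> to a vector of weight \<open>k\<close> ends in a lowest weight vector of weight at most \<open>k\<close>,
  whose string reaches the opposite weight.\<close>

lemma weight_lower_bound:
  assumes "\<And>k. is_weight X k \<Longrightarrow> k \<le> m" "is_weight X k"
  shows "- m \<le> k"
proof -
  obtain v where v: "v \<in> weight_space X k" "v \<noteq> 0" using assms(2) by (auto simp: is_weight_def)
  obtain j where j: "Fpow j v \<noteq> 0" "F *v Fpow j v = 0" using last_Fpow[OF v(2)] .
  have "Fpow j v \<in> weight_space X (k - real j)"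
    using eigen_Fpow[of v "of_real k" j] v by (simp add: weight_space_eq)
  then obtain u where "highest_weight_vector X E (- (k - real j)) u"
    using lowest_imp_highest j by blast
  then have "is_weight X (- (k - real j))" by (auto simp: highest_weight_vector_def is_weight_def)
  then show ?thesis using assms(1) by fastforce
qed

lemma F_left_inverse:
  assumes "\<And>v. v \<in> weight_space X p \<Longrightarrow> F *v v = 0 \<Longrightarrow> v = 0"
  shows "\<exists>H. H ** F ** weight_proj X {p} = weight_proj X {p}"
proof -
  have sub: "vec.subspace (weight_space X p)" unfolding weight_space_eq by (rule X.subspace_eigenspace)
  have "inj_on ((*v) F) (weight_space X p)"
  proof (rule inj_onI)
    fix v w assume vw: "v \<in> weight_space X p" "w \<in> weight_space X p" "F *v v = F *v w"
    then have "v - w = 0"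
      using assms[OF vec.subspace_diff[OF sub vw(1,2)]]
      by (simp add: matrix_vector_mult_diff_distrib)
    then show "v = w" by simp
  qed
  from vec.linear_exists_left_inverse_on[OF matrix_vector_mul_linear_gen sub this]
  obtain g where g: "Vector_Spaces.linear (*s) (*s) g" "\<forall>v\<in>weight_space X p. g (F *v v) = v"
    by blast
  have "matrix g *v (F *v v) = v" if "v \<in> weight_space X p" for v
    using g that by (simp add: matrix_works)
  then have "matrix g ** F ** weight_proj X {p} = weight_proj X {p}"
    by (intro eq_on_weights)
      (auto simp: weight_proj_weight_vector simp flip: matrix_vector_mul_assoc)
  then show ?thesis by blast
qed

subsection \<open>The projection onto the lowest weight vectors\<close>

text \<open>The Casimir eigenvectors in an irreducible module form a submodule.\<close>

lemma casimir_isotypic: "isotypic_component X E F k \<subseteq> Om.eigenspace (casimir_val (of_real k))"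
  unfolding isotypic_component_def
proof (rule vec.span_minimal[OF _ Om.subspace_eigenspace], rule Union_least)
  fix S assume "S \<in> {S. sl2_irreducible X E F S \<and> (\<exists>v\<in>S. highest_weight_vector X E k v)}"
  then obtain v where S: "sl2_irreducible X E F S" and v: "v \<in> S" "highest_weight_vector X E k v"
    by blast
  let ?O = "Om.eigenspace (casimir_val (of_real k))"
  have "v \<in> ?O" using v casimir_hw by (simp add: highest_weight_vector_def weight_space_eq)
  have inv: "A *v w \<in> ?O" if "\<And>v. A *v (casimir *v v) = casimir *v (A *v v)" "w \<in> ?O" for A w
    using that(2) by (simp add: Om.eigenspace_def vec.scale flip: that(1))
  have "sl2_submodule X E F (S \<inter> ?O)"
    using S unfolding sl2_irreducible_def sl2_submodule_def
    by (auto intro!: vec.subspace_inter Om.subspace_eigenspace inv casimir_X casimir_E casimir_F)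
  moreover have "S \<inter> ?O \<noteq> {0}"
    using \<open>v \<in> ?O\<close> v by (auto simp: highest_weight_vector_def)
  ultimately have "S \<inter> ?O = S" using S unfolding sl2_irreducible_def by blast
  then show "S \<subseteq> ?O" by blast
qed

lemma string_irreducible:
  assumes w: "w \<in> hw_space k" "w \<noteq> 0"
  shows "sl2_irreducible X E F (vec.span (range (\<lambda>i. Fpow i w)))"
proof -
  let ?S = "vec.span (range (\<lambda>i. Fpow i w))"
  have w': "E *v w = 0" "w \<in> X.eigenspace (of_nat k / 2)" using w by (auto simp: hw_space_def)
  have base: "Fpow i w \<in> ?S" for i by (intro vec.span_base) auto
  have inv: "A *v u \<in> ?S" if "\<And>i. A *v Fpow i w \<in> ?S" "u \<in> ?S" for A u
  proof -
    have "?S \<subseteq> {u. A *v u \<in> ?S}"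
      by (rule vec.span_minimal)
        (use that(1) in \<open>auto simp: vec.subspace_def matrix_vector_right_distrib vec.scale
          intro: vec.span_add vec.span_scale vec.span_zero\<close>)
    then show ?thesis using that(2) by blast
  qed
  have Xw: "X *v Fpow i w \<in> ?S" for i
    using eigen_Fpow[OF w'(2), of i] base vec.span_scale
    unfolding X.eigenspace_def mem_Collect_eq by metis
  have Ew: "E *v Fpow i w \<in> ?S" for i
  proof (cases i)
    case (Suc j)
    have "2 *s (X *v w) - of_nat j *s w = (of_nat k - of_nat j) *s w"
      using w'(2) by (simp add: X.eigenspace_def vec.scale_left_diff_distrib)
    then show ?thesis
      unfolding Suc E_Fpow w'(1) by (simp only: Fpow_linear add_0) (intro vec.span_scale base)
  qed (simp add: w' vec.span_zero)
  have Fw: "F *v Fpow i w \<in> ?S" for i using base[of "Suc i"] by simp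
  have sub: "sl2_submodule X E F ?S"
    unfolding sl2_submodule_def using inv Xw Ew Fw by blast
  have "T = {0} \<or> T = ?S" if T: "sl2_submodule X E F T" "T \<subseteq> ?S" for T
  proof (rule disjCI)
    assume "T \<noteq> ?S"
    have subT: "vec.subspace T" using T by (simp add: sl2_submodule_def)
    have Tpow: "Epow i u \<in> T" "Fpow i u \<in> T" if "u \<in> T" for i u
      using that T by (induction i) (auto simp: sl2_submodule_def)
    show "T = {0}"
    proof (rule ccontr)
      assume "T \<noteq> {0}"
      then obtain u where u: "u \<in> T" "u \<noteq> 0" using vec.subspace_0[OF subT] by blast
      \<comment> \<open>The last nonzero \<open>E\<^sup>j u\<close> is a highest weight vector of the string, hence a multiple
        of \<open>w\<close>.\<close>
      obtain j where j: "Epow j u \<noteq> 0" "E *v Epow j u = 0" using last_Epow[OF u(2)] .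
      define y where "y = Epow j u"
      have "?S \<subseteq> Om.eigenspace (casimir_val (of_nat k / 2))"
      proof (rule vec.span_minimal[OF _ Om.subspace_eigenspace])
        have "casimir *v Fpow i w = Fpow i (casimir *v w)" for i
          by (induction i) (auto simp flip: casimir_F)
        then show "range (\<lambda>i. Fpow i w) \<subseteq> Om.eigenspace (casimir_val (of_nat k / 2))"
          using casimir_hw[OF w'] by (auto simp: Om.eigenspace_def Fpow_linear)
      qed
      moreover have y: "y \<in> T" "y \<in> ?S" using Tpow[OF u(1)] T(2) by (auto simp: y_def)
      ultimately have "y \<in> GE k"
        by (auto simp: GE_def Om.gen_eigenspace_def Om.eigenspace_def intro!: exI[of _ 1])
      then have "y \<in> X.eigenspace (of_nat k / 2)" using GE_hw j(2) by (simp add: y_def)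
      moreover have "range (\<lambda>i. Fpow i w) \<subseteq> (\<Union>c. X.eigenspace c)" using eigen_Fpow[OF w'(2)] by blast
      ultimately have "y \<in> vec.span (range (\<lambda>i. Fpow i w) \<inter> X.eigenspace (of_nat k / 2))"
        using y(2) by (intro X.eigenvector_in_span_eigenvectors)
      moreover have "v \<in> {0, w}" if v: "v \<in> range (\<lambda>i. Fpow i w)" "v \<in> X.eigenspace (of_nat k / 2)" for v
      proof -
        obtain i where i: "v = Fpow i w" using v(1) by blast
        show ?thesis
        proof (cases "v = 0")
          case False
          then have "i = 0" using eigen_eq[OF eigen_Fpow[OF w'(2), of i] _] v(2) i by fastforce
          then show ?thesis using i by simp
        qed simp
      qed
      then have "range (\<lambda>i. Fpow i w) \<inter> X.eigenspace (of_nat k / 2) \<subseteq> {0, w}" by blast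
      ultimately have "y \<in> vec.span {0, w}" using vec.span_mono by blast
      then obtain a where a: "y = a *s w" by (auto simp: vec.span_insert vec.span_singleton)
      then have "a \<noteq> 0" using j by (auto simp: y_def)
      then have "w = (1 / a) *s y" using a by simp
      then have "w \<in> T" using y(1) vec.subspace_scale[OF subT] by simp
      then have "?S \<subseteq> T" using Tpow by (intro vec.span_minimal[OF _ subT]) auto
      then show False using \<open>T \<noteq> ?S\<close> T(2) by blast
    qed
  qed
  moreover have "?S \<noteq> {0}" using base[of 0] w(2) by auto
  ultimately show ?thesis using sub unfolding sl2_irreducible_def by blast
qed

lemma string_in_isotypic:
  assumes "w \<in> hw_space k" shows "Fpow i w \<in> isotypic_component X E F (real k / 2)"
proof (cases "w = 0")
  case True
  then show ?thesis by (simp add: Fpow_linear isotypic_component_def vec.span_zero)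
next
  case False
  let ?S = "vec.span (range (\<lambda>i. Fpow i w))"
  have "w \<in> ?S" using vec.span_base[of "Fpow 0 w"] by (metis funpow_0 rangeI vec.span_base)
  moreover have "highest_weight_vector X E (real k / 2) w"
    using assms False by (simp add: highest_weight_vector_def hw_space_def weight_space_eq)
  ultimately have "?S \<subseteq> isotypic_component X E F (real k / 2)"
    unfolding isotypic_component_def
    by (intro subset_trans[OF _ vec.span_superset] Union_upper)
      (use string_irreducible[OF assms False] in blast)
  moreover have "Fpow i w \<in> ?S" by (intro vec.span_base) auto
  ultimately show ?thesis by blast
qed


text \<open>The projection onto the lowest weight vectors of weight \<open>-l\<close> is well defined: strings show
  that the two subspaces span, and Casimir eigenvalues that they meet in \<open>0\<close>.\<close>

lemma W_proj_weight_vector: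
  assumes l: "highest_weight_vector X E l u" and v: "v \<in> weight_space X k" "k \<noteq> - l"
  shows "W_proj X E F l *v v = 0"
proof -
  let ?I = "vec.span (\<Union>k\<in>- {l}. isotypic_component X E F k)"
  let ?U = "weight_space X (- l) \<inter> ?I"
  let ?A = "W_space X F l" and ?B = "vec.span (weight_sum X (- {- l}) \<union> ?U)"
  obtain n :: nat where n: "l = real n / 2" using highest_weight_nonneg[OF l] .
  have subl: "vec.subspace (weight_space X (- l))"
    unfolding weight_space_eq by (rule X.subspace_eigenspace)
  have subU: "vec.subspace ?U" by (intro vec.subspace_inter subl vec.subspace_span)
  have in_sum: "y \<in> weight_sum X K" if "y \<in> weight_space X q" "q \<in> K" for y q K
    using that by (auto simp: weight_sum_def intro: vec.span_base)
  have A_weight: "?A \<subseteq> weight_space X (- l)"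
    unfolding W_space_def by (rule vec.span_minimal[OF _ subl]) (auto simp: lowest_weight_vector_def)
  have A_casimir: "?A \<subseteq> Om.eigenspace (casimir_val (of_real l))"
    unfolding W_space_def
  proof (rule vec.span_minimal[OF _ Om.subspace_eigenspace], clarify)
    fix y assume "lowest_weight_vector X F (- l) y"
    then have y: "F *v y = 0" "X *v y = (- of_real l) *s y"
      by (auto simp: lowest_weight_vector_def weight_space_def)
    have XXy: "X *v (X *v y) = (of_real l * of_real l) *s y"
      unfolding y(2) vec.scale by (simp add: y(2))
    have EFy: "F *v (E *v y) = - (2 *s (X *v y))"
      using EF_v[of y] y(1) by (simp add: eq_neg_iff_add_eq_0)
    show "y \<in> Om.eigenspace (casimir_val (of_real l))"
      unfolding Om.eigenspace_def mem_Collect_eq casimir_v EFy XXy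
      by (simp add: y(2) casimir_val_def vec_eq_iff algebra_simps)
  qed
  have "vec.span (?A \<union> ?B) = UNIV"
  proof -
    have "Fpow i w \<in> ?A \<union> ?B" if w: "w \<in> hw_space k" for i k w
    proof -
      have q: "Fpow i w \<in> weight_space X (real k / 2 - real i)"
        using w eigen_Fpow[of w "of_nat k / 2" i] by (simp add: hw_space_def weight_space_eq)
      consider "real k / 2 - real i \<noteq> - l" | "real k / 2 - real i = - l" "real k / 2 \<noteq> l"
        | "real k / 2 = l" "i = k" using n by fastforce
      then show ?thesis
      proof cases
        case 1
        then show ?thesis using in_sum[OF q] by (auto intro: vec.span_base)
      next
        case 2
        then have "Fpow i w \<in> ?I"
          using string_in_isotypic[OF w, of i] by (intro vec.span_base) auto
        then show ?thesis using q 2 by (auto intro: vec.span_base)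
      next
        case 3
        have "F *v Fpow i w = 0" using string_end[OF w] 3 by simp
        moreover have "Fpow i w \<in> weight_space X (- l)" using q 3 by (simp add: field_simps)
        ultimately have "Fpow i w \<in> ?A"
          unfolding W_space_def lowest_weight_vector_def
          by (cases "Fpow i w = 0") (auto intro: vec.span_base vec.span_zero)
        then show ?thesis by blast
      qed
    qed
    then have "{Fpow i w | i k w. i \<le> k \<and> w \<in> hw_space k} \<subseteq> ?A \<union> ?B" by blast
    then show ?thesis using vec.span_mono span_strings by blast
  qed
  moreover have "vec.span ?A \<inter> vec.span ?B \<subseteq> {0}"
  proof
    fix y assume "y \<in> vec.span ?A \<inter> vec.span ?B"
    then have y: "y \<in> ?A" "y \<in> ?B" by (simp_all only: W_space_def vec.span_span Int_iff)
    have "vec.span (weight_sum X (- {- l})) = weight_sum X (- {- l})"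
      by (simp add: weight_sum_def vec.span_span)
    moreover have "vec.span ?U = ?U" using subU by (simp only: vec.span_eq_iff)
    moreover obtain a u where "a \<in> vec.span (weight_sum X (- {- l}))" "u \<in> vec.span ?U"
      and yau: "y = a + u"
      using y(2) unfolding vec.span_Un by blast
    ultimately have a: "a \<in> weight_sum X (- {- l})" and u: "u \<in> ?U" by blast+
    have "y - u \<in> weight_space X (- l)"
      using y(1) A_weight u by (intro vec.subspace_diff[OF subl]) auto
    then have "a \<in> weight_sum X {- l}" using yau by (auto intro: in_sum)
    then have "a = 0" using weight_sum_Int[OF _ a, of "{- l}"] by blast
    have iso: "isotypic_component X E F k \<subseteq>
        vec.span (\<Union>c\<in>- {casimir_val (of_real l)}. Om.eigenspace c)" if "k \<noteq> l" for k
    proof (cases "\<exists>v. highest_weight_vector X E k v")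
      case True
      then obtain i :: nat where i: "k = real i / 2" using highest_weight_nonneg by blast
      have "complex_of_real k = of_nat i / 2" "complex_of_real l = of_nat n / 2"
        by (simp_all add: i n)
      moreover have "i \<noteq> n" using i n that by auto
      ultimately have "casimir_val (of_real k) \<noteq> casimir_val (of_real l)"
        using casimir_val_half_nat[of i n] by metis
      then show ?thesis using casimir_isotypic[of k] by (auto intro: vec.span_base)
    next
      case False
      then have "isotypic_component X E F k = vec.span {}"
        unfolding isotypic_component_def by (intro arg_cong[of _ _ vec.span]) blast
      then show ?thesis by (simp add: vec.span_zero)
    qed
    have "?I \<subseteq> vec.span (\<Union>c\<in>- {casimir_val (of_real l)}. Om.eigenspace c)"
      by (rule vec.span_minimal) (use iso in auto)
    then have "y \<in> vec.span (\<Union>c\<in>- {casimir_val (of_real l)}. Om.eigenspace c)"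
      using yau u \<open>a = 0\<close> by auto
    moreover have "y \<in> vec.span (\<Union>c\<in>{casimir_val (of_real l)}. Om.eigenspace c)"
      using y(1) A_casimir by (auto intro: vec.span_base)
    ultimately show "y \<in> {0}" using Om.span_eigenspaces_Int[of "- {casimir_val (of_real l)}"] by blast
  qed
  ultimately have "proj_along ?A ?B *v v = 0"
    by (rule proj_along(2)) (intro vec.span_base UnI1 in_sum[OF v(1)], use v in auto)
  then show ?thesis by (simp add: W_proj_def)
qed

lemma W_proj_mult_weight_proj:
  assumes "highest_weight_vector X E l u"
  shows "W_proj X E F l ** weight_proj X {- l} = W_proj X E F l"
  by (rule eq_on_weights)
    (auto simp: weight_proj_weight_vector W_proj_weight_vector[OF assms]
      simp flip: matrix_vector_mul_assoc)

subsection \<open>The leading term of the operator to be inverted\<close>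

lemma one_plus_F_inverse: "\<exists>H. (mat 1 + F) ** H = mat 1 \<and> H ** (mat 1 + F) = mat 1"
proof -
  have "v = 0" if "(mat 1 + F) *v v = 0" for v
  proof -
    have "F *v v = - v"
      using that by (simp add: matrix_vector_mult_add_rdistrib add_eq_0_iff)
    then have "Fpow j v = (- 1) ^ j *s v" for j
      by (induction j) (auto simp: vec.scale)
    moreover obtain j where "Fpow j v = 0" using nilpotent_F by blast
    ultimately have "(- 1) ^ j *s v = 0" by metis
    then show ?thesis by simp
  qed
  then obtain H where "H ** (mat 1 + F) = mat 1"
    using matrix_left_invertible_ker[of "mat 1 + F"] by blast
  then show ?thesis using matrix_left_right_inverse by blast
qed

text \<open>With \<open>m\<close> the largest weight, \<open>1 + F\<close> compressed to a map from \<open>V[>-m]\<close> to \<open>V[<m]\<close> is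
  invertible, because \<open>F\<^sup>2\<^sup>m\<close> maps \<open>V[m]\<close> isomorphically onto \<open>V[-m]\<close> with inverse a multiple of
  \<open>E\<^sup>2\<^sup>m\<close>: the preimage of \<open>y\<close> is \<open>(1 + F)\<^sup>-\<^sup>1 (y + w)\<close> with the unique \<open>w \<in> V[m]\<close> for which the
  component of weight \<open>-m\<close> vanishes.\<close>

lemma one_plus_F_rel_inverse:
  assumes m: "is_weight X m" "\<And>k. is_weight X k \<Longrightarrow> k \<le> m"
  defines "P \<equiv> weight_proj X {..<m}" and "Q \<equiv> weight_proj X {- m<..}"
  shows "\<exists>C. Q ** C ** P = C \<and> P ** (mat 1 + F) ** Q ** C = P \<and> C ** (P ** (mat 1 + F) ** Q) = Q"
proof -
  interpret d: sl2_rep F E "- X" by (rule dual)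
  define Pm where "Pm = weight_proj X {- m}"
  define Pp where "Pp = weight_proj X {m}"
  have low: "- m \<le> k" if "is_weight X k" for k using weight_lower_bound m(2) that by blast
  have none: "v = 0" if "v \<in> weight_space X k" "\<not> (- m \<le> k \<and> k \<le> m)" for v k
    using that low m(2) by (auto simp: is_weight_def)
  have "weight_proj X ({..<m} \<union> {m}) = mat 1"
    unfolding weight_proj_UNIV[symmetric] by (rule weight_proj_cong) (use m(2) in force)
  then have PPp: "P + Pp = mat 1" using weight_proj_Un[of "{..<m}" "{m}"] by (simp add: P_def Pp_def)
  have "weight_proj X ({- m<..} \<union> {- m}) = mat 1"
    unfolding weight_proj_UNIV[symmetric] by (rule weight_proj_cong) (use low in force)
  then have QPm: "Q + Pm = mat 1" using weight_proj_Un[of "{- m<..}" "{- m}"] by (simp add: Q_def Pm_def)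
  have QQ: "Q ** Q = Q" and PP: "P ** P = P" and PmQ: "Pm ** Q = 0"
    by (auto simp: Q_def P_def Pm_def Pp_def weight_proj_mult weight_proj_empty
        simp flip: weight_proj_empty intro!: arg_cong[of _ _ "weight_proj X"])
  have range: "weight_proj X {k} *v v \<in> weight_space X k" for k v
  proof -
    have "vec.span (\<Union>k. weight_space X k) \<subseteq> {v. weight_proj X {k} *v v \<in> weight_space X k}"
    proof (rule vec.span_minimal)
      have sub: "vec.subspace (weight_space X k)"
        unfolding weight_space_eq by (rule X.subspace_eigenspace)
      show "(\<Union>k. weight_space X k) \<subseteq> {v. weight_proj X {k} *v v \<in> weight_space X k}"
        using vec.subspace_0[OF sub] by (auto simp: weight_proj_weight_vector)
      show "vec.subspace {v. weight_proj X {k} *v v \<in> weight_space X k}"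
        using vec.subspace_0[OF sub] vec.subspace_add[OF sub] vec.subspace_scale[OF sub]
        by (auto simp: vec.subspace_def matrix_vector_right_distrib vec.scale)
    qed
    then show ?thesis using span_weight_spaces by blast
  qed
  obtain v0 where "v0 \<in> weight_space X m" "v0 \<noteq> 0" using m(1) by (auto simp: is_weight_def)
  moreover have E0: "E *v v = 0" if "v \<in> weight_space X m" for v
    using none[OF has_weight_v[OF has_weight_E that]] by simp
  ultimately have "highest_weight_vector X E m v0" by (simp add: highest_weight_vector_def)
  then obtain n :: nat where n: "m = real n / 2" using highest_weight_nonneg by blast
  have F0: "F *v v = 0" if "v \<in> weight_space X (- m)" for v
    using none[OF has_weight_v[OF has_weight_F that]] by simp
  define c where "c = hw_coeff n (of_real m)"
  have c: "c \<noteq> 0" unfolding c_def by (rule hw_coeff_nonzero) (simp add: n)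
  have EFn: "Epow n (Fpow n v) = c *s v" if "v \<in> weight_space X m" for v
    using Epow_Fpow_hw[OF E0[OF that]] that by (simp add: c_def weight_space_eq)
  have FEn: "Fpow n (Epow n v) = c *s v" if v: "v \<in> weight_space X (- m)" for v
  proof -
    have "v \<in> d.X.eigenspace (of_real m)" using v dual_eigenspace by (simp add: weight_space_eq)
    then show ?thesis using d.Epow_Fpow_hw[OF F0[OF v]] by (simp add: c_def d.hw_coeff_def hw_coeff_def)
  qed
  obtain H where H: "(mat 1 + F) ** H = mat 1" "H ** (mat 1 + F) = mat 1"
    using one_plus_F_inverse by blast
  have FH: "H *v v + F *v (H *v v) = v" for v
    using arg_cong[OF H(1), of "\<lambda>M. M *v v"]
    by (simp add: matrix_vector_mult_add_rdistrib flip: matrix_vector_mul_assoc)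
  have HF: "H *v (v + F *v v) = v" for v
    using arg_cong[OF H(2), of "\<lambda>M. M *v v"]
    by (simp add: matrix_vector_mult_add_rdistrib flip: matrix_vector_mul_assoc)
  have PmH: "Pm *v (H *v w) = (- 1) ^ n *s Fpow n w" if w: "w \<in> weight_space X m" for w
  proof -
    define u where "u = H *v w"
    have rec: "weight_proj X {k} *v u + F *v (weight_proj X {k + 1} *v u) = weight_proj X {k} *v w" for k
    proof -
      have "{k'. k' + - 1 \<in> {k}} = {k + 1}" by auto
      then have "weight_proj X {k} *v (F *v u) = F *v (weight_proj X {k + 1} *v u)"
        using weight_proj_shift[OF has_weight_F, of "{k}"]
        by (simp only: matrix_vector_mul_assoc)
      then show ?thesis
        using arg_cong[OF FH[of w], of "\<lambda>v. weight_proj X {k} *v v"]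
        by (simp add: u_def matrix_vector_right_distrib)
    qed
    have "weight_proj X {m - real j} *v u = (- 1) ^ j *s Fpow j w" for j
    proof (induction j)
      case 0
      have "weight_proj X {m + 1} *v u = 0" using none[OF range] by simp
      then show ?case using rec[of m] weight_proj(1)[OF w] by simp
    next
      case (Suc j)
      have "weight_proj X {m - real (Suc j)} *v w = 0" using w by (intro weight_proj(2)) auto
      then show ?case using rec[of "m - real (Suc j)"] Suc by (simp add: vec.scale eq_neg_iff_add_eq_0)
    qed
    from this[of n] show ?thesis by (simp add: u_def Pm_def n field_simps)
  qed
  define a where "a = (- 1) ^ n / c"
  have a: "a * ((- 1) ^ n * c) = 1" using c by (simp add: a_def flip: power_mult_distrib)
  define En where "En = matrix (Epow n)"
  have En: "En *v v = Epow n v" for v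
    unfolding En_def by (rule matrix_works) (unfold_locales, simp_all add: Epow_linear)
  have Enm: "Epow n v \<in> weight_space X m" if "v \<in> weight_space X (- m)" for v
  proof -
    have "complex_of_real (- m) + of_nat n = of_real m" by (simp add: n)
    then show ?thesis using eigen_Epow[of v "of_real (- m)" n] that by (metis weight_space_eq)
  qed
  define Z where "Z y = H *v y - a *s (H *v Epow n (Pm *v (H *v y)))" for y
  define C where "C = Q ** (H - mat a ** (H ** En ** Pm ** H)) ** P"
  have mat_v: "mat a *v w = a *s w" for w :: "complex ^ 'n"
    using mat_mult_v[of a "mat 1" w] by simp
  have C: "C *v v = Q *v Z (P *v v)" for v
    by (simp add: C_def Z_def matrix_vector_mult_diff_rdistrib mat_v En
        flip: matrix_vector_mul_assoc)
  have PmZ: "Pm *v Z y = 0" for y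
  proof -
    let ?u = "Pm *v (H *v y)"
    have u: "?u \<in> weight_space X (- m)" unfolding Pm_def by (rule range)
    have "Pm *v Z y = ?u - (a * ((- 1) ^ n * c)) *s ?u"
      by (simp add: Z_def matrix_vector_mult_diff_distrib vec.scale PmH[OF Enm[OF u]] FEn[OF u])
    then show ?thesis by (simp add: a)
  qed
  have QZ: "Q *v Z y = Z y" for y
    using arg_cong[OF QPm, of "\<lambda>M. M *v Z y"] PmZ by (simp add: matrix_vector_mult_add_rdistrib)
  have Pp0: "P *v w = 0" if "w \<in> weight_space X m" for w
    using that weight_proj(2) by (simp add: P_def)
  have PFZ: "P *v (Z y + F *v Z y) = P *v y" for y
  proof -
    let ?w = "Epow n (Pm *v (H *v y))"
    have w: "?w \<in> weight_space X m" unfolding Pm_def by (rule Enm[OF range])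
    have "Z y + F *v Z y = (H *v y + F *v (H *v y)) - a *s (H *v ?w + F *v (H *v ?w))"
      by (simp add: Z_def matrix_vector_mult_diff_distrib vec.scale vec.scale_right_distrib)
    also have "\<dots> = y - a *s ?w" unfolding FH ..
    finally show ?thesis using Pp0[OF w] by (simp add: matrix_vector_mult_diff_distrib vec.scale)
  qed
  have ZP: "Z (P *v (x + F *v x)) = x" if x: "Pm *v x = 0" for x
  proof -
    let ?w = "Pp *v (x + F *v x)"
    have w: "?w \<in> weight_space X m" unfolding Pp_def by (rule range)
    have "P *v (x + F *v x) + ?w = x + F *v x"
      using arg_cong[OF PPp, of "\<lambda>M. M *v (x + F *v x)"]
      by (simp only: matrix_vector_mult_add_rdistrib matrix_vector_mul_lid)
    then have "P *v (x + F *v x) = (x + F *v x) - ?w" by (simp only: eq_diff_eq)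
    then have Hy: "H *v (P *v (x + F *v x)) = x - H *v ?w"
      by (simp only: matrix_vector_mult_diff_distrib HF)
    have 1: "Pm *v (x - H *v ?w) = (- ((- 1) ^ n)) *s Fpow n ?w"
      by (simp add: matrix_vector_mult_diff_distrib x PmH[OF w])
    have 2: "Epow n (Pm *v (x - H *v ?w)) = (- ((- 1) ^ n) * c) *s ?w"
      unfolding 1 Epow_linear EFn[OF w] by simp
    have "Z (P *v (x + F *v x)) = x - H *v ?w + (a * ((- 1) ^ n * c)) *s (H *v ?w)"
      unfolding Z_def Hy 2 vec.scale by simp
    then show ?thesis by (simp add: a)
  qed
  have "Q ** C ** P = C"
    by (simp add: C_def matrix_mul_assoc QQ) (simp add: PP flip: matrix_mul_assoc)
  moreover have "P ** (mat 1 + F) ** Q ** C = P"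
  proof -
    have "(P ** (mat 1 + F) ** Q ** C) *v v = P *v v" for v
      using PFZ[of "P *v v"] PP
      by (simp add: QZ C matrix_vector_mult_add_rdistrib flip: matrix_vector_mul_assoc)
         (simp add: matrix_vector_mul_assoc)
    then show ?thesis by (simp add: matrix_eq)
  qed
  moreover have "C ** (P ** (mat 1 + F) ** Q) = Q"
  proof -
    have "(C ** (P ** (mat 1 + F) ** Q)) *v v = Q *v v" for v
    proof -
      have "P *v (P *v x) = P *v x" for x using PP by (simp add: matrix_vector_mul_assoc)
      moreover have "Pm *v (Q *v v) = 0" using PmQ by (simp add: matrix_vector_mul_assoc)
      moreover have "Q *v (Q *v v) = Q *v v" using QQ by (simp add: matrix_vector_mul_assoc)
      ultimately show ?thesis
        using ZP[of "Q *v v"]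
        by (simp add: C matrix_vector_mult_add_rdistrib flip: matrix_vector_mul_assoc)
    qed
    then show ?thesis by (simp add: matrix_eq)
  qed
  ultimately show ?thesis by blast
qed

text \<open>A lowest weight vector of weight \<open>p\<close> would force the highest weight \<open>-p\<close>, strictly between
  \<open>l\<close> and \<open>m\<close>.\<close>

lemma F_injective_between:
  assumes "\<And>k v. k \<in> half_ints \<Longrightarrow> k < m \<Longrightarrow> highest_weight_vector X E k v \<Longrightarrow> k \<le> l"
    and "- m < p" "p < - l" and v: "v \<in> weight_space X p" "F *v v = 0"
  shows "v = 0"
proof (rule ccontr)
  assume "v \<noteq> 0"
  then obtain u where u: "highest_weight_vector X E (- p) u" using lowest_imp_highest v by blast
  then have "- p \<in> half_ints"
    using is_weight_half_int by (auto simp: highest_weight_vector_def is_weight_def)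
  then have "- p \<le> l" using assms(1,2) u by auto
  then show False using assms(3) by simp
qed

end

section \<open>The enveloping algebra\<close>

lemma free_const_central: "free_const c * p = p * free_const c"
proof (induction p rule: Poly_Mapping.update_induct)
  case (update f a b)
  have "Poly_Mapping.update a b f = f + Poly_Mapping.single a b"
    using update(1) by (intro poly_mapping_eqI) (auto simp: lookup_update lookup_add lookup_single in_keys_iff when_def)
  then show ?case using update by (simp add: distrib_left distrib_right mult_single mult.commute)
qed simp

lemma uea_eqI: "p - q = 0 \<Longrightarrow> p - q \<in> uea_ideal"
  using ideal_zero by simp

lemma uea_const_central: "uea_const c * a = a * uea_const c"
  by transfer (intro uea_eqI, simp add: free_const_central)

lemma uea_const_mult: "uea_const (c * d) = uea_const c * uea_const d"
  by transfer (intro uea_eqI, simp add: mult_single)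

lemma uea_const_add: "uea_const (c + d) = uea_const c + uea_const d"
  by transfer (intro uea_eqI, simp add: single_add)

lemma uea_const_1 [simp]: "uea_const 1 = 1"
  by transfer (intro uea_eqI, simp)

lemma uea_const_0 [simp]: "uea_const 0 = 0"
  by transfer (intro uea_eqI, simp)

lemma uea_const_sum: "uea_const (\<Sum>i\<in>I. c i) = (\<Sum>i\<in>I. uea_const (c i))"
  by (induction I rule: infinite_finite_induct) (auto simp: uea_const_add)

lemma uea_rel_in_ideal: "r \<in> uea_rel \<Longrightarrow> r \<in> uea_ideal"
  using ideal_rel[of r 1 1] by simp

lemma uea_gen_add: "uea_gen (a + b) = uea_gen a + uea_gen b"
  by transfer (use uea_rel_in_ideal[OF rel_add] in \<open>simp add: diff_diff_eq\<close>)

lemma uea_gen_scale: "uea_gen (c *\<^sub>C a) = uea_const c * uea_gen a"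
  by transfer (use uea_rel_in_ideal[OF rel_scale] in simp)

lemma uea_gen_lie: "uea_gen (lie a b) = uea_gen a * uea_gen b - uea_gen b * uea_gen a"
  by transfer (use uea_ideal_uminus[OF uea_rel_in_ideal[OF rel_lie]] in simp)

section \<open>Square matrices of power series\<close>

text \<open>A copy of the type of square matrices whose multiplication is the matrix product, which makes it
  an instance of \<open>ring_1\<close>.\<close>

typedef ('r, 'n) sqmat = "UNIV :: ('r ^ 'n ^ 'n) set" morphisms rep_sqmat Sqmat ..

setup_lifting type_definition_sqmat

lemmas [simp] = Sqmat_inverse[OF UNIV_I] rep_sqmat_inverse

instantiation sqmat :: (ring_1, finite) ring_1
begin

lift_definition zero_sqmat :: "('a, 'b) sqmat" is 0 .
lift_definition one_sqmat :: "('a, 'b) sqmat" is "mat 1" .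
lift_definition plus_sqmat :: "('a, 'b) sqmat \<Rightarrow> ('a, 'b) sqmat \<Rightarrow> ('a, 'b) sqmat" is "(+)" .
lift_definition minus_sqmat :: "('a, 'b) sqmat \<Rightarrow> ('a, 'b) sqmat \<Rightarrow> ('a, 'b) sqmat" is "(-)" .
lift_definition uminus_sqmat :: "('a, 'b) sqmat \<Rightarrow> ('a, 'b) sqmat" is uminus .
lift_definition times_sqmat :: "('a, 'b) sqmat \<Rightarrow> ('a, 'b) sqmat \<Rightarrow> ('a, 'b) sqmat" is "(**)" .

instance
proof
  show "(0 :: ('a, 'b) sqmat) \<noteq> 1" by transfer (simp add: vec_eq_iff mat_def)
  show "(a + b) * c = a * c + b * c" for a b c :: "('a, 'b) sqmat"
    by transfer (vector matrix_matrix_mult_def sum.distrib[symmetric] distrib_right)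
qed (transfer; simp add: matrix_mul_assoc matrix_add_ldistrib algebra_simps)+

end

lemma Sqmat_simps: "Sqmat (A + B) = Sqmat A + Sqmat B" "Sqmat (A - B) = Sqmat A - Sqmat B"
  "Sqmat (- A) = - Sqmat A" "Sqmat (A ** B) = Sqmat A * Sqmat B" "Sqmat 0 = 0" "Sqmat (mat 1) = 1"
  for A B :: "'r::ring_1 ^ 'n ^ 'n"
  by (transfer, simp)+

lemma Sqmat_sum: "Sqmat (\<Sum>i\<in>I. A i) = (\<Sum>i\<in>I. Sqmat (A i))" for A :: "_ \<Rightarrow> 'r::ring_1 ^ 'n ^ 'n"
  by (induction I rule: infinite_finite_induct) (auto simp: Sqmat_simps)

text \<open>The coefficient of \<open>z\<^sup>-\<^sup>k\<^sup>/\<^sup>2\<close> in the entry \<open>(i, j)\<close>.\<close>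

definition entry :: "('r::ring_1 fps, 'n::finite) sqmat \<Rightarrow> 'n \<Rightarrow> 'n \<Rightarrow> nat \<Rightarrow> 'r" where
  "entry A i j k = fps_nth (rep_sqmat A $ i $ j) k"

lemma sqmat_eqI: "(\<And>i j k. entry A i j k = entry B i j k) \<Longrightarrow> A = B"
  unfolding entry_def
  by (metis (no_types, lifting) fps_ext rep_sqmat_inverse vec_eq_iff)

lemma entry_simps [simp]: "entry (A + B) i j k = entry A i j k + entry B i j k"
  "entry (A - B) i j k = entry A i j k - entry B i j k" "entry (- A) i j k = - entry A i j k"
  "entry 0 i j k = 0"
  by (simp_all add: entry_def plus_sqmat.rep_eq minus_sqmat.rep_eq uminus_sqmat.rep_eq
      zero_sqmat.rep_eq)

lemma entry_sum: "entry (\<Sum>a\<in>I. A a) i j k = (\<Sum>a\<in>I. entry (A a) i j k)"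
  by (induction I rule: infinite_finite_induct) auto

lemma entry_mult:
  "entry (A * B) i j k = (\<Sum>h\<in>UNIV. \<Sum>m=0..k. entry A i h m * entry B h j (k - m))"
  by (simp add: entry_def times_sqmat.rep_eq matrix_matrix_mult_def fps_sum_nth fps_mult_nth)

definition scal :: "'r::ring_1 \<Rightarrow> ('r fps, 'n::finite) sqmat" where
  "scal c = Sqmat (mat (fps_const c))"

text \<open>The variable \<open>z\<^sup>-\<^sup>1\<^sup>/\<^sup>2\<close> of the power series.\<close>

definition zv :: "('r::ring_1 fps, 'n::finite) sqmat" where
  "zv = Sqmat (mat fps_X)"

lemma zv_central: "zv * A = A * zv"
  unfolding zv_def
  by (simp add: rep_sqmat_inject[symmetric] times_sqmat.rep_eq vec_eq_iff fps_mult_fps_X_commute)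

lemma zv_power_central: "zv ^ n * A = A * zv ^ n"
  by (induction n) (simp_all add: mult.assoc, metis mult.assoc zv_central)

lemma zv_left_commute: "a * (zv ^ n * y) = zv ^ n * (a * y)"
  unfolding mult.assoc[of _ a, symmetric] zv_power_central[of n a] by (simp only: mult.assoc)

lemma entry_zv_power: "entry (zv ^ n * A) i j k = (if k < n then 0 else entry A i j (k - n))"
  for A :: "('a::ring_1 fps, 'b::finite) sqmat"
proof (induction n arbitrary: k)
  case (Suc n)
  have "entry (zv * B) i j k = (if k = 0 then 0 else entry B i j (k - 1))"
    for B :: "('a fps, 'b) sqmat" and k
    by (simp add: entry_def zv_def times_sqmat.rep_eq)
  then show ?case using Suc by (auto simp: mult.assoc) 
qed simp

lemma entry_scal_mult: "entry (scal c * A) i j k = c * entry A i j k"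
  by (simp add: entry_def scal_def times_sqmat.rep_eq)

lemma entry_scal: "entry (scal c) i j k = (if i = j \<and> k = 0 then c else 0)"
  by (simp add: entry_def scal_def mat_def)

lemma entry_mult_scal: "entry (A * scal c) i j k = entry A i j k * c"
  by (simp add: entry_def scal_def times_sqmat.rep_eq)

text \<open>A descending filtration by left ideals (if \<open>J\<close> is one); its intersection consists of the
  matrices with all coefficients in \<open>J\<close>.\<close>

definition coeffs_in :: "'r::ring_1 set \<Rightarrow> nat \<Rightarrow> ('r fps, 'n::finite) sqmat set" where
  "coeffs_in J n = {A. \<forall>i j k. k < n \<longrightarrow> entry A i j k \<in> J}"

lemma left_ideal_0: "left_ideal J \<Longrightarrow> 0 \<in> J"
  by (simp add: left_ideal_def)

lemma left_ideal_sum: "left_ideal J \<Longrightarrow> (\<And>i. i \<in> I \<Longrightarrow> f i \<in> J) \<Longrightarrow> sum f I \<in> J"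
  by (induction I rule: infinite_finite_induct) (auto simp: left_ideal_def)

lemma left_ideal_mult: "left_ideal J \<Longrightarrow> a \<in> J \<Longrightarrow> r * a \<in> J"
  by (simp add: left_ideal_def)

lemma left_ideal_add: "left_ideal J \<Longrightarrow> a \<in> J \<Longrightarrow> b \<in> J \<Longrightarrow> a + b \<in> J"
  by (simp add: left_ideal_def)

lemma left_ideal_uminus: "left_ideal J \<Longrightarrow> a \<in> J \<Longrightarrow> - a \<in> J"
  by (metis left_ideal_def mult_minus1)

lemma left_ideal_diff: "left_ideal J \<Longrightarrow> a \<in> J \<Longrightarrow> b \<in> J \<Longrightarrow> a - b \<in> J"
  using left_ideal_uminus[of J b] by (auto simp: left_ideal_def simp flip: add_uminus_conv_diff)

lemma left_ideal_coeffs_in: "left_ideal J \<Longrightarrow> left_ideal (coeffs_in J n)"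
  unfolding left_ideal_def[of "coeffs_in J n"]
proof (intro conjI ballI allI)
  assume J: "left_ideal J"
  show "r * a \<in> coeffs_in J n" if "a \<in> coeffs_in J n" for r a
    using that J
    by (auto simp: coeffs_in_def entry_mult intro!: left_ideal_sum[OF J])
      (auto simp: left_ideal_def)
qed (auto simp: coeffs_in_def left_ideal_def)

lemma coeffs_in_zv: "left_ideal J \<Longrightarrow> A \<in> coeffs_in J n \<Longrightarrow> zv ^ d * A \<in> coeffs_in J (n + d)"
  by (auto simp: coeffs_in_def entry_zv_power left_ideal_def)

lemma coeffs_in_mono: "m \<le> n \<Longrightarrow> coeffs_in J n \<subseteq> coeffs_in J m"
  by (auto simp: coeffs_in_def)

subsection \<open>Inversion of power series with invertible leading term\<close>

text \<open>The geometric series; its coefficient of order \<open>n\<close> is that of the partial sum up to \<open>n\<close>.\<close>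

lemma zv_shift_right_inverse: "\<exists>M. (1 - zv * N) * M = 1" for N :: "('r::ring_1 fps, 'n::finite) sqmat"
proof -
  define G where "G n = (\<Sum>k\<le>n. (zv * N) ^ k)" for n
  define M :: "('r fps, 'n::finite) sqmat" where
    "M = Sqmat (\<chi> i j. Abs_fps (\<lambda>n. entry (G n) i j n))"
  have M: "entry M i j n = entry (G n) i j n" for i j n by (simp add: M_def entry_def)
  have I: "left_ideal {0 :: 'r}" by (simp add: left_ideal_def)
  note I' = left_ideal_coeffs_in[OF I]
  have pow: "(zv * N) ^ k = zv ^ k * N ^ k" for k
  proof (induction k)
    case (Suc k)
    have "(zv * N) ^ Suc k = zv * (N * zv ^ k) * N ^ k" using Suc by (simp add: mult.assoc)
    also have "N * zv ^ k = zv ^ k * N" by (rule zv_power_central[symmetric])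
    finally show ?case by (simp add: mult.assoc)
  qed simp
  have small: "(zv * N) ^ k \<in> coeffs_in {0} k" for k
    using coeffs_in_zv[OF I, of "N ^ k" 0 k] unfolding pow by (simp add: coeffs_in_def)
  have GM: "M - G n \<in> coeffs_in {0} (Suc n)" for n
  proof -
    have "entry (G n) i j k = entry (G k) i j k" if "k \<le> n" for i j k
    proof -
      have "G n = G k + (\<Sum>h\<in>{k<..n}. (zv * N) ^ h)"
        unfolding G_def using that
        by (subst sum.union_disjoint[symmetric]) (auto intro!: sum.cong)
      moreover have "entry ((zv * N) ^ h) i j k = 0" if "h \<in> {k<..n}" for h
        using small[of h] that by (auto simp: coeffs_in_def)
      ultimately show ?thesis by (simp add: entry_sum)
    qed
    then show ?thesis by (auto simp: coeffs_in_def M)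
  qed
  have tele: "(1 - zv * N) * G n = 1 - (zv * N) ^ Suc n" for n
  proof (induction n)
    case (Suc n)
    have "(1 - zv * N) * G (Suc n) = (1 - zv * N) * G n + (1 - zv * N) * (zv * N) ^ Suc n"
      unfolding G_def by (simp only: sum.atMost_Suc distrib_left)
    then show ?case unfolding Suc by (simp only: left_diff_distrib power_Suc) simp
  qed (simp add: G_def)
  have "(1 - zv * N) * M - 1 \<in> coeffs_in {0} (Suc n)" for n
  proof -
    have "(1 - zv * N) * M - 1 = (1 - zv * N) * (M - G n) - (zv * N) ^ Suc n"
      using tele[of n] by (simp add: algebra_simps)
    then show ?thesis
      using left_ideal_diff[OF I' left_ideal_mult[OF I' GM[of n]] small[of "Suc n"]] by simp
  qed
  then have "(1 - zv * N) * M = 1"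
    by (intro sqmat_eqI) (force simp: coeffs_in_def)
  then show ?thesis by blast
qed

text \<open>The right inverse is again of the form \<open>1 - zv N'\<close>, so it has a right inverse itself and is
  two-sided.\<close>

lemma zv_shift_inverse: "\<exists>M. (1 + zv * N) * M = 1 \<and> M * (1 + zv * N) = 1"
  for N :: "('r::ring_1 fps, 'n::finite) sqmat"
proof -
  obtain M where M: "(1 - zv * (- N)) * M = 1" using zv_shift_right_inverse by blast
  then have "M = 1 - zv * (N * M)" by (simp add: algebra_simps)
  then obtain M' where M': "M * M' = 1" using zv_shift_right_inverse by metis
  have "1 + zv * N = (1 + zv * N) * (M * M')" by (simp add: M')
  also have "\<dots> = M'" using M by (simp flip: mult.assoc)
  finally show ?thesis using M M' by auto
qed

text \<open>\<open>A C\<^sub>0\<close> is \<open>P\<close> times a series with leading term \<open>1\<close>, and \<open>C\<^sub>0 A\<close> such a series times \<open>Q\<close>.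
  Inverting these series gives a right and a left inverse of \<open>A\<close>, which therefore agree.\<close>

lemma rel_inverse_exists:
  fixes A P Q R C0 :: "('r::ring_1 fps, 'n::finite) sqmat"
  assumes A: "P * A * Q = A" and P: "P * P = P" and Q: "Q * Q = Q"
    and C0: "Q * C0 * P = C0" "(A - zv * R) * C0 = P" "C0 * (A - zv * R) = Q"
  shows "\<exists>!C. Q * C * P = C \<and> A * C = P \<and> C * A = Q"
proof -
  have PP: "P * (P * y) = P * y" and QQ: "Q * (Q * y) = Q * y" for y
    by (simp_all add: P Q flip: mult.assoc)
  have "P * (P * A * Q) = P * A * Q" "P * A * Q * Q = P * A * Q" by (simp_all add: mult.assoc PP Q)
  then have PA: "P * A = A" and AQ: "A * Q = A" unfolding A .
  have AQy: "A * (Q * y) = A * y" for y by (simp add: AQ flip: mult.assoc)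
  obtain M1 where M1: "(1 + zv * (R * C0)) * M1 = 1" using zv_shift_inverse by blast
  obtain M2 where M2: "M2 * (1 + zv * (C0 * R)) = 1" using zv_shift_inverse by blast
  have AC0: "A * C0 = P + zv * (R * C0)" using C0(2) by (simp add: algebra_simps)
  have "C0 * (zv * R) = C0 * zv * R" by (rule mult.assoc[symmetric])
  then have "C0 * (zv * R) = zv * (C0 * R)" unfolding zv_central[symmetric] by (simp only: mult.assoc)
  then have C0A: "C0 * A = Q + zv * (C0 * R)" using C0(3) by (simp add: right_diff_distrib diff_eq_eq)
  have "A * C0 = P * (A * C0)" by (simp add: PA flip: mult.assoc)
  also have "\<dots> = P * (1 + zv * (R * C0))" unfolding AC0 by (simp add: distrib_left P)
  finally have AC0': "A * C0 = P * (1 + zv * (R * C0))" .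
  have "A * C0 * M1 = P" unfolding AC0' mult.assoc[of P] M1 by simp
  then have 1: "A * (C0 * (M1 * y)) = P * y" for y by (simp only: mult.assoc[symmetric])
  have "C0 * A = C0 * A * Q" by (simp add: AQ mult.assoc)
  also have "\<dots> = (1 + zv * (C0 * R)) * Q" unfolding C0A by (simp add: distrib_right Q)
  finally have C0A': "C0 * A = (1 + zv * (C0 * R)) * Q" .
  have 2: "M2 * (C0 * A) = Q" unfolding C0A' mult.assoc[of M2, symmetric] M2 by simp
  define C where "C = Q * (C0 * M1) * P"
  define C' where "C' = Q * (M2 * C0) * P"
  have QCP: "Q * C * P = C" and QC: "Q * C = C" and CP: "C * P = C" and C'P: "C' * P = C'"
    unfolding C_def C'_def by (simp_all add: mult.assoc P QQ)
  have AC: "A * C = P" unfolding C_def by (simp add: mult.assoc AQy 1 P)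
  have C'A: "C' * A = Q" unfolding C'_def by (simp add: mult.assoc PA 2 Q)
  have "C' = C' * A * C" using C'P by (simp add: mult.assoc AC)
  also have "\<dots> = C" by (simp add: C'A QC)
  finally have CA: "C * A = Q" using C'A by simp
  show ?thesis
  proof (rule ex1I[of _ C])
    show "Q * C * P = C \<and> A * C = P \<and> C * A = Q" using QCP AC CA by blast
    fix D assume D: "Q * D * P = D \<and> A * D = P \<and> D * A = Q"
    have "Q * (Q * D * P) = Q * D * P" by (simp add: mult.assoc QQ)
    then have "D = C * A * D" using D CA by simp
    also have "\<dots> = C" using D CP by (simp add: mult.assoc)
    finally show "D = C" .
  qed
qed

text \<open>Unique existence in the ring of matrices makes the description of \<open>rel_inverse\<close> meaningful.\<close>

lemma rel_inverse_Sqmat: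
  assumes "\<exists>!C. Sqmat Q * C * Sqmat P = C \<and> Sqmat A * C = Sqmat P \<and> C * Sqmat A = Sqmat Q"
  shows "Sqmat Q * Sqmat (rel_inverse P Q A) * Sqmat P = Sqmat (rel_inverse P Q A)
    \<and> Sqmat A * Sqmat (rel_inverse P Q A) = Sqmat P \<and> Sqmat (rel_inverse P Q A) * Sqmat A = Sqmat Q"
proof -
  let ?R = "\<lambda>C. Q ** C ** P = C \<and> A ** C = P \<and> C ** A = Q"
  have eq: "?R (rep_sqmat C) \<longleftrightarrow> Sqmat Q * C * Sqmat P = C \<and> Sqmat A * C = Sqmat P \<and> C * Sqmat A = Sqmat Q"
    for C by (simp add: rep_sqmat_inject[symmetric] times_sqmat.rep_eq)
  obtain C where C: "?R (rep_sqmat C)" and un: "\<And>D. ?R (rep_sqmat D) \<Longrightarrow> D = C"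
    using assms unfolding eq[symmetric] by metis
  have "?R (rel_inverse P Q A)"
    unfolding rel_inverse_def
  proof (rule theI[of ?R])
    show "?R (rep_sqmat C)" by (rule C)
    show "D = rep_sqmat C" if "?R D" for D using un[of "Sqmat D"] that by (metis Sqmat_inverse UNIV_I)
  qed
  then show ?thesis using eq[of "Sqmat (rel_inverse P Q A)"] by simp
qed

subsection \<open>Operators with constant coefficients\<close>

definition cst :: "complex ^ 'n ^ 'n \<Rightarrow> ('g::complex_lie_algebra uea fps, 'n::finite) sqmat" where
  "cst M = Sqmat (const_op M)"

lemma entry_cst: "entry (cst M) i j k = (if k = 0 then uea_const (M $ i $ j) else 0)"
  by (simp add: entry_def cst_def z_tensor_def)

lemma entry_cst_mult: "entry (cst M * A) i j k = (\<Sum>h\<in>UNIV. uea_const (M $ i $ h) * entry A h j k)"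
  unfolding entry_mult entry_cst
  by (intro sum.cong refl) (simp add: sum.delta if_distrib if_distribR cong: if_cong)

lemma cst_mult: "cst (M ** N) = cst M * cst N"
  by (rule sqmat_eqI)
    (auto simp: entry_cst_mult entry_cst matrix_matrix_mult_def uea_const_sum uea_const_mult)

lemma cst_add: "cst (M + N) = cst M + cst N"
  by (rule sqmat_eqI) (auto simp: entry_cst uea_const_add)

lemma cst_0 [simp]: "cst 0 = 0"
  by (rule sqmat_eqI) (auto simp: entry_cst)

lemma cst_uminus: "cst (- M) = - cst M"
  using cst_add[of M "- M"] by (simp add: add_eq_0_iff)

lemma cst_diff: "cst (M - N) = cst M - cst N"
  using cst_add[of M "- N"] by (simp add: cst_uminus)

lemma cst_1 [simp]: "cst (mat 1) = 1"
  by (rule sqmat_eqI) (auto simp: entry_cst entry_def[of 1] one_sqmat.rep_eq mat_def)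

lemma cst_sum: "cst (\<Sum>i\<in>I. M i) = (\<Sum>i\<in>I. cst (M i))"
  by (induction I rule: infinite_finite_induct) (auto simp: cst_add)

lemma cst_mat: "cst (mat c) = scal (uea_const c)"
  by (rule sqmat_eqI)
    (simp add: entry_cst entry_scal mat_def)

lemma scal_const_central: "scal (uea_const c) * A = A * scal (uea_const c)"
  by (rule sqmat_eqI) (simp add: entry_scal_mult entry_mult_scal uea_const_central)

lemma scal_0 [simp]: "scal 0 = 0"
  by (rule sqmat_eqI) (simp add: entry_scal)

lemma scal_cst_commute: "scal a * cst M = cst M * scal a"
  by (rule sqmat_eqI) (simp add: entry_scal_mult entry_mult_scal entry_cst uea_const_central)

lemma scal_add: "scal (a + b) = scal a + scal b"
  by (rule sqmat_eqI) (simp add: entry_scal)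

lemma scal_mult: "scal (a * b) = scal a * scal b"
  by (rule sqmat_eqI) (simp add: entry_scal_mult entry_scal)

lemma scal_diff: "scal (a - b) = scal a - scal b"
  by (rule sqmat_eqI) (simp add: entry_scal)

lemma Sqmat_z_tensor: "Sqmat (z_tensor p a M) = scal a * cst M * zv ^ nat \<lfloor>2 * p\<rfloor>"
proof -
  have "scal a * cst M * zv ^ nat \<lfloor>2 * p\<rfloor> = zv ^ nat \<lfloor>2 * p\<rfloor> * (scal a * cst M)"
    by (rule zv_power_central[symmetric])
  then show ?thesis
    by (intro sqmat_eqI)
      (auto simp: entry_zv_power entry_scal_mult entry_cst entry_def[of "Sqmat _"] z_tensor_def
        fps_X_power_mult_right_nth)
qed

section \<open>The grading of the Lie algebra and the Casimir tensor\<close>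

lemma half_ints_closed:
  "a \<in> half_ints \<Longrightarrow> b \<in> half_ints \<Longrightarrow> a + b \<in> half_ints"
  "a \<in> half_ints \<Longrightarrow> b \<in> half_ints \<Longrightarrow> a - b \<in> half_ints"
  "1 \<in> half_ints" "1/2 \<in> half_ints" "0 \<in> half_ints"
proof -
  show "a + b \<in> half_ints" if ab: "a \<in> half_ints" "b \<in> half_ints"
  proof -
    obtain n m :: int where "a = n / 2" "b = m / 2" using ab by (auto simp: half_ints_def)
    then have "a + b = of_int (n + m) / 2" by simp
    then show ?thesis unfolding half_ints_def by blast
  qed
  show "a - b \<in> half_ints" if ab: "a \<in> half_ints" "b \<in> half_ints"
  proof -
    obtain n m :: int where "a = n / 2" "b = m / 2" using ab by (auto simp: half_ints_def)
    then have "a - b = of_int (n - m) / 2" by (simp add: diff_divide_distrib)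
    then show ?thesis unfolding half_ints_def by blast
  qed
  show "1 \<in> half_ints" unfolding half_ints_def by (rule CollectI, rule exI[of _ 2]) simp
  show "1/2 \<in> half_ints" unfolding half_ints_def by (rule CollectI, rule exI[of _ 1]) simp
  show "0 \<in> half_ints" unfolding half_ints_def by (rule CollectI, rule exI[of _ 0]) simp
qed

text \<open>Half-integral weights below \<open>1\<close> are at most \<open>1/2\<close>: this is why the sums over \<open>g\<^bsub>\<le>1/2\<^esub>\<close> and over
  \<open>g\<^bsub>\<ge>1\<^esub>\<close> in \<open>Y\<close> complement each other.\<close>

lemma half_int_gap: "a \<in> half_ints \<Longrightarrow> b \<in> half_ints \<Longrightarrow> a < b \<longleftrightarrow> a + 1/2 \<le> b"
proof -
  assume "a \<in> half_ints" "b \<in> half_ints"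
  then obtain n m :: int where ab: "a = n / 2" "b = m / 2" by (auto simp: half_ints_def)
  have "a < b \<longleftrightarrow> real_of_int (n + 1) \<le> real_of_int m"
    unfolding ab of_int_le_iff by (simp add: divide_less_cancel) linarith
  also have "\<dots> \<longleftrightarrow> a + 1/2 \<le> b" unfolding ab of_int_add of_int_1 by (rule iffI; linarith)
  finally show ?thesis .
qed

lemma nat_floor_double_add:
  assumes "a \<in> half_ints" "b \<in> half_ints" "0 \<le> a" "0 \<le> b"
  shows "nat \<lfloor>2 * (a + b)\<rfloor> = nat \<lfloor>2 * a\<rfloor> + nat \<lfloor>2 * b\<rfloor>"
proof -
  obtain n m :: int where "a = n / 2" "b = m / 2" using assms by (auto simp: half_ints_def)
  then have 2: "2 * a = of_int n" "2 * b = of_int m" "2 * (a + b) = of_int (n + m)" by simp_all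
  moreover have "0 \<le> n" "0 \<le> m"
    using 2(1,2) assms(3,4) by (metis mult_nonneg_nonneg of_int_0_le_iff zero_le_numeral)+
  ultimately show ?thesis by (simp only: floor_of_int nat_add_distrib)
qed

locale graded_lie =
  fixes form :: "'g::complex_lie_algebra \<Rightarrow> 'g \<Rightarrow> complex" and f x :: 'g and B :: "'g set"
  assumes form: "sym_nondeg_invariant_form form"
    and xf: "lie x f = - f"
    and finite_dim: "\<exists>A::'g set. finite A \<and> lie_vs.span A = UNIV"
    and basis: "ad_eigenbasis x B"
    and half_int_weights: "\<And>u. u \<in> B \<Longrightarrow> \<exists>d\<in>half_ints. u \<in> ad_space x d"
begin

abbreviation \<delta> :: "'g \<Rightarrow> real" where "\<delta> \<equiv> ad_weight x"
abbreviation du :: "'g \<Rightarrow> 'g" where "du \<equiv> dual_elt form B"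

lemma form_simps:
  "form (a + b) c = form a c + form b c" "form c (a + b) = form c a + form c b"
  "form (k *\<^sub>C a) b = k * form a b" "form a (k *\<^sub>C b) = k * form a b"
  using form unfolding sym_nondeg_invariant_form_def by metis+

lemma form_sym: "form a b = form b a"
  using form unfolding sym_nondeg_invariant_form_def by blast

lemma form_invariant: "form (lie a b) c = form a (lie b c)"
  using form unfolding sym_nondeg_invariant_form_def by blast

lemma form_0: "form 0 b = 0" "form b 0 = 0"
  using form_simps(1)[of 0 0 b] form_sym[of b 0] by auto

lemma form_minus: "form (- a) b = - form a b" "form b (- a) = - form b a"
  using form_simps(1)[of a "- a" b] form_simps(2)[of b a "- a"] form_0
  by (auto simp: add_eq_0_iff)

lemma form_diff: "form (a - c) b = form a b - form c b" "form b (a - c) = form b a - form b c"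
  using form_simps(1)[of a "- c" b] form_simps(2)[of b a "- c"] by (simp_all add: form_minus)

lemma form_sum: "form (\<Sum>i\<in>I. g i) b = (\<Sum>i\<in>I. form (g i) b)"
  "form b (\<Sum>i\<in>I. g i) = (\<Sum>i\<in>I. form b (g i))"
  by (induction I rule: infinite_finite_induct) (auto simp: form_simps form_0)

lemma independent_B: "lie_vs.independent B" and span_B: "lie_vs.span B = UNIV"
  using basis by (auto simp: ad_eigenbasis_def)

lemma finite_B: "finite B"
  using finite_dim lie_vs.independent_span_bound independent_B by blast

lemma form_eq_0I:
  assumes "\<And>w. w \<in> B \<Longrightarrow> form w a = 0" shows "a = 0"
proof -
  have "lie_vs.span B \<subseteq> {b. form b a = 0}"
    by (rule lie_vs.span_minimal) (auto simp: assms lie_vs.subspace_def form_0 form_simps)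
  then have "\<forall>b. form a b = 0" using form_sym span_B by auto
  then show ?thesis using form unfolding sym_nondeg_invariant_form_def by blast
qed

lemma lie_skew: "lie a b = - lie b a"
proof -
  have "lie (a + b) (a + b) = lie a b + lie b a"
    by (simp only: lie_add_left lie_add_right lie_self[of a] lie_self[of b] add_0_left add_0_right add.commute)
  then have "lie a b + lie b a = 0" unfolding lie_self by (rule sym)
  then show ?thesis by (simp add: eq_neg_iff_add_eq_0)
qed

lemma lie_0: "lie a 0 = 0" "lie 0 a = 0"
  using lie_add_right[of a 0 0] lie_add_left[of 0 0 a] by auto

lemma lie_minus_right: "lie a (- b) = - lie a b"
  using lie_add_right[of a b "- b"] by (simp add: lie_0 add_eq_0_iff)

sublocale adx: vector_space_endo cscale "lie x"
  by unfold_locales (simp_all add: lie_add_right lie_cscale_right)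

lemma ad_space_eq: "ad_space x k = adx.eigenspace (of_real k)"
  by (simp add: ad_space_def adx.eigenspace_def)

lemma subspace_ad_space: "lie_vs.subspace (ad_space x k)"
  unfolding ad_space_eq by (rule adx.subspace_eigenspace)

lemma ad_space_unique: "a \<in> ad_space x k \<Longrightarrow> a \<in> ad_space x k' \<Longrightarrow> a \<noteq> 0 \<Longrightarrow> k = k'"
proof -
  assume "a \<in> ad_space x k" "a \<in> ad_space x k'" "a \<noteq> 0"
  then have "complex_of_real k *\<^sub>C a = complex_of_real k' *\<^sub>C a" by (simp add: ad_space_def)
  then show ?thesis using \<open>a \<noteq> 0\<close> by simp
qed

lemma B_nonzero: "u \<in> B \<Longrightarrow> u \<noteq> 0"
  using independent_B lie_vs.dependent_zero by blast

lemma weight_B: "u \<in> B \<Longrightarrow> u \<in> ad_space x (\<delta> u) \<and> \<delta> u \<in> half_ints"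
proof -
  assume u: "u \<in> B"
  obtain d where d: "d \<in> half_ints" "u \<in> ad_space x d" using half_int_weights u by blast
  then have "\<delta> u = d"
    unfolding ad_weight_def using ad_space_unique B_nonzero[OF u] by (intro the_equality) auto
  then show ?thesis using d by simp
qed

lemma ad_sum_disjoint:
  assumes "a \<in> ad_space x k" "a \<in> ad_sum x K" "k \<notin> K" shows "a = 0"
proof -
  have "complex_of_real ` K \<inter> {of_real k} = {}" using assms(3) by auto
  moreover have "a \<in> lie_vs.span (\<Union>c\<in>complex_of_real ` K. adx.eigenspace c)"
    using assms(2) by (simp add: ad_sum_def ad_space_eq)
  moreover have "a \<in> lie_vs.span (\<Union>c\<in>{complex_of_real k}. adx.eigenspace c)"
    using assms(1) by (simp add: ad_space_eq lie_vs.span_base)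
  ultimately show ?thesis by (rule adx.span_eigenspaces_Int)
qed

lemma ad_space_in_ad_sum: "a \<in> ad_space x k \<Longrightarrow> k \<in> K \<Longrightarrow> a \<in> ad_sum x K"
  by (auto simp: ad_sum_def intro: lie_vs.span_base)

lemma B_in_ad_sum: "u \<in> B \<Longrightarrow> u \<in> ad_sum x K \<longleftrightarrow> \<delta> u \<in> K"
  using weight_B ad_sum_disjoint B_nonzero ad_space_in_ad_sum by metis

lemma ad_space_zero: "a \<in> ad_space x k \<Longrightarrow> k \<notin> half_ints \<Longrightarrow> a = 0"
proof -
  assume a: "a \<in> ad_space x k" "k \<notin> half_ints"
  have "B \<subseteq> (\<Union>k\<in>half_ints. ad_space x k)" using weight_B by blast
  then have "a \<in> ad_sum x half_ints"
    unfolding ad_sum_def using lie_vs.span_mono span_B by blast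
  then show ?thesis using ad_sum_disjoint a by blast
qed

lemma lie_ad_space: "a \<in> ad_space x j \<Longrightarrow> b \<in> ad_space x k \<Longrightarrow> lie a b \<in> ad_space x (j + k)"
proof -
  assume a: "a \<in> ad_space x j" and b: "b \<in> ad_space x k"
  have "lie x (lie a b) = - (lie a (lie b x) + lie b (lie x a))"
    using jacobi[of x a b] by (simp add: eq_neg_iff_add_eq_0 algebra_simps)
  also have "\<dots> = lie a (lie x b) + lie (lie x a) b"
    by (simp add: lie_skew[of b x] lie_minus_right lie_skew[of b])
  also have "\<dots> = of_real (j + k) *\<^sub>C lie a b"
    using a b by (simp add: ad_space_def lie_cscale_left lie_cscale_right
        flip: cscale_left_distrib)
  finally show ?thesis by (simp add: ad_space_def)
qed

lemma form_weights: "a \<in> ad_space x j \<Longrightarrow> b \<in> ad_space x k \<Longrightarrow> j + k \<noteq> 0 \<Longrightarrow> form a b = 0"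
proof -
  assume a: "a \<in> ad_space x j" and b: "b \<in> ad_space x k" and jk: "j + k \<noteq> 0"
  have "of_real j * form a b = form (lie x a) b" using a by (simp add: ad_space_def form_simps)
  also have "\<dots> = - form (lie a x) b" by (simp add: lie_skew[of x a] form_minus)
  also have "\<dots> = - form a (lie x b)" by (simp add: form_invariant)
  also have "\<dots> = - of_real k * form a b" using b by (simp add: ad_space_def form_simps)
  finally have "of_real (j + k) * form a b = 0" by (simp add: distrib_right)
  then show ?thesis using jk by (simp del: of_real_add)
qed

lemma f_weight: "f \<in> ad_space x (- 1)"
  using xf lie_vs.scale_minus_left[of 1 f] by (simp add: ad_space_def)

subsection \<open>The dual basis\<close>

text \<open>The Gram map \<open>v \<mapsto> \<Sum>w. \<langle>w|v\<rangle> w\<close> is injective because the form is nondegenerate, hence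
  surjective; a preimage of \<open>u\<close> is dual to \<open>u\<close>.\<close>

lemma dual_exists: assumes u: "u \<in> B" shows "\<exists>v. \<forall>w\<in>B. form w v = (if w = u then 1 else 0)"
proof -
  interpret fd: finite_dimensional_vector_space cscale B
    by unfold_locales (use finite_B independent_B span_B in auto)
  define L where "L v = (\<Sum>w\<in>B. form w v *\<^sub>C w)" for v
  have lin: "Vector_Spaces.linear cscale cscale L"
    by unfold_locales
      (simp_all add: L_def form_simps cscale_left_distrib sum.distrib lie_vs.scale_sum_right)
  interpret L: Vector_Spaces.linear cscale cscale L by (rule lin)
  have coeffs: "c w = d w" if "(\<Sum>w\<in>B. c w *\<^sub>C w) = (\<Sum>w\<in>B. d w *\<^sub>C w)" "w \<in> B" for c d w
  proof -
    have "(\<Sum>w\<in>B. (c w - d w) *\<^sub>C w) = 0"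
      using that(1) by (simp add: lie_vs.scale_left_diff_distrib sum_subtractf)
    then have "c w - d w = 0"
      using independent_B[unfolded lie_vs.independent_explicit_module, rule_format,
          OF finite_B subset_refl _ that(2), of "\<lambda>w. c w - d w"] by simp
    then show ?thesis by simp
  qed
  have "inj L"
  proof (rule injI)
    fix v v' assume "L v = L v'"
    then have "L (v - v') = 0" by (simp add: L.diff)
    then have "form w (v - v') = 0" if "w \<in> B" for w
      using coeffs[of "\<lambda>w. form w (v - v')" "\<lambda>_. 0"] that by (simp add: L_def)
    then have "v - v' = 0" by (rule form_eq_0I)
    then show "v = v'" by simp
  qed
  then have "surj L" using fd.linear_inj_imp_surj[OF lin] by blast
  then obtain v where "L v = u" by (metis surjD)
  moreover have "u = (\<Sum>w\<in>B. (if w = u then 1 else 0) *\<^sub>C w)"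
    using u finite_B by (simp add: if_distrib if_distribR sum.delta cong: if_cong)
  ultimately show ?thesis
    using coeffs[of "\<lambda>w. form w v" "\<lambda>w. if w = u then 1 else 0"] unfolding L_def by metis
qed

lemma form_du: "u \<in> B \<Longrightarrow> w \<in> B \<Longrightarrow> form w (du u) = (if w = u then 1 else 0)"
proof -
  assume u: "u \<in> B" and w: "w \<in> B"
  obtain v where v: "\<forall>w\<in>B. form w v = (if w = u then 1 else 0)" using dual_exists[OF u] by blast
  have "\<forall>w\<in>B. form w (du u) = (if w = u then 1 else 0)"
    unfolding dual_elt_def
  proof (rule theI[where a = v])
    show "\<forall>w\<in>B. form w v = (if w = u then 1 else 0)" by (rule v)
    fix v' assume v': "\<forall>w\<in>B. form w v' = (if w = u then 1 else 0)"
    have "v' - v = 0" by (rule form_eq_0I) (simp add: form_diff v v')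
    then show "v' = v" by simp
  qed
  then show ?thesis using w by blast
qed

lemma expand_B: "a = (\<Sum>w\<in>B. form a (du w) *\<^sub>C w)"
proof -
  have "a \<in> lie_vs.span B" using span_B by simp
  then obtain c where c: "a = (\<Sum>w\<in>B. c w *\<^sub>C w)" using lie_vs.span_finite[OF finite_B] by auto
  have "form a (du u) = c u" if "u \<in> B" for u
    unfolding c form_sum using that finite_B
    by (simp add: form_simps form_du if_distrib if_distribR sum.delta cong: if_cong)
  then have "(\<Sum>w\<in>B. form a (du w) *\<^sub>C w) = (\<Sum>w\<in>B. c w *\<^sub>C w)" by (intro sum.cong) auto
  then show ?thesis using c by simp
qed

lemma expand_dual: "a = (\<Sum>w\<in>B. form w a *\<^sub>C du w)"
proof -
  have "a - (\<Sum>w\<in>B. form w a *\<^sub>C du w) = 0"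
  proof (rule form_eq_0I)
    fix v assume v: "v \<in> B"
    have "(\<Sum>w\<in>B. form w a * form v (du w)) = (\<Sum>w\<in>B. if v = w then form w a else 0)"
      using v by (intro sum.cong) (auto simp: form_du)
    then show "form v (a - (\<Sum>w\<in>B. form w a *\<^sub>C du w)) = 0"
      using v finite_B by (simp add: form_diff form_sum form_simps)
  qed
  then show ?thesis by simp
qed

lemma du_weight: assumes u: "u \<in> B" shows "du u \<in> ad_space x (- \<delta> u)"
proof -
  have "lie x (du u) + - (of_real (- \<delta> u) *\<^sub>C du u) = 0"
  proof (rule form_eq_0I)
    fix w assume w: "w \<in> B"
    have "form w (lie x (du u)) = form (lie w x) (du u)" by (simp add: form_invariant)
    also have "\<dots> = - of_real (\<delta> w) * form w (du u)"
      using weight_B[OF w] by (simp add: lie_skew[of w x] form_minus ad_space_def form_simps)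
    finally show "form w (lie x (du u) + - (of_real (- \<delta> u) *\<^sub>C du u)) = 0"
      using form_du[OF u w] by (simp add: form_simps form_minus)
  qed
  then show ?thesis by (simp add: ad_space_def add_eq_0_iff)
qed

text \<open>The coefficients of \<open>[m, u]\<close> in the basis and those of \<open>[m, w\<^sup>*]\<close> in the dual basis are the
  numbers \<open>\<langle>[m, u]|w\<^sup>*\<rangle>\<close>, up to sign, by invariance of the form.  They vanish unless the weights of \<open>u\<close>
  and \<open>w\<close> differ by \<open>j\<close>, so a function \<open>c\<close> of the weight can be carried along with a shift by \<open>j\<close>.\<close>

lemma casimir_tensor_invariant:
  fixes \<beta> :: "'g \<Rightarrow> 'g \<Rightarrow> 'r::ring_1" and c :: "real \<Rightarrow> 'r"
  assumes add: "\<And>a b y. \<beta> (a + b) y = \<beta> a y + \<beta> b y" "\<And>a y z. \<beta> a (y + z) = \<beta> a y + \<beta> a z"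
    and scale: "\<And>k a y. \<beta> (k *\<^sub>C a) y = \<beta> a (k *\<^sub>C y)"
    and m: "m \<in> ad_space x j"
  shows "(\<Sum>u\<in>B. c (\<delta> u) * \<beta> (lie m u) (du u)) = - (\<Sum>u\<in>B. c (\<delta> u - j) * \<beta> u (lie m (du u)))"
proof -
  have z: "\<beta> 0 y = 0" "\<beta> a 0 = 0" for a y using add(1)[of 0 0 y] add(2)[of a 0 0] by auto
  have sum1: "\<beta> (\<Sum>i\<in>I. g i) y = (\<Sum>i\<in>I. \<beta> (g i) y)" for I :: "'g set" and g y
    by (induction I rule: infinite_finite_induct) (auto simp: z add)
  have sum2: "\<beta> a (\<Sum>i\<in>I. g i) = (\<Sum>i\<in>I. \<beta> a (g i))" for I :: "'g set" and g a
    by (induction I rule: infinite_finite_induct) (auto simp: z add)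
  have minus: "\<beta> a (- y) = - \<beta> a y" for a y
    using add(2)[of a y "- y"] by (simp add: z add_eq_0_iff)
  define g where "g u w = form (lie m u) (du w)" for u w
  have g0: "g u w = 0" if "u \<in> B" "w \<in> B" "\<delta> u \<noteq> \<delta> w - j" for u w
    unfolding g_def
    using form_weights[OF lie_ad_space[OF m weight_B[OF that(1), THEN conjunct1]] du_weight[OF that(2)]] that(3)
    by simp
  have "(\<Sum>u\<in>B. c (\<delta> u) * \<beta> (lie m u) (du u)) = (\<Sum>u\<in>B. \<Sum>w\<in>B. c (\<delta> u) * \<beta> w (g u w *\<^sub>C du u))"
  proof (rule sum.cong[OF refl])
    fix u assume "u \<in> B"
    have "lie m u = (\<Sum>w\<in>B. g u w *\<^sub>C w)" unfolding g_def by (rule expand_B)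
    then have "\<beta> (lie m u) (du u) = (\<Sum>w\<in>B. \<beta> w (g u w *\<^sub>C du u))"
      by (simp only: sum1 scale)
    then show "c (\<delta> u) * \<beta> (lie m u) (du u) = (\<Sum>w\<in>B. c (\<delta> u) * \<beta> w (g u w *\<^sub>C du u))"
      by (simp add: sum_distrib_left)
  qed
  also have "\<dots> = (\<Sum>w\<in>B. \<Sum>u\<in>B. c (\<delta> u) * \<beta> w (g u w *\<^sub>C du u))" by (rule sum.swap)
  also have "\<dots> = (\<Sum>w\<in>B. c (\<delta> w - j) * - \<beta> w (lie m (du w)))"
  proof (rule sum.cong[OF refl])
    fix w assume w: "w \<in> B"
    have "(\<Sum>u\<in>B. c (\<delta> u) * \<beta> w (g u w *\<^sub>C du u)) = (\<Sum>u\<in>B. c (\<delta> w - j) * \<beta> w (g u w *\<^sub>C du u))"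
    proof (rule sum.cong[OF refl])
      fix u assume u: "u \<in> B"
      show "c (\<delta> u) * \<beta> w (g u w *\<^sub>C du u) = c (\<delta> w - j) * \<beta> w (g u w *\<^sub>C du u)"
        using g0[OF u w] by (cases "\<delta> u = \<delta> w - j") (simp_all add: z)
    qed
    also have "\<dots> = c (\<delta> w - j) * \<beta> w (\<Sum>u\<in>B. g u w *\<^sub>C du u)"
      by (simp add: sum2 sum_distrib_left)
    also have "(\<Sum>u\<in>B. g u w *\<^sub>C du u) = (\<Sum>u\<in>B. form u (- lie m (du w)) *\<^sub>C du u)"
      by (intro sum.cong refl) (simp add: g_def lie_skew[of m] form_minus form_invariant)
    also have "\<dots> = - lie m (du w)" by (rule expand_dual[symmetric])
    finally show "(\<Sum>u\<in>B. c (\<delta> u) * \<beta> w (g u w *\<^sub>C du u)) = c (\<delta> w - j) * - \<beta> w (lie m (du w))"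
      by (simp only: minus)
  qed
  also have "\<dots> = - (\<Sum>u\<in>B. c (\<delta> u - j) * \<beta> u (lie m (du u)))" by (simp add: sum_negf)
  finally show ?thesis .
qed

end

section \<open>The transformation law of the Lax operator\<close>

text \<open>The transformation law is an identity in a ring which contains two commuting images of the Lie
  algebra, \<open>G\<close> as coefficients in \<open>U(g)\<close> and \<open>\<Phi>\<close> as operators on \<open>V\<close>, together with a central element \<open>s\<close> in the place of
  \<open>z\<^sup>-\<^sup>1\<^sup>/\<^sup>2\<close>; it is proved in this generality.\<close>

locale lax_data = graded_lie form f x B
  for form :: "'g::complex_lie_algebra \<Rightarrow> 'g \<Rightarrow> complex" and f x :: 'g and B :: "'g set" +
  fixes G \<Phi> :: "'g \<Rightarrow> 'r::ring_1" and \<kappa> :: "complex \<Rightarrow> 'r" and s :: 'r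
  assumes G_add: "G (a + b) = G a + G b" and \<Phi>_add: "\<Phi> (a + b) = \<Phi> a + \<Phi> b"
    and G_scale: "G (k *\<^sub>C a) = \<kappa> k * G a" and \<Phi>_scale: "\<Phi> (k *\<^sub>C a) = \<kappa> k * \<Phi> a"
    and G_lie: "G (lie a b) = G a * G b - G b * G a"
    and \<Phi>_lie: "\<Phi> (lie a b) = \<Phi> a * \<Phi> b - \<Phi> b * \<Phi> a"
    and G_\<Phi>: "G a * \<Phi> b = \<Phi> b * G a"
    and \<kappa>_central: "\<kappa> k * r = r * \<kappa> k" and \<kappa>_0: "\<kappa> 0 = 0"
    and s_central: "s * r = r * s"
begin

abbreviation zpow :: "real \<Rightarrow> 'r" where "zpow d \<equiv> s ^ nat \<lfloor>2 * d\<rfloor>"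

lemma s_power_central: "s ^ n * r = r * s ^ n"
proof (induction n)
  case (Suc n)
  have "s ^ Suc n * r = s * (s ^ n * r)" by (simp add: mult.assoc)
  also have "\<dots> = s * r * s ^ n" by (simp add: Suc mult.assoc)
  also have "\<dots> = r * s ^ Suc n" by (simp add: s_central mult.assoc)
  finally show ?case .
qed simp

definition D :: 'r where
  "D = - (\<Sum>u\<in>B. (if 1 \<le> \<delta> u then 1 else 0) * (\<Phi> (du u) * \<Phi> u))"

definition Y :: 'r where
  "Y = 1 + \<Phi> f + (\<Sum>u\<in>B. (if \<delta> u \<le> 1/2 then zpow (1 - \<delta> u) else 0) * (G u * \<Phi> (du u))) + s ^ 2 * D"

text \<open>The deviation of \<open>t\<close> from the transformation law \<open>[m, t] = - z\<^sup>-\<^sup>j \<phi>(m) t\<close> for \<open>m\<close> of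
  weight \<open>j\<close>.\<close>

definition \<rho> :: "'r \<Rightarrow> 'g \<Rightarrow> real \<Rightarrow> 'r" where
  "\<rho> t m j = (G m * t - t * G m) + zpow j * (\<Phi> m * t)"

text \<open>Replacing \<open>u\<close> by \<open>\<langle>f|u\<rangle>\<close> in the Casimir tensor gives \<open>f\<close>.\<close>

lemma \<Phi>_f: "\<Phi> f = (\<Sum>u\<in>B. \<kappa> (form f u) * \<Phi> (du u))"
proof -
  have \<Phi>0: "\<Phi> 0 = 0" using \<Phi>_add[of 0 0] by simp
  have \<Phi>sum: "\<Phi> (\<Sum>i\<in>I. g i) = (\<Sum>i\<in>I. \<Phi> (g i))" for I :: "'g set" and g
    by (induction I rule: infinite_finite_induct) (auto simp: \<Phi>0 \<Phi>_add)
  have "f = (\<Sum>u\<in>B. form f u *\<^sub>C du u)"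
    using expand_dual[of f] by (simp add: form_sym)
  then have "\<Phi> f = \<Phi> (\<Sum>u\<in>B. form f u *\<^sub>C du u)" by (rule arg_cong)
  then show ?thesis by (simp add: \<Phi>sum \<Phi>_scale)
qed

lemma form_f_0: "u \<in> B \<Longrightarrow> \<delta> u \<noteq> 1 \<Longrightarrow> form f u = 0"
  using form_weights[OF f_weight, of u "\<delta> u"] weight_B by simp

text \<open>On the right, the first sum carries positive powers of \<open>s\<close>, and the second lies in every left
  ideal that contains \<open>u - \<langle>f|u\<rangle>\<close> for the \<open>u\<close> of weight at least \<open>1\<close>.  By invariance of the Casimir
  tensor, the commutators of \<open>Y\<close> with \<open>m\<close> and with \<open>\<phi>(m)\<close> cancel except for the weights
  \<open>1 \<le> \<delta> < 1 + j\<close>, which \<open>m\<close> moves across the cut between \<open>g\<^bsub>\<le>1/2\<^esub>\<close> and \<open>g\<^bsub>\<ge>1\<^esub>\<close>.  There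
  \<open>(u - \<langle>f|u\<rangle>) t = [u, t] + t (u - \<langle>f|u\<rangle>)\<close>, and the commutator of \<open>\<phi>(m)\<close> with \<open>D\<close> supplies the terms
  \<open>\<phi>(u) t\<close> which complete \<open>[u, t]\<close> to \<open>\<rho>\<close>.\<close>

lemma Y_\<rho>:
  assumes m: "m \<in> ad_space x j" and j: "j \<in> half_ints" "1/2 \<le> j"
    and PG: "P * G m = G m * P" and P\<Phi>: "P * \<Phi> m = P * \<Phi> m * P" and t: "P * Y * t = 0"
  defines "c \<equiv> \<lambda>d. if 1 \<le> d \<and> d < 1 + j then zpow (1 + j - d) else 0"
  shows "P * Y * \<rho> t m j = P * (\<Sum>u\<in>B. c (\<delta> u) * (\<Phi> (lie m (du u)) * \<rho> t u (\<delta> u)))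
    + P * (\<Sum>u\<in>B. c (\<delta> u) * (\<Phi> (lie m (du u)) * (t * (G u - \<kappa> (form f u)))))"
proof -
  \<comment> \<open>The coefficients of \<open>Y\<close> and of \<open>D\<close> as functions of the weight: the Casimir tensor identity
    shifts their argument by \<open>j\<close>.\<close>
  define h where "h d = (if d \<le> 1/2 then zpow (1 - d) else 0)" for d :: real
  define i where "i d = (if 1 \<le> d then 1 else 0 :: 'r)" for d :: real
  have h_central: "h d * r = r * h d" for d r
    by (auto simp: h_def s_power_central)
  have nn: "nat \<lfloor>2 * (a + b)\<rfloor> = nat \<lfloor>2 * a\<rfloor> + nat \<lfloor>2 * b\<rfloor>"
    if "a \<in> half_ints" "b \<in> half_ints" "0 \<le> a" "0 \<le> b" for a b
    using nat_floor_double_add that by blast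
  have hc: "h (\<delta> u - j) - zpow j * h (\<delta> u) = c (\<delta> u)" if u: "u \<in> B" for u
  proof -
    have du: "\<delta> u \<in> half_ints" using weight_B[OF u] by blast
    have 1: "1/2 < \<delta> u \<longleftrightarrow> 1 \<le> \<delta> u" using half_int_gap[of "1/2" "\<delta> u"] du half_ints_closed by simp
    have "\<delta> u < 1 + j \<longleftrightarrow> \<delta> u + 1/2 \<le> 1 + j"
      using half_int_gap du j(1) half_ints_closed by blast
    also have "\<dots> \<longleftrightarrow> \<delta> u - j \<le> 1/2" by (rule iffI; linarith)
    finally have 2: "\<delta> u < 1 + j \<longleftrightarrow> \<delta> u - j \<le> 1/2" .
    have 3: "1 - (\<delta> u - j) = 1 + j - \<delta> u" by simp
    show ?thesis
    proof (cases "\<delta> u \<le> 1/2")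
      case True
      have "nat \<lfloor>2 * (j + (1 - \<delta> u))\<rfloor> = nat \<lfloor>2 * j\<rfloor> + nat \<lfloor>2 * (1 - \<delta> u)\<rfloor>"
        by (rule nn) (use True j du half_ints_closed in auto)
      moreover have "1 - (\<delta> u - j) = j + (1 - \<delta> u)" by simp
      ultimately have "zpow (1 - (\<delta> u - j)) = zpow j * zpow (1 - \<delta> u)"
        by (simp only: power_add)
      moreover have "\<delta> u - j \<le> 1/2" using True j by simp
      ultimately show ?thesis using True by (simp only: h_def c_def) simp
    next
      case False
      then have "1 \<le> \<delta> u" using 1 by simp
      then show ?thesis using False 2 3 by (simp only: h_def c_def) simp
    qed
  qed
  have Gm\<Phi>: "G m * \<Phi> a = \<Phi> a * G m" for a by (rule G_\<Phi>)
  have GmD: "G m * D = D * G m"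
  proof -
    have "G m * (\<Phi> a * \<Phi> b) = \<Phi> a * \<Phi> b * G m" for a b
      by (simp add: Gm\<Phi> mult.assoc flip: mult.assoc[of "G m"])
    then have "G m * (i d * (\<Phi> a * \<Phi> b)) = i d * (\<Phi> a * \<Phi> b) * G m" for d a b
      by (simp add: i_def)
    then show ?thesis
      unfolding D_def i_def[symmetric] by (simp add: sum_distrib_left sum_distrib_right)
  qed
  have adG: "G m * Y - Y * G m = - (\<Sum>u\<in>B. h (\<delta> u - j) * (G u * \<Phi> (lie m (du u))))"
  proof -
    have "G m * (h (\<delta> u) * (G u * \<Phi> (du u))) - h (\<delta> u) * (G u * \<Phi> (du u)) * G m
      = h (\<delta> u) * (G (lie m u) * \<Phi> (du u))" for u
    proof -
      have "G m * (h (\<delta> u) * (G u * \<Phi> (du u))) = h (\<delta> u) * (G m * G u * \<Phi> (du u))"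
        by (metis h_central mult.assoc)
      moreover have "h (\<delta> u) * (G u * \<Phi> (du u)) * G m = h (\<delta> u) * (G u * G m * \<Phi> (du u))"
        by (simp add: mult.assoc Gm\<Phi>)
      ultimately show ?thesis by (simp only: G_lie left_diff_distrib right_diff_distrib)
    qed
    then have "G m * (\<Sum>u\<in>B. h (\<delta> u) * (G u * \<Phi> (du u))) - (\<Sum>u\<in>B. h (\<delta> u) * (G u * \<Phi> (du u))) * G m
      = (\<Sum>u\<in>B. h (\<delta> u) * (G (lie m u) * \<Phi> (du u)))"
      by (simp add: sum_distrib_left sum_distrib_right flip: sum_subtractf)
    also have "\<dots> = - (\<Sum>u\<in>B. h (\<delta> u - j) * (G u * \<Phi> (lie m (du u))))"
      by (rule casimir_tensor_invariant[OF _ _ _ m, where c = h and \<beta> = "\<lambda>a b. G a * \<Phi> b"])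
        (simp_all add: G_add \<Phi>_add G_scale \<Phi>_scale distrib_left distrib_right mult.assoc,
          metis \<kappa>_central mult.assoc)
    finally have 1: "G m * (\<Sum>u\<in>B. h (\<delta> u) * (G u * \<Phi> (du u)))
      - (\<Sum>u\<in>B. h (\<delta> u) * (G u * \<Phi> (du u))) * G m = - (\<Sum>u\<in>B. h (\<delta> u - j) * (G u * \<Phi> (lie m (du u))))" .
    have 2: "G m * (s ^ 2 * D) = s ^ 2 * D * G m"
      by (metis GmD mult.assoc s_power_central)
    show ?thesis
      using 1 unfolding Y_def h_def[symmetric]
      by (simp only: distrib_left distrib_right 2 Gm\<Phi>) (simp add: algebra_simps)
  qed
  have adD: "\<Phi> m * D - D * \<Phi> m = - (\<Sum>u\<in>B. (i (\<delta> u) - i (\<delta> u - j)) * (\<Phi> (lie m (du u)) * \<Phi> u))"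
  proof -
    have "\<Phi> m * (i (\<delta> u) * (\<Phi> (du u) * \<Phi> u)) - i (\<delta> u) * (\<Phi> (du u) * \<Phi> u) * \<Phi> m
      = i (\<delta> u) * (\<Phi> (lie m (du u)) * \<Phi> u) + i (\<delta> u) * (\<Phi> (du u) * \<Phi> (lie m u))" for u
      by (simp add: i_def \<Phi>_lie algebra_simps)
    then have "\<Phi> m * (\<Sum>u\<in>B. i (\<delta> u) * (\<Phi> (du u) * \<Phi> u)) - (\<Sum>u\<in>B. i (\<delta> u) * (\<Phi> (du u) * \<Phi> u)) * \<Phi> m
      = (\<Sum>u\<in>B. i (\<delta> u) * (\<Phi> (lie m (du u)) * \<Phi> u)) + (\<Sum>u\<in>B. i (\<delta> u) * (\<Phi> (du u) * \<Phi> (lie m u)))"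
      by (simp add: sum_distrib_left sum_distrib_right flip: sum_subtractf sum.distrib)
    also have "(\<Sum>u\<in>B. i (\<delta> u) * (\<Phi> (du u) * \<Phi> (lie m u)))
      = - (\<Sum>u\<in>B. i (\<delta> u - j) * (\<Phi> (lie m (du u)) * \<Phi> u))"
      by (rule casimir_tensor_invariant[OF _ _ _ m, where c = i and \<beta> = "\<lambda>a b. \<Phi> b * \<Phi> a"])
        (simp_all add: \<Phi>_add \<Phi>_scale distrib_left distrib_right mult.assoc,
          metis \<kappa>_central mult.assoc)
    finally show ?thesis
      unfolding D_def i_def[symmetric]
      by (simp add: left_diff_distrib sum_subtractf algebra_simps)
  qed
  have ad\<Phi>: "\<Phi> m * Y - Y * \<Phi> m = (\<Sum>u\<in>B. \<kappa> (form f u) * \<Phi> (lie m (du u)))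
      + (\<Sum>u\<in>B. h (\<delta> u) * (G u * \<Phi> (lie m (du u))))
      + s ^ 2 * (\<Phi> m * D - D * \<Phi> m)"
  proof -
    have 1: "\<Phi> m * \<Phi> f - \<Phi> f * \<Phi> m = (\<Sum>u\<in>B. \<kappa> (form f u) * \<Phi> (lie m (du u)))"
    proof -
      have "\<Phi> m * (\<kappa> k * \<Phi> a) - \<kappa> k * \<Phi> a * \<Phi> m = \<kappa> k * \<Phi> (lie m a)" for k a
      proof -
        have "\<Phi> m * (\<kappa> k * \<Phi> a) = \<kappa> k * (\<Phi> m * \<Phi> a)" by (metis \<kappa>_central mult.assoc)
        then show ?thesis by (simp add: \<Phi>_lie right_diff_distrib mult.assoc)
      qed
      then show ?thesis
        unfolding \<Phi>_f by (simp add: sum_distrib_left sum_distrib_right flip: sum_subtractf)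
    qed
    have "\<Phi> m * (h (\<delta> u) * (G u * \<Phi> (du u))) - h (\<delta> u) * (G u * \<Phi> (du u)) * \<Phi> m
        = h (\<delta> u) * (G u * \<Phi> (lie m (du u)))" for u
    proof -
      have "\<Phi> m * (h (\<delta> u) * (G u * \<Phi> (du u))) = h (\<delta> u) * (G u * (\<Phi> m * \<Phi> (du u)))"
        by (metis h_central G_\<Phi> mult.assoc)
      then show ?thesis by (simp add: \<Phi>_lie right_diff_distrib mult.assoc)
    qed
    then have 2: "\<Phi> m * (\<Sum>u\<in>B. h (\<delta> u) * (G u * \<Phi> (du u))) - (\<Sum>u\<in>B. h (\<delta> u) * (G u * \<Phi> (du u))) * \<Phi> m
      = (\<Sum>u\<in>B. h (\<delta> u) * (G u * \<Phi> (lie m (du u))))"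
      by (simp add: sum_distrib_left sum_distrib_right flip: sum_subtractf)
    have 3: "\<Phi> m * (s ^ 2 * D) = s ^ 2 * (\<Phi> m * D)" by (metis mult.assoc s_power_central)
    show ?thesis
      unfolding 1[symmetric] 2[symmetric] Y_def h_def[symmetric]
      by (simp only: distrib_left distrib_right right_diff_distrib 3) (simp add: mult.assoc)
  qed
  \<comment> \<open>Only \<open>P\<close> times the commutators survives, because \<open>P Y t = 0\<close>.\<close>
  have "P * (G m * (Y * t)) = 0"
  proof -
    have "P * (G m * (Y * t)) = G m * (P * Y * t)" by (simp add: PG flip: mult.assoc)
    then show ?thesis using t by simp
  qed
  moreover have "Y * (G m * t - t * G m) = G m * (Y * t) - Y * t * G m - (G m * Y - Y * G m) * t"
    by (simp add: algebra_simps)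
  ultimately have 1: "P * (Y * (G m * t - t * G m)) = - (P * ((G m * Y - Y * G m) * t))"
    using t by (simp add: right_diff_distrib flip: mult.assoc)
  have "P * (\<Phi> m * (Y * t)) = P * \<Phi> m * P * (Y * t)" by (simp only: P\<Phi>[symmetric] mult.assoc[symmetric])
  then have "P * (\<Phi> m * (Y * t)) = 0" using t by (simp add: mult.assoc)
  moreover have "Y * (\<Phi> m * t) = \<Phi> m * (Y * t) - (\<Phi> m * Y - Y * \<Phi> m) * t"
    by (simp add: algebra_simps)
  ultimately have 2: "P * (Y * (\<Phi> m * t)) = - (P * ((\<Phi> m * Y - Y * \<Phi> m) * t))"
    by (simp add: right_diff_distrib)
  have 3: "Y * (zpow j * (\<Phi> m * t)) = zpow j * (Y * (\<Phi> m * t))"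
    by (metis mult.assoc s_power_central)
  have 4: "P * (zpow j * y) = zpow j * (P * y)" for y by (metis mult.assoc s_power_central)
  have "P * Y * \<rho> t m j = P * (Y * (G m * t - t * G m)) + zpow j * (P * (Y * (\<Phi> m * t)))"
    unfolding \<rho>_def by (simp only: distrib_left mult.assoc 3 4)
  also have "\<dots> = P * ((- (G m * Y - Y * G m) - zpow j * (\<Phi> m * Y - Y * \<Phi> m)) * t)"
    unfolding 1 2
    by (simp only: left_diff_distrib right_diff_distrib mult_minus_left mult_minus_right mult.assoc 4)
      simp
  also have "- (G m * Y - Y * G m) - zpow j * (\<Phi> m * Y - Y * \<Phi> m)
    = (\<Sum>u\<in>B. c (\<delta> u) * (\<Phi> (lie m (du u)) * (G u - \<kappa> (form f u) + zpow (\<delta> u) * \<Phi> u)))"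
  proof -
    have "- (G m * Y - Y * G m) - zpow j * (\<Phi> m * Y - Y * \<Phi> m)
      = (\<Sum>u\<in>B. h (\<delta> u - j) * (G u * \<Phi> (lie m (du u))))
        - ((\<Sum>u\<in>B. zpow j * (\<kappa> (form f u) * \<Phi> (lie m (du u))))
         + (\<Sum>u\<in>B. zpow j * (h (\<delta> u) * (G u * \<Phi> (lie m (du u)))))
         - (\<Sum>u\<in>B. zpow j * (s ^ 2 * ((i (\<delta> u) - i (\<delta> u - j)) * (\<Phi> (lie m (du u)) * \<Phi> u)))))"
      unfolding adG ad\<Phi> adD
      by (simp only: distrib_left right_diff_distrib mult_minus_right sum_distrib_left minus_minus add_uminus_conv_diff)
    also have "\<dots> = (\<Sum>u\<in>B. h (\<delta> u - j) * (G u * \<Phi> (lie m (du u)))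
         - (zpow j * (\<kappa> (form f u) * \<Phi> (lie m (du u)))
           + zpow j * (h (\<delta> u) * (G u * \<Phi> (lie m (du u))))
           - zpow j * (s ^ 2 * ((i (\<delta> u) - i (\<delta> u - j)) * (\<Phi> (lie m (du u)) * \<Phi> u)))))"
      by (simp only: sum_subtractf sum.distrib)
    also have "\<dots> = (\<Sum>u\<in>B. c (\<delta> u) * (\<Phi> (lie m (du u)) * (G u - \<kappa> (form f u) + zpow (\<delta> u) * \<Phi> u)))"
    proof (rule sum.cong[OF refl])
      fix u assume u: "u \<in> B"
      let ?L = "\<Phi> (lie m (du u))"
      have du: "\<delta> u \<in> half_ints" using weight_B[OF u] by blast
      have "h (\<delta> u - j) * (G u * ?L) - zpow j * (h (\<delta> u) * (G u * ?L))
        = (h (\<delta> u - j) - zpow j * h (\<delta> u)) * (G u * ?L)"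
        by (simp add: left_diff_distrib mult.assoc)
      also have "\<dots> = c (\<delta> u) * (?L * G u)" by (simp only: hc[OF u] G_\<Phi>)
      finally have A: "h (\<delta> u - j) * (G u * ?L) - zpow j * (h (\<delta> u) * (G u * ?L)) = c (\<delta> u) * (?L * G u)" .
      have C: "zpow j * (\<kappa> (form f u) * ?L) = c (\<delta> u) * (?L * \<kappa> (form f u))"
      proof (cases "\<delta> u = 1")
        case True
        then have "c (\<delta> u) = zpow j" using j by (simp add: c_def)
        then show ?thesis by (simp add: \<kappa>_central)
      next
        case False
        then show ?thesis using form_f_0[OF u] by (simp add: \<kappa>_0)
      qed
      have E: "zpow j * (s ^ 2 * ((i (\<delta> u) - i (\<delta> u - j)) * (?L * \<Phi> u))) = c (\<delta> u) * (?L * (zpow (\<delta> u) * \<Phi> u))"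
      proof (cases "1 \<le> \<delta> u \<and> \<delta> u < 1 + j")
        case True
        have "nat \<lfloor>2 * ((1 + j - \<delta> u) + \<delta> u)\<rfloor> = nat \<lfloor>2 * (1 + j - \<delta> u)\<rfloor> + nat \<lfloor>2 * \<delta> u\<rfloor>"
          by (rule nn) (use True j du half_ints_closed in auto)
        moreover have "nat \<lfloor>2 * (1 + j)\<rfloor> = nat \<lfloor>2 * (1::real)\<rfloor> + nat \<lfloor>2 * j\<rfloor>"
          by (rule nn) (use j half_ints_closed in auto)
        ultimately have "nat \<lfloor>2 * (1 + j - \<delta> u)\<rfloor> + nat \<lfloor>2 * \<delta> u\<rfloor> = nat \<lfloor>2 * j\<rfloor> + 2" by simp
        then have "zpow (1 + j - \<delta> u) * zpow (\<delta> u) = zpow j * s ^ 2" by (metis power_add)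
        moreover have "i (\<delta> u) - i (\<delta> u - j) = 1" using True by (simp add: i_def)
        moreover have "c (\<delta> u) * (?L * (zpow (\<delta> u) * \<Phi> u)) = zpow (1 + j - \<delta> u) * zpow (\<delta> u) * (?L * \<Phi> u)"
          using True s_power_central[of _ ?L] by (simp add: c_def mult.assoc) (metis mult.assoc)
        ultimately show ?thesis by (simp add: mult.assoc)
      next
        case False
        then have "i (\<delta> u) - i (\<delta> u - j) = 0" using j by (auto simp: i_def)
        moreover have "c (\<delta> u) = 0" using False by (auto simp: c_def)
        ultimately show ?thesis by simp
      qed
      show "h (\<delta> u - j) * (G u * ?L) - (zpow j * (\<kappa> (form f u) * ?L) + zpow j * (h (\<delta> u) * (G u * ?L))
           - zpow j * (s ^ 2 * ((i (\<delta> u) - i (\<delta> u - j)) * (?L * \<Phi> u))))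
        = c (\<delta> u) * (?L * (G u - \<kappa> (form f u) + zpow (\<delta> u) * \<Phi> u))"
        unfolding C E distrib_left right_diff_distrib A[symmetric] by simp
    qed
    finally show ?thesis .
  qed
  also have "(\<Sum>u\<in>B. c (\<delta> u) * (\<Phi> (lie m (du u)) * (G u - \<kappa> (form f u) + zpow (\<delta> u) * \<Phi> u))) * t
    = (\<Sum>u\<in>B. c (\<delta> u) * (\<Phi> (lie m (du u)) * \<rho> t u (\<delta> u)))
      + (\<Sum>u\<in>B. c (\<delta> u) * (\<Phi> (lie m (du u)) * (t * (G u - \<kappa> (form f u)))))"
    unfolding sum_distrib_right sum.distrib[symmetric]
  proof (rule sum.cong[OF refl])
    fix u
    have "(G u - \<kappa> (form f u) + zpow (\<delta> u) * \<Phi> u) * t = \<rho> t u (\<delta> u) + t * (G u - \<kappa> (form f u))"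
      by (simp add: \<rho>_def algebra_simps \<kappa>_central)
    then show "c (\<delta> u) * (\<Phi> (lie m (du u)) * (G u - \<kappa> (form f u) + zpow (\<delta> u) * \<Phi> u)) * t
      = c (\<delta> u) * (\<Phi> (lie m (du u)) * \<rho> t u (\<delta> u))
        + c (\<delta> u) * (\<Phi> (lie m (du u)) * (t * (G u - \<kappa> (form f u))))"
      by (simp only: mult.assoc) (simp only: distrib_left)
  qed
  finally show ?thesis by (simp only: distrib_left)
qed

end

section \<open>Invariance of the coefficients\<close>

lemma left_ideal_W_ideal: "left_ideal (W_ideal form f x)"
  unfolding W_ideal_def left_ideal_def by blast

lemma W_ideal_gen: "a \<in> ad_sum x {1..} \<Longrightarrow> uea_gen a - uea_const (form f a) \<in> W_ideal form f x"
  unfolding W_ideal_def by blast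

text \<open>The instance of the preceding section given by the representation \<open>\<phi>\<close>.\<close>

locale lax_setting =
  fixes form :: "'g::complex_lie_algebra \<Rightarrow> 'g \<Rightarrow> complex" and f x e :: 'g
    and \<phi> :: "'g \<Rightarrow> complex ^ 'n ^ 'n" and B :: "'g set" and \<xi> :: real
  assumes reductive: "reductive TYPE('g)"
    and sym_form: "sym_nondeg_invariant_form form"
    and triple: "sl2_triple f x e"
    and rep: "faithful_representation \<phi>"
    and eigenbasis: "ad_eigenbasis x B"
    and top: "is_weight (\<phi> x) (\<xi>/2)" "\<And>k. is_weight (\<phi> x) k \<Longrightarrow> k \<le> \<xi>/2"
begin

lemma \<phi>_add: "\<phi> (a + b) = \<phi> a + \<phi> b" and \<phi>_scale: "\<phi> (c *\<^sub>C a) = mat c ** \<phi> a"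
  and \<phi>_lie: "\<phi> (lie a b) = \<phi> a ** \<phi> b - \<phi> b ** \<phi> a" and \<phi>_inj: "inj \<phi>"
  using rep by (auto simp: faithful_representation_def representation_def)

lemma \<phi>_0: "\<phi> 0 = 0"
  using \<phi>_add[of 0 0] by simp

lemma \<phi>_minus: "\<phi> (- a) = - \<phi> a"
  using \<phi>_add[of a "- a"] by (simp add: \<phi>_0 add_eq_0_iff)

sublocale sl2: sl2_rep "\<phi> e" "\<phi> f" "\<phi> x"
proof
  have "lie x e = e" "lie x f = - f" "lie e f = 2 *\<^sub>C x" using triple by (auto simp: sl2_triple_def)
  moreover have "mat 2 ** M = M + M" for M :: "complex ^ 'n ^ 'n" by (simp add: vec_eq_iff)
  ultimately show "\<phi> x ** \<phi> e - \<phi> e ** \<phi> x = \<phi> e" "\<phi> x ** \<phi> f - \<phi> f ** \<phi> x = - \<phi> f"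
    "\<phi> e ** \<phi> f - \<phi> f ** \<phi> e = \<phi> x + \<phi> x"
    by (simp_all flip: \<phi>_lie \<phi>_scale add: \<phi>_minus) (simp add: \<phi>_scale)
qed

text \<open>Faithfulness identifies the \<open>ad x\<close>-eigenvalues with differences of weights of \<open>V\<close>.\<close>

sublocale graded_lie form f x B
proof
  show "sym_nondeg_invariant_form form" by (rule sym_form)
  show "lie x f = - f" using triple by (simp add: sl2_triple_def)
  show "\<exists>A::'g set. finite A \<and> lie_vs.span A = UNIV" using reductive by (auto simp: reductive_def)
  show "ad_eigenbasis x B" by (rule eigenbasis)
  fix u assume u: "u \<in> B"
  then obtain c where c: "lie x u = c *\<^sub>C u" using eigenbasis by (auto simp: ad_eigenbasis_def)
  have "u \<noteq> 0" using u eigenbasis lie_vs.dependent_zero by (auto simp: ad_eigenbasis_def)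
  then have "\<phi> u \<noteq> 0" using \<phi>_inj \<phi>_0 by (metis injD)
  moreover have "\<phi> x ** \<phi> u - \<phi> u ** \<phi> x = mat c ** \<phi> u" by (simp add: c flip: \<phi>_lie \<phi>_scale)
  ultimately obtain d where "d \<in> half_ints" "c = of_real d" using sl2.ad_eigenvalue_half_int by blast
  then show "\<exists>d\<in>half_ints. u \<in> ad_space x d" using c by (auto simp: ad_space_def)
qed

abbreviation G :: "'g \<Rightarrow> ('g uea fps, 'n) sqmat" where "G a \<equiv> scal (uea_gen a)"
abbreviation \<Phi> :: "'g \<Rightarrow> ('g uea fps, 'n) sqmat" where "\<Phi> a \<equiv> cst (\<phi> a)"
abbreviation \<kappa> :: "complex \<Rightarrow> ('g uea fps, 'n) sqmat" where "\<kappa> c \<equiv> scal (uea_const c)"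

sublocale lax_data form f x B G \<Phi> \<kappa> zv
  by unfold_locales
    (simp_all add: uea_gen_add scal_add \<phi>_add cst_add uea_gen_scale scal_mult \<phi>_scale cst_mult cst_mat
      uea_gen_lie scal_diff \<phi>_lie cst_diff scal_cst_commute scal_const_central zv_central)

abbreviation wp :: "real set \<Rightarrow> complex ^ 'n ^ 'n" where "wp \<equiv> weight_proj (\<phi> x)"
abbreviation pr :: "real set \<Rightarrow> ('g uea fps, 'n) sqmat" where "pr K \<equiv> cst (wp K)"

lemma \<phi>_has_weight: "a \<in> ad_space x k \<Longrightarrow> sl2.has_weight (\<phi> a) k"
  by (simp add: sl2.has_weight_def ad_space_def flip: \<phi>_lie \<phi>_scale)

lemma pr_\<Phi>: "a \<in> ad_space x j \<Longrightarrow> pr K * \<Phi> a = \<Phi> a * pr {k. k + j \<in> K}"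
  using sl2.weight_proj_shift[OF \<phi>_has_weight] by (simp flip: cst_mult)

lemma pr_\<Phi>1: "a \<in> ad_space x j \<Longrightarrow> pr {p} * \<Phi> a = \<Phi> a * pr {p - j}"
proof -
  have "{k. k + j \<in> {p}} = {p - j}" by auto
  then show "a \<in> ad_space x j \<Longrightarrow> pr {p} * \<Phi> a = \<Phi> a * pr {p - j}" using pr_\<Phi>[of a j "{p}"] by simp
qed

lemma pr_pr: "pr K * pr L = pr (K \<inter> L)"
  by (simp add: sl2.weight_proj_mult flip: cst_mult)

lemma low: "is_weight (\<phi> x) k \<Longrightarrow> - (\<xi>/2) \<le> k"
  using sl2.weight_lower_bound[OF top(2)] by blast

lemma pr_eq_0: "(\<And>k. k \<in> K \<Longrightarrow> k < - (\<xi>/2)) \<Longrightarrow> pr K = 0"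
proof -
  assume "\<And>k. k \<in> K \<Longrightarrow> k < - (\<xi>/2)"
  then have "wp K = wp {}" by (intro sl2.weight_proj_cong) (use low in force)
  then show ?thesis by (simp add: sl2.weight_proj_empty)
qed

lemma Y_op_eq: "Sqmat (Y_op form \<phi> f x B) = Y"
proof -
  have 1: "(\<Sum>u\<in>B \<inter> ad_sum x {..1/2}. Sqmat (z_tensor (1 - \<delta> u) (uea_gen u) (\<phi> (du u))))
    = (\<Sum>u\<in>B. (if \<delta> u \<le> 1/2 then zpow (1 - \<delta> u) else 0) * (G u * \<Phi> (du u)))"
  proof -
    have "(\<Sum>u\<in>B \<inter> ad_sum x {..1/2}. Sqmat (z_tensor (1 - \<delta> u) (uea_gen u) (\<phi> (du u))))
      = (\<Sum>u\<in>B. if u \<in> ad_sum x {..1/2} then Sqmat (z_tensor (1 - \<delta> u) (uea_gen u) (\<phi> (du u))) else 0)"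
      by (rule sum.inter_restrict[OF finite_B])
    also have "\<dots> = (\<Sum>u\<in>B. (if \<delta> u \<le> 1/2 then zpow (1 - \<delta> u) else 0) * (G u * \<Phi> (du u)))"
      by (intro sum.cong refl) (simp add: B_in_ad_sum Sqmat_z_tensor zv_power_central)
    finally show ?thesis .
  qed
  have "cst (D_op form \<phi> x B) = - (\<Sum>u\<in>B \<inter> ad_sum x {1..}. \<Phi> (du u) * \<Phi> u)"
    by (simp add: D_op_def cst_uminus cst_sum cst_mult)
  also have "(\<Sum>u\<in>B \<inter> ad_sum x {1..}. \<Phi> (du u) * \<Phi> u)
      = (\<Sum>u\<in>B. if u \<in> ad_sum x {1..} then \<Phi> (du u) * \<Phi> u else 0)"
    by (rule sum.inter_restrict[OF finite_B])
  also have "\<dots> = (\<Sum>u\<in>B. (if 1 \<le> \<delta> u then 1 else 0) * (\<Phi> (du u) * \<Phi> u))"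
    by (intro sum.cong refl) (simp add: B_in_ad_sum)
  finally have 2: "cst (D_op form \<phi> x B) = D" by (simp add: D_def)
  have scal1: "scal (1 :: 'g uea) = (1 :: ('g uea fps, 'n) sqmat)"
    by (rule sqmat_eqI) (simp add: entry_scal entry_def[of 1] one_sqmat.rep_eq mat_def)
  show ?thesis
    unfolding Y_op_def Sqmat_simps Sqmat_sum cst_def[symmetric] 1 Y_def unfolding Sqmat_z_tensor 2
    by (simp add: scal1 zv_power_central)
qed

lemma Y_leading: "\<exists>R. Y = 1 + \<Phi> f + zv * R"
proof -
  have "\<exists>r. (if \<delta> u \<le> 1/2 then zpow (1 - \<delta> u) else 0) * (G u * \<Phi> (du u)) = zv * r" if "u \<in> B" for u
  proof (cases "\<delta> u \<le> 1/2")
    case True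
    then have "1 \<le> nat \<lfloor>2 * (1 - \<delta> u)\<rfloor>" by (simp add: le_nat_iff le_floor_iff)
    then obtain k where "nat \<lfloor>2 * (1 - \<delta> u)\<rfloor> = Suc k" using Suc_le_D by (metis One_nat_def)
    then show ?thesis using True by (auto simp: mult.assoc)
  qed (auto intro: exI[of _ 0])
  then obtain r where r: "\<And>u. u \<in> B \<Longrightarrow>
      (if \<delta> u \<le> 1/2 then zpow (1 - \<delta> u) else 0) * (G u * \<Phi> (du u)) = zv * r u" by metis
  have "(\<Sum>u\<in>B. (if \<delta> u \<le> 1/2 then zpow (1 - \<delta> u) else 0) * (G u * \<Phi> (du u))) = (\<Sum>u\<in>B. zv * r u)"
    by (rule sum.cong[OF refl r])
  then have "Y = 1 + \<Phi> f + (\<Sum>u\<in>B. zv * r u) + zv ^ 2 * D" unfolding Y_def by (simp only:)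
  then have "Y = 1 + \<Phi> f + zv * ((\<Sum>u\<in>B. r u) + zv * D)"
    by (simp add: sum_distrib_left distrib_left power2_eq_square mult.assoc)
  then show ?thesis by blast
qed

abbreviation P :: "('g uea fps, 'n) sqmat" where "P \<equiv> pr {..<\<xi>/2}"
abbreviation Q :: "('g uea fps, 'n) sqmat" where "Q \<equiv> pr {- (\<xi>/2)<..}"
abbreviation Z :: "('g uea fps, 'n) sqmat" where "Z \<equiv> pr {- (\<xi>/2)}"
definition C :: "('g uea fps, 'n) sqmat" where
  "C = (THE C. Q * C * P = C \<and> P * Y * Q * C = P \<and> C * (P * Y * Q) = Q)"

lemma QZ: "Q + Z = 1"
proof -
  have "wp ({- (\<xi>/2)<..} \<union> {- (\<xi>/2)}) = mat 1"
    unfolding sl2.weight_proj_UNIV[symmetric] by (rule sl2.weight_proj_cong) (use low in force)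
  then have "wp {- (\<xi>/2)<..} + wp {- (\<xi>/2)} = mat 1" by (subst (asm) sl2.weight_proj_Un) auto
  then show ?thesis by (simp flip: cst_add)
qed

lemma ZQ: "Z * Q = 0" and PP: "P * P = P" and QQ: "Q * Q = Q" and ZZ: "Z * Z = Z"
  by (auto simp: pr_pr sl2.weight_proj_empty)

lemma C_unique: "\<exists>!C. Q * C * P = C \<and> P * Y * Q * C = P \<and> C * (P * Y * Q) = Q"
proof -
  obtain R where R: "Y = 1 + \<Phi> f + zv * R" using Y_leading by blast
  obtain C0 where C0: "wp {- (\<xi>/2)<..} ** C0 ** wp {..<\<xi>/2} = C0"
      "wp {..<\<xi>/2} ** (mat 1 + \<phi> f) ** wp {- (\<xi>/2)<..} ** C0 = wp {..<\<xi>/2}"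
      "C0 ** (wp {..<\<xi>/2} ** (mat 1 + \<phi> f) ** wp {- (\<xi>/2)<..}) = wp {- (\<xi>/2)<..}"
    using sl2.one_plus_F_rel_inverse[OF top] by blast
  have lead: "P * Y * Q - zv * (P * R * Q) = P * (1 + \<Phi> f) * Q"
  proof -
    have "P * (zv * R) * Q = zv * (P * R * Q)" 
      by (simp only: zv_central[of P, symmetric] mult.assoc[symmetric])
    then show ?thesis unfolding R by (simp add: distrib_left distrib_right)
  qed
  note C0' = C0[THEN arg_cong[where f = cst], unfolded cst_mult cst_add cst_1]
  show ?thesis
  proof (rule rel_inverse_exists)
    show "P * (P * Y * Q) * Q = P * Y * Q" by (simp add: mult.assoc QQ) (simp add: PP flip: mult.assoc)
    show "Q * cst C0 * P = cst C0" by (rule C0'(1))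
    show "(P * Y * Q - zv * (P * R * Q)) * cst C0 = P" unfolding lead by (rule C0'(2))
    show "cst C0 * (P * Y * Q - zv * (P * R * Q)) = Q" unfolding lead by (rule C0'(3))
  qed (fact PP QQ)+
qed

lemma C: "Q * C * P = C" "P * Y * Q * C = P" "C * (P * Y * Q) = Q"
  using theI'[OF C_unique] unfolding C_def[symmetric] by blast+

lemma QC: "Q * C = C"
proof -
  have "Q * (Q * C * P) = Q * C * P" by (simp only: QQ mult.assoc[symmetric])
  then show ?thesis unfolding C(1) .
qed

lemma PYC: "P * Y * C = P"
  using C(2) by (simp only: mult.assoc QC)

lemma ZC: "Z * C = 0"
proof -
  have "Z * (Q * C) = 0" by (simp add: ZQ flip: mult.assoc)
  then show ?thesis by (simp only: QC)
qed

definition L :: "('g uea fps, 'n) sqmat" where "L = C * (P * Y * Z)"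

lemma L_R_eq: "Sqmat (L_R form \<phi> f x B \<xi>) = L"
proof -
  let ?P = "const_op (wp {..<\<xi>/2}) :: 'g uea fps ^ 'n ^ 'n"
  let ?Q = "const_op (wp {- (\<xi>/2)<..}) :: 'g uea fps ^ 'n ^ 'n"
  let ?A = "?P ** Y_op form \<phi> f x B ** ?Q"
  have A: "Sqmat ?A = P * Y * Q" by (simp add: Sqmat_simps Y_op_eq cst_def)
  have "Sqmat ?Q * Sqmat (rel_inverse ?P ?Q ?A) * Sqmat ?P = Sqmat (rel_inverse ?P ?Q ?A)
    \<and> Sqmat ?A * Sqmat (rel_inverse ?P ?Q ?A) = Sqmat ?P
    \<and> Sqmat (rel_inverse ?P ?Q ?A) * Sqmat ?A = Sqmat ?Q"
    by (rule rel_inverse_Sqmat) (use C_unique in \<open>simp only: A cst_def[symmetric]\<close>)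
  then have "Sqmat (rel_inverse ?P ?Q ?A) = C"
    using C_unique C unfolding A cst_def[symmetric] by blast
  then show ?thesis
    by (simp add: L_R_def Let_def Sqmat_simps L_def Y_op_eq flip: cst_def)
qed

text \<open>The solution \<open>t\<close> of \<open>\<Pi>\<^bsub><\<xi>/2\<^esub> Y t = 0\<close> with component \<open>1\<close> on \<open>V[-\<xi>/2]\<close>.\<close>

definition t :: "('g uea fps, 'n) sqmat" where "t = Z - L"

lemma PYt: "P * Y * t = 0"
proof -
  have "P * Y * L = P * Y * Z" by (simp only: L_def mult.assoc[symmetric] PYC PP)
  then show ?thesis by (simp add: t_def right_diff_distrib)
qed

lemma Zt: "Z * t = Z"
proof -
  have "Z * L = 0" by (simp only: L_def mult.assoc[symmetric] ZC mult_zero_left)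
  then show ?thesis by (simp add: t_def right_diff_distrib ZZ)
qed

lemma LZ: "L * Z = L"
  by (simp add: L_def mult.assoc ZZ)

abbreviation J :: "'g uea set" where "J \<equiv> W_ideal form f x"

text \<open>The component of \<open>t\<close> on \<open>V[-\<xi>/2]\<close> is constant, and \<open>\<phi>(a)\<close> raises weights.\<close>

lemma Z_\<rho>: assumes a: "a \<in> ad_space x j" and "0 < j" shows "Z * \<rho> t a j = 0"
proof -
  have "Z * (G a * t) = G a * (Z * t)" by (simp only: mult.assoc[symmetric] scal_cst_commute)
  then have "Z * (G a * t) = G a * Z" by (simp only: Zt)
  moreover have "Z * (t * G a) = G a * Z" by (simp only: mult.assoc[symmetric] Zt scal_cst_commute)
  moreover have "pr {- (\<xi>/2) - j} = 0" by (rule pr_eq_0) (use assms in auto)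
  then have "Z * \<Phi> a = 0" using pr_\<Phi>1[OF a, of "- (\<xi>/2)"] by simp
  then have "Z * (zpow j * (\<Phi> a * t)) = 0"
    unfolding zv_left_commute by (simp flip: mult.assoc[of Z])
  ultimately show ?thesis by (simp add: \<rho>_def distrib_left right_diff_distrib)
qed

text \<open>Multiplying \<open>Y_\<rho>\<close> by the inverse \<open>C\<close> gains at least one power of \<open>z\<^sup>-\<^sup>1\<^sup>/\<^sup>2\<close>, so induction on
  the order \<open>n\<close>, for all \<open>a\<close> and \<open>j\<close> at once, gives the transformation law modulo \<open>J\<close>.\<close>

lemma \<rho>_coeffs_in:
  "a \<in> ad_space x j \<Longrightarrow> j \<in> half_ints \<Longrightarrow> 1/2 \<le> j \<Longrightarrow> \<rho> t a j \<in> coeffs_in J n"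
proof (induction n arbitrary: a j)
  case 0
  then show ?case by (simp add: coeffs_in_def)
next
  case (Suc n)
  note I = left_ideal_coeffs_in[OF left_ideal_W_ideal[of form f x]]
  define c :: "real \<Rightarrow> ('g uea fps, 'n) sqmat" where
    "c d = (if 1 \<le> d \<and> d < 1 + j then zpow (1 + j - d) else 0)" for d
  have P\<Phi>: "P * \<Phi> a = P * \<Phi> a * P"
  proof -
    have "P * \<Phi> a * P = \<Phi> a * pr ({k. k + j \<in> {..<\<xi>/2}} \<inter> {..<\<xi>/2})"
      by (simp add: pr_\<Phi>[OF Suc.prems(1)] pr_pr mult.assoc)
    also have "{k. k + j \<in> {..<\<xi>/2}} \<inter> {..<\<xi>/2} = {k. k + j \<in> {..<\<xi>/2}}" using Suc.prems by auto
    finally show ?thesis by (simp add: pr_\<Phi>[OF Suc.prems(1)])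
  qed
  have eq: "P * Y * \<rho> t a j = P * (\<Sum>u\<in>B. c (\<delta> u) * (\<Phi> (lie a (du u)) * \<rho> t u (\<delta> u)))
    + P * (\<Sum>u\<in>B. c (\<delta> u) * (\<Phi> (lie a (du u)) * (t * (G u - \<kappa> (form f u)))))"
    unfolding c_def by (rule Y_\<rho>[OF Suc.prems _ P\<Phi> PYt]) (rule scal_cst_commute[symmetric])
  have c: "c d * y \<in> coeffs_in J (Suc n)" if "y \<in> coeffs_in J n" "d \<in> half_ints" for d y
  proof (cases "1 \<le> d \<and> d < 1 + j")
    case True
    then have "d + 1/2 \<le> 1 + j" using half_int_gap that(2) Suc.prems(2) half_ints_closed by blast
    then have "1 \<le> nat \<lfloor>2 * (1 + j - d)\<rfloor>" by (simp add: le_nat_iff le_floor_iff)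
    then have "zpow (1 + j - d) * y \<in> coeffs_in J (Suc n)"
      using coeffs_in_zv[OF left_ideal_W_ideal that(1), of "nat \<lfloor>2 * (1 + j - d)\<rfloor>"]
        coeffs_in_mono[of "Suc n" "n + nat \<lfloor>2 * (1 + j - d)\<rfloor>" J] by auto
    then show ?thesis using True by (simp add: c_def)
  next
    case False
    then have "c d = 0" by (auto simp: c_def)
    then show ?thesis using left_ideal_0[OF I] by simp
  qed
  have "c (\<delta> u) * (\<Phi> (lie a (du u)) * \<rho> t u (\<delta> u)) \<in> coeffs_in J (Suc n)" if u: "u \<in> B" for u
  proof (cases "1 \<le> \<delta> u")
    case True
    then have "\<rho> t u (\<delta> u) \<in> coeffs_in J n" using weight_B[OF u] by (intro Suc.IH) auto
    then show ?thesis using weight_B[OF u] by (intro c left_ideal_mult[OF I]) auto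
  next
    case False
    then have "c (\<delta> u) = 0" by (simp add: c_def)
    then show ?thesis using left_ideal_0[OF I] by simp
  qed
  moreover have "c (\<delta> u) * (\<Phi> (lie a (du u)) * (t * (G u - \<kappa> (form f u)))) \<in> coeffs_in J (Suc n)"
    if u: "u \<in> B" for u
  proof (cases "1 \<le> \<delta> u")
    case True
    then have "uea_gen u - uea_const (form f u) \<in> J"
      using B_in_ad_sum[OF u] by (intro W_ideal_gen) simp
    then have "t * scal (uea_gen u - uea_const (form f u)) \<in> coeffs_in J (Suc n)"
      by (simp add: coeffs_in_def entry_mult_scal left_ideal_mult[OF left_ideal_W_ideal])
    then have "t * (G u - \<kappa> (form f u)) \<in> coeffs_in J (Suc n)" by (simp only: scal_diff)
    then show ?thesis using left_ideal_mult[OF I] by blast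
  next
    case False
    then have "c (\<delta> u) = 0" by (simp add: c_def)
    then show ?thesis using left_ideal_0[OF I] by simp
  qed
  ultimately have "P * Y * \<rho> t a j \<in> coeffs_in J (Suc n)"
    unfolding eq
    by (intro left_ideal_add[OF I] left_ideal_mult[OF I left_ideal_sum[OF I]])
  then have "C * (P * Y * \<rho> t a j) \<in> coeffs_in J (Suc n)" by (rule left_ideal_mult[OF I])
  moreover have "Q * \<rho> t a j = \<rho> t a j"
    using arg_cong[OF QZ, of "\<lambda>y. y * \<rho> t a j"] Z_\<rho>[OF Suc.prems(1)] Suc.prems(3)
    by (simp add: distrib_right)
  then have "C * (P * Y * \<rho> t a j) = C * (P * Y * Q) * \<rho> t a j" by (simp only: mult.assoc)
  then have "C * (P * Y * \<rho> t a j) = \<rho> t a j" using \<open>Q * \<rho> t a j = \<rho> t a j\<close> by (simp only: C(3))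
  ultimately show ?case by simp
qed

text \<open>By \<open>F_injective_between\<close> the component of \<open>\<Pi>\<^bsub><\<xi>/2\<^esub> Y t = 0\<close> of weight \<open>q = p - 1\<close> determines the
  component of \<open>t\<close> of weight \<open>p\<close> from those of weight at most \<open>p - 1/2\<close>.  The summand of \<open>Y\<close> for \<open>u\<close>
  raises the order by \<open>2 (1 - \<delta> u)\<close> and uses weight \<open>q + \<delta> u\<close>, which keeps the bound
  \<open>2 (p + \<xi>/2)\<close> on the order.  The induction runs over a bound \<open>k\<close> for the number of
  steps of size \<open>1/2\<close> from \<open>-\<xi>/2\<close> up to \<open>p\<close>.\<close>

lemma t_polynomial:
  assumes hw: "\<And>k v. k \<in> half_ints \<Longrightarrow> k < \<xi>/2 \<Longrightarrow> highest_weight_vector (\<phi> x) (\<phi> e) k v \<Longrightarrow> k \<le> l"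
    and l: "0 \<le> l" "l < \<xi>/2"
  shows "p < - l \<Longrightarrow> p \<le> - (\<xi>/2) + real k / 2 \<Longrightarrow> 2 * (p + \<xi>/2) < real n \<Longrightarrow> entry (pr {p} * t) i j n = 0"
proof (induction k arbitrary: p n i j)
  case 0
  show ?case
  proof (cases "p = - (\<xi>/2)")
    case True
    then show ?thesis using 0 by (simp add: Zt entry_cst)
  next
    case False
    then have "pr {p} = 0" using 0 by (intro pr_eq_0) auto
    then show ?thesis by simp
  qed
next
  case (Suc k)
  show ?case
  proof (cases "p \<le> - (\<xi>/2) + real k / 2")
    case True
    then show ?thesis using Suc.IH Suc.prems by blast
  next
    case False
    then have p: "- (\<xi>/2) < p" by (smt (verit) of_nat_0_le_iff divide_nonneg_nonneg)
    define q where "q = p - 1"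
    have IH: "entry (pr {p'} * t) i j n = 0" if "p' \<le> p - 1/2" "2 * (p' + \<xi>/2) < real n" for p' i j n
    proof (rule Suc.IH)
      show "p' < - l" using Suc.prems(1) that(1) by linarith
      show "p' \<le> - (\<xi>/2) + real k / 2"
        using Suc.prems(2) that(1) by (simp only: of_nat_Suc add_divide_distrib)
    qed (rule that(2))
    have qP: "pr {q} * P = pr {q}" using Suc.prems l by (simp add: pr_pr q_def)
    have "pr {q} * (Y * t) = pr {q} * (P * Y * t)" by (simp only: mult.assoc[symmetric] qP)
    then have 0: "pr {q} * (Y * t) = 0" by (simp add: PYt)
    define h where "h d = (if d \<le> 1/2 then zpow (1 - d) else 0)" for d :: real
    have zc: "pr {q} * (zv ^ k * y) = zv ^ k * (pr {q} * y)" for k y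
      by (rule zv_left_commute)
    have hc: "pr {q} * (h d * y) = h d * (pr {q} * y)" for d y by (simp add: h_def zc)
    have A: "pr {q} * \<Phi> f = \<Phi> f * pr {p}" using pr_\<Phi>1[OF f_weight, of q] by (simp add: q_def)
    have U: "pr {q} * (h (\<delta> u) * (G u * \<Phi> (du u)) * t) = h (\<delta> u) * (G u * (\<Phi> (du u) * (pr {q + \<delta> u} * t)))"
      if "u \<in> B" for u
    proof -
      have "pr {q} * (h (\<delta> u) * (G u * \<Phi> (du u)) * t) = h (\<delta> u) * (pr {q} * G u * \<Phi> (du u) * t)"
        by (simp add: hc mult.assoc)
      also have "pr {q} * G u = G u * pr {q}" by (rule scal_cst_commute[symmetric])
      also have "G u * pr {q} * \<Phi> (du u) = G u * (\<Phi> (du u) * pr {q + \<delta> u})"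
        using pr_\<Phi>1[OF du_weight[OF that], of q] by (simp add: mult.assoc)
      finally show ?thesis by (simp add: mult.assoc)
    qed
    have Dq: "pr {q} * D = D * pr {q}"
    proof -
      have "pr {q} * (\<Phi> (du u) * \<Phi> u) = \<Phi> (du u) * \<Phi> u * pr {q}" if "u \<in> B" for u
      proof -
        have "pr {q} * (\<Phi> (du u) * \<Phi> u) = \<Phi> (du u) * (pr {q + \<delta> u} * \<Phi> u)"
          using pr_\<Phi>1[OF du_weight[OF that], of q] by (simp flip: mult.assoc)
        then show ?thesis using pr_\<Phi>1[of u "\<delta> u" "q + \<delta> u"] weight_B[OF that] by (simp add: mult.assoc)
      qed
      then have "pr {q} * ((if b then 1 else 0) * (\<Phi> (du u) * \<Phi> u)) = (if b then 1 else 0) * (\<Phi> (du u) * \<Phi> u) * pr {q}"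
        if "u \<in> B" for b u using that by simp
      then show ?thesis unfolding D_def by (simp add: sum_distrib_left sum_distrib_right)
    qed
    have "pr {q} * (Y * t) = pr {q} * t + pr {q} * \<Phi> f * t
        + (\<Sum>u\<in>B. pr {q} * (h (\<delta> u) * (G u * \<Phi> (du u)) * t)) + zv ^ 2 * (pr {q} * D * t)"
      unfolding Y_def h_def[symmetric]
      by (simp add: distrib_left distrib_right sum_distrib_left sum_distrib_right mult.assoc zc)
    also have "\<dots> = pr {q} * t + \<Phi> f * (pr {p} * t)
        + (\<Sum>u\<in>B. h (\<delta> u) * (G u * (\<Phi> (du u) * (pr {q + \<delta> u} * t)))) + zv ^ 2 * (D * (pr {q} * t))"
    proof -
      have "(\<Sum>u\<in>B. pr {q} * (h (\<delta> u) * (G u * \<Phi> (du u)) * t))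
        = (\<Sum>u\<in>B. h (\<delta> u) * (G u * (\<Phi> (du u) * (pr {q + \<delta> u} * t))))"
        by (rule sum.cong[OF refl U])
      then show ?thesis unfolding A Dq by (simp only: mult.assoc)
    qed
    finally have eq: "\<Phi> f * (pr {p} * t) = - (pr {q} * t)
        - (\<Sum>u\<in>B. h (\<delta> u) * (G u * (\<Phi> (du u) * (pr {q + \<delta> u} * t)))) - zv ^ 2 * (D * (pr {q} * t))"
      unfolding 0 by (simp add: algebra_simps add_eq_0_iff)
    have Dc: "D = cst (D_op form \<phi> x B)"
      using Y_op_eq by (simp add: D_def D_op_def cst_uminus cst_sum cst_mult sum.inter_restrict[OF finite_B] B_in_ad_sum if_distrib if_distribR cong: if_cong)
    have F0: "entry (\<Phi> f * (pr {p} * t)) i j n = 0" if n: "2 * (p + \<xi>/2) < real n" for i j n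
    proof -
      have 1: "entry (pr {q} * t) i j n = 0" by (rule IH) (use n in \<open>auto simp: q_def\<close>)
      have 2: "entry (h (\<delta> u) * (G u * (\<Phi> (du u) * (pr {q + \<delta> u} * t)))) i j n = 0" if u: "u \<in> B" for u
      proof (cases "\<delta> u \<le> 1/2")
        case True
        obtain d :: int where d: "\<delta> u = d / 2" using weight_B[OF u] by (auto simp: half_ints_def)
        have "2 * (1 - \<delta> u) = of_int (2 - d)" using d by simp
        then have N: "nat \<lfloor>2 * (1 - \<delta> u)\<rfloor> = nat (2 - d)" by (simp only: floor_of_int)
        have "d \<le> 1" using True d by simp
        have "entry (pr {q + \<delta> u} * t) i' j (n - nat (2 - d)) = 0" if "nat (2 - d) \<le> n" for i'
        proof (rule IH)
          show "q + \<delta> u \<le> p - 1/2" using True by (simp add: q_def)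
          show "2 * (q + \<delta> u + \<xi>/2) < real (n - nat (2 - d))"
            using n that \<open>d \<le> 1\<close> by (simp add: q_def d of_nat_diff)
        qed
        then show ?thesis
          using True N by (simp add: h_def entry_zv_power entry_scal_mult entry_cst_mult)
      qed (simp add: h_def)
      have 3: "entry (zv ^ 2 * (D * (pr {q} * t))) i j n = 0"
      proof (cases "n < 2")
        case False
        have "entry (pr {q} * t) i' j (n - 2) = 0" for i'
          by (rule IH) (use n False in \<open>auto simp: q_def of_nat_diff\<close>)
        then show ?thesis unfolding Dc by (simp add: entry_zv_power entry_cst_mult)
      qed (simp add: entry_zv_power)
      show ?thesis unfolding eq by (simp add: 1 2 3 entry_sum)
    qed
    have "\<exists>H. H ** \<phi> f ** wp {p} = wp {p}"
      by (rule sl2.F_left_inverse) (rule sl2.F_injective_between[OF hw p Suc.prems(1)])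
    then obtain H where H: "H ** \<phi> f ** wp {p} = wp {p}" by blast
    have "pr {p} * t = cst H * (\<Phi> f * (pr {p} * t))"
    proof -
      have "cst H * (\<Phi> f * (pr {p} * t)) = cst (H ** \<phi> f ** wp {p}) * t"
        by (simp only: cst_mult mult.assoc)
      then show ?thesis by (simp only: H)
    qed
    then have "entry (pr {p} * t) i j n = entry (cst H * (\<Phi> f * (pr {p} * t))) i j n" by simp
    also have "\<dots> = 0" using F0[OF Suc.prems(3)] by (simp add: entry_cst_mult)
    finally show ?thesis .
  qed
qed

text \<open>As \<open>\<Pi>\<^sub>W\<close> kills \<open>V[-\<xi>/2]\<close>, the coefficients of \<open>\<Pi>\<^sub>W L\<^sub>R\<close> are those of \<open>-\<Pi>\<^sub>W t\<close>.  By the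
  transformation law their commutator with \<open>a\<close> of weight \<open>j\<close> is, modulo \<open>J\<close>, a coefficient of
  \<open>\<Pi>\<^sub>W \<phi>(a) t\<close>, which involves only the component of \<open>t\<close> of weight \<open>-l - j\<close>, and the order
  \<open>2b - 2j > 2 (-l - j + \<xi>/2)\<close> exceeds the bound of \<open>t_polynomial\<close>.\<close>

lemma W_coefficient_invariant:
  assumes hw: "\<And>k v. k \<in> half_ints \<Longrightarrow> k < \<xi>/2 \<Longrightarrow> highest_weight_vector (\<phi> x) (\<phi> e) k v \<Longrightarrow> k \<le> l"
    and l: "highest_weight_vector (\<phi> x) (\<phi> e) l v" "l < \<xi>/2"
    and b: "b \<in> half_ints" "\<xi>/2 - l < b"
    and a: "a \<in> ad_sum x {1/2..}"
  defines "w \<equiv> \<lambda>i h. entry (cst (W_proj (\<phi> x) (\<phi> e) (\<phi> f) l) * L) i h (nat \<lfloor>2 * b\<rfloor>)"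
  shows "uea_gen a * w i h - w i h * uea_gen a \<in> J"
proof -
  let ?W = "cst (W_proj (\<phi> x) (\<phi> e) (\<phi> f) l) :: ('g uea fps, 'n) sqmat"
  let ?b = "nat \<lfloor>2 * b\<rfloor>"
  obtain k :: nat where "l = real k / 2" using sl2.highest_weight_nonneg[OF l(1)] .
  then have l0: "0 \<le> l" by simp
  have Wl: "?W * pr {- l} = ?W" using sl2.W_proj_mult_weight_proj[OF l(1)] by (simp flip: cst_mult)
  have "{- l} \<inter> {- (\<xi>/2)} = {}" using l(2) by auto
  then have "pr {- l} * Z = 0" by (simp only: pr_pr sl2.weight_proj_empty cst_0)
  then have "?W * pr {- l} * Z = 0" by (simp only: mult.assoc mult_zero_right)
  then have "?W * Z = 0" by (simp only: Wl)
  then have WL: "?W * L = - (?W * t)" by (simp add: t_def right_diff_distrib)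
  have eig: "uea_gen a * w i h - w i h * uea_gen a \<in> J"
    if a: "a \<in> ad_space x j" and j: "1/2 \<le> j" for a j
  proof (cases "j \<in> half_ints")
    case False
    then have "a = 0" using ad_space_zero a by blast
    moreover have "uea_gen (0::'g) = 0" using uea_gen_add[of 0 0] by simp
    ultimately show ?thesis using left_ideal_0[OF left_ideal_W_ideal] by simp
  next
    case True
    have "G a * (?W * L) - ?W * L * G a = - (?W * (G a * t - t * G a))"
    proof -
      have "G a * (?W * t) = ?W * (G a * t)" by (simp only: mult.assoc[symmetric] scal_cst_commute)
      then show ?thesis unfolding WL by (simp add: right_diff_distrib mult.assoc)
    qed
    also have "\<dots> = - (?W * \<rho> t a j) + ?W * (zpow j * (\<Phi> a * t))"
      by (simp add: \<rho>_def distrib_left)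
    also have "?W * (zpow j * (\<Phi> a * t)) = zpow j * (?W * (\<Phi> a * t))"
      by (rule zv_left_commute)
    also have "?W * (\<Phi> a * t) = ?W * (\<Phi> a * (pr {- l - j} * t))"
    proof -
      have "?W * (\<Phi> a * t) = ?W * (pr {- l} * \<Phi> a * t)" by (simp only: mult.assoc[symmetric] Wl)
      then show ?thesis by (simp only: pr_\<Phi>1[OF a] mult.assoc)
    qed
    finally have "entry (G a * (?W * L) - ?W * L * G a) i h ?b
      = - entry (?W * \<rho> t a j) i h ?b + entry (zpow j * (?W * (\<Phi> a * (pr {- l - j} * t)))) i h ?b"
      by simp
    moreover have "entry (zpow j * (?W * (\<Phi> a * (pr {- l - j} * t)))) i h ?b = 0"
    proof (cases "?b < nat \<lfloor>2 * j\<rfloor>")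
      case False
      obtain b' j' :: int where bj: "b = b' / 2" "j = j' / 2" using b(1) True by (auto simp: half_ints_def)
      then have bj2: "2 * b = of_int b'" "2 * j = of_int j'" by simp_all
      then have fl: "\<lfloor>2 * b\<rfloor> = b'" "\<lfloor>2 * j\<rfloor> = j'" by (simp_all only: floor_of_int)
      have "0 \<le> real_of_int b'" "0 \<le> real_of_int j'"
        unfolding bj2[symmetric] using b(2) l(2) j by simp_all
      then have "0 \<le> b'" "0 \<le> j'" by simp_all
      then have n: "real (?b - nat \<lfloor>2 * j\<rfloor>) = 2 * b - 2 * j"
        using False unfolding fl bj2 not_less by (subst of_nat_diff) simp_all
      obtain k :: nat where k: "2 * (- l - j + \<xi>/2) \<le> real k" using real_arch_simple by blast
      have "entry (pr {- l - j} * t) i' h (?b - nat \<lfloor>2 * j\<rfloor>) = 0" for i'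
        using t_polynomial[OF hw l0 l(2), where p = "- l - j" and k = k] j b(2) n k by simp
      then show ?thesis by (simp add: entry_zv_power entry_cst_mult)
    qed (simp add: entry_zv_power)
    moreover have "entry (?W * \<rho> t a j) i h ?b \<in> J"
      using left_ideal_mult[OF left_ideal_coeffs_in[OF left_ideal_W_ideal] \<rho>_coeffs_in[OF a True j]]
      unfolding coeffs_in_def by blast
    ultimately have "entry (G a * (?W * L) - ?W * L * G a) i h ?b \<in> J"
      using left_ideal_uminus[OF left_ideal_W_ideal] by simp
    then show ?thesis by (simp add: w_def entry_scal_mult entry_mult_scal)
  qed
  have "ad_sum x {1/2..} \<subseteq> {a. uea_gen a * w i h - w i h * uea_gen a \<in> J}"
    unfolding ad_sum_def
  proof (rule lie_vs.span_minimal)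
    show "(\<Union>k\<in>{1/2..}. ad_space x k) \<subseteq> {a. uea_gen a * w i h - w i h * uea_gen a \<in> J}"
      using eig by auto
    show "lie_vs.subspace {a. uea_gen a * w i h - w i h * uea_gen a \<in> J}"
    proof (rule lie_vs.subspaceI, goal_cases)
      case 1
      have "0 \<in> ad_space x (1/2)" using lie_vs.subspace_0[OF subspace_ad_space] .
      then show ?case using eig by auto
    next
      case (2 a a')
      have "uea_gen (a + a') * w i h - w i h * uea_gen (a + a')
        = (uea_gen a * w i h - w i h * uea_gen a) + (uea_gen a' * w i h - w i h * uea_gen a')"
        by (simp add: uea_gen_add algebra_simps)
      then show ?case using 2 left_ideal_add[OF left_ideal_W_ideal] by simp
    next
      case (3 c a)
      have "w i h * (uea_const c * uea_gen a) = uea_const c * (w i h * uea_gen a)"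
        by (metis mult.assoc uea_const_central)
      then have "uea_gen (c *\<^sub>C a) * w i h - w i h * uea_gen (c *\<^sub>C a)
        = uea_const c * (uea_gen a * w i h - w i h * uea_gen a)"
        by (simp add: uea_gen_scale right_diff_distrib mult.assoc)
      then show ?case using 3 left_ideal_mult[OF left_ideal_W_ideal] by simp
    qed
  qed
  then show ?thesis using a by blast
qed

end

lemma quot_class_zero: "left_ideal J \<Longrightarrow> a \<in> J \<Longrightarrow> quot_class J a = quot_class J 0"
  unfolding quot_class_def using left_ideal_add[of J _ a] left_ideal_diff[of J _ a]
  by (auto) (metis diff_add_cancel)

theorem theorem1p1:
  fixes form :: "'g::complex_lie_algebra \<Rightarrow> 'g \<Rightarrow> complex"
    and f x e :: 'g
    and \<phi> :: "'g \<Rightarrow> complex ^ 'n ^ 'n"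
    and B :: "'g set"
    and \<xi> l b :: real
  assumes "reductive TYPE('g)"
    and "sym_nondeg_invariant_form form"
    and "ad_nilpotent f"
    and "sl2_triple f x e"
    and "faithful_representation \<phi>"
    and "ad_eigenbasis x B"
    and "is_weight (\<phi> x) (\<xi>/2)"
    and "\<And>k. is_weight (\<phi> x) k \<Longrightarrow> k \<le> \<xi>/2"
    and "\<exists>k k' v v'. k \<noteq> k' \<and> highest_weight_vector (\<phi> x) (\<phi> e) k v
           \<and> highest_weight_vector (\<phi> x) (\<phi> e) k' v'"
    and "l \<in> half_ints" and "l < \<xi>/2"
    and "\<exists>v. highest_weight_vector (\<phi> x) (\<phi> e) l v"
    and "\<And>k v. k \<in> half_ints \<Longrightarrow> k < \<xi>/2 \<Longrightarrow> highest_weight_vector (\<phi> x) (\<phi> e) k v \<Longrightarrow> k \<le> l"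
    and "b \<in> half_ints" and "b > \<xi>/2 - l"
  shows "\<forall>i j. quot_class (W_ideal form f x)
           (z_coeff b (const_op (W_proj (\<phi> x) (\<phi> e) (\<phi> f) l)
                       ** L_R form \<phi> f x B \<xi>
                       ** const_op (weight_proj (\<phi> x) {- (\<xi>/2)})) $ i $ j)
         \<in> finite_W_algebra form f x"
proof (intro allI)
  fix i j :: 'n
  interpret lax_setting form f x e \<phi> B \<xi>
    using assms(1,2,4-8) by unfold_locales
  obtain v where v: "highest_weight_vector (\<phi> x) (\<phi> e) l v" using assms(12) by blast
  let ?w = "entry (cst (W_proj (\<phi> x) (\<phi> e) (\<phi> f) l) * L) i j (nat \<lfloor>2 * b\<rfloor>)"
  have "Sqmat (const_op (W_proj (\<phi> x) (\<phi> e) (\<phi> f) l) ** L_R form \<phi> f x B \<xi>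
      ** const_op (weight_proj (\<phi> x) {- (\<xi>/2)})) = cst (W_proj (\<phi> x) (\<phi> e) (\<phi> f) l) * L"
    unfolding Sqmat_simps cst_def[symmetric] L_R_eq by (simp add: LZ mult.assoc)
  then have "z_coeff b (const_op (W_proj (\<phi> x) (\<phi> e) (\<phi> f) l) ** L_R form \<phi> f x B \<xi>
      ** const_op (weight_proj (\<phi> x) {- (\<xi>/2)})) $ i $ j = ?w"
    unfolding z_coeff_def entry_def by (metis (no_types, lifting) Sqmat_inverse UNIV_I vec_lambda_beta)
  moreover have "\<forall>a\<in>ad_sum x {1/2..}. quot_class (W_ideal form f x) (uea_gen a * ?w - ?w * uea_gen a)
      = quot_class (W_ideal form f x) 0"
    using W_coefficient_invariant[OF assms(13) v assms(11,14,15)]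
    by (intro ballI quot_class_zero left_ideal_W_ideal)
  ultimately show "quot_class (W_ideal form f x)
       (z_coeff b (const_op (W_proj (\<phi> x) (\<phi> e) (\<phi> f) l) ** L_R form \<phi> f x B \<xi>
          ** const_op (weight_proj (\<phi> x) {- (\<xi>/2)})) $ i $ j) \<in> finite_W_algebra form f x"
    unfolding finite_W_algebra_def by auto
qed

end
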